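(* Let $n,d\ge1$, $\sigma>0$, and let $W\in\mathbb{R}^{nd\times nd}$ be a random symmetric matrix with $d\times d$ blocks $W_{ij}$, $W_{ji}=W_{ij}^{\top}$, $W_{ii}=0$, whose entries in the blocks $W_{ij}$, $i<j$, are i.i.d. standard Gaussian. Let $Z\in\mathbb{R}^{nd\times d}$ with $Z^{\top}=[I_d,\dots,I_d]$ and $A=ZZ^{\top}+\sigma W$, i.e. $A_{ij}=I_d+\sigma W_{ij}$ for $i\neq j$ and $A_{ii}=I_d$. There is a small absolute constant $C_0>0$ such that if \[ \sigma\le \frac{C_0\,n^{1/4}}{d^{3/4}}, \] then with high probability the solution of the semidefinite program \[ \max_{X\in\mathbb{R}^{nd\times nd}}\ \langle A,X\rangle\quad\text{s.t.}\quad X_{ii}=I_d\ (1\le i\le n),\ X\succeq0 \] is exactly of rank $d$ (and hence coincides with the global maximizer of $\max_{R_i\in O(d)}\sum_{i,j}\langle R_iR_j^{\top},A_{ij}\rangle$).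
   Context: $O(d)$ is the group of $d\times d$ orthogonal matrices and $\langle X,Y\rangle=\mathrm{Tr}(XY^{\top})$. This is orthogonal group synchronization $A_{ij}=G_iG_j^{\top}+\sigma W_{ij}$ with Gaussian noise, written (as the paper does throughout) in the coordinates where the ground truth is $G_i=I_d$; by orthogonal invariance of the Gaussian noise this is no loss. *)

theory Defs
  imports "HOL-Probability.Probability" "Jordan_Normal_Form.DL_Rank"
begin

text \<open>An nd x nd matrix is viewed as n x n blocks of size d x d; entry (a,b) of block (i,j)
  is the matrix entry (i*d+a, j*d+b).\<close>

text \<open>Index set of the i.i.d. standard Gaussian entries: entry (a,b) of block W_ij, i<j.\<close>
definition gidx :: "nat \<Rightarrow> nat \<Rightarrow> (nat \<times> nat \<times> nat \<times> nat) set" where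
  "gidx n d = {(i,j,a,b). i < j \<and> j < n \<and> a < d \<and> b < d}"

definition std_gauss :: "real measure" where
  "std_gauss = density lborel std_normal_density"

definition gauss_space :: "nat \<Rightarrow> nat \<Rightarrow> (nat \<times> nat \<times> nat \<times> nat \<Rightarrow> real) measure" where
  "gauss_space n d = PiM (gidx n d) (\<lambda>_. std_gauss)"

definition Wmat :: "nat \<Rightarrow> nat \<Rightarrow> (nat \<times> nat \<times> nat \<times> nat \<Rightarrow> real) \<Rightarrow> real mat" where
  "Wmat n d g = mat (n*d) (n*d) (\<lambda>(p,q).
      let i = p div d; a = p mod d; j = q div d; b = q mod d in
      if i < j then g (i,j,a,b) else if j < i then g (j,i,b,a) else 0)"

definition Zmat :: "nat \<Rightarrow> nat \<Rightarrow> real mat" where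
  "Zmat n d = mat (n*d) d (\<lambda>(p,b). if p mod d = b then 1 else 0)"

definition Amat :: "nat \<Rightarrow> nat \<Rightarrow> real \<Rightarrow> (nat \<times> nat \<times> nat \<times> nat \<Rightarrow> real) \<Rightarrow> real mat" where
  "Amat n d \<sigma> g = Zmat n d * (Zmat n d)\<^sup>T + \<sigma> \<cdot>\<^sub>m Wmat n d g"

definition frob :: "nat \<Rightarrow> real mat \<Rightarrow> real mat \<Rightarrow> real" where
  "frob N X Y = (\<Sum>p<N. \<Sum>q<N. X $$ (p,q) * Y $$ (p,q))"

definition psd :: "nat \<Rightarrow> real mat \<Rightarrow> bool" where
  "psd N X \<longleftrightarrow> X \<in> carrier_mat N N \<and> X\<^sup>T = X \<and>
     (\<forall>v \<in> carrier_vec N. v \<bullet> (X *\<^sub>v v) \<ge> 0)"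

definition sdp_feasible :: "nat \<Rightarrow> nat \<Rightarrow> real mat \<Rightarrow> bool" where
  "sdp_feasible n d X \<longleftrightarrow> psd (n*d) X \<and>
     (\<forall>i<n. \<forall>a<d. \<forall>b<d. X $$ (i*d+a, i*d+b) = (if a = b then 1 else 0))"

definition sdp_solution :: "nat \<Rightarrow> nat \<Rightarrow> real mat \<Rightarrow> real mat \<Rightarrow> bool" where
  "sdp_solution n d A X \<longleftrightarrow> sdp_feasible n d X \<and>
     (\<forall>Y. sdp_feasible n d Y \<longrightarrow> frob (n*d) A Y \<le> frob (n*d) A X)"

definition block_orth :: "nat \<Rightarrow> nat \<Rightarrow> real mat \<Rightarrow> bool" where
  "block_orth n d R \<longleftrightarrow> R \<in> carrier_mat (n*d) d \<and>
     (\<forall>i<n. let Ri = mat d d (\<lambda>(a,b). R $$ (i*d+a, b)) in Ri\<^sup>T * Ri = 1\<^sub>m d)"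

text \<open>Objective sum_{i,j} <R_i R_j^T, A_ij> = <R R^T, A>.\<close>
definition od_solution :: "nat \<Rightarrow> nat \<Rightarrow> real mat \<Rightarrow> real mat \<Rightarrow> bool" where
  "od_solution n d A R \<longleftrightarrow> block_orth n d R \<and>
     (\<forall>R'. block_orth n d R' \<longrightarrow> frob (n*d) (R' * R'\<^sup>T) A \<le> frob (n*d) (R * R\<^sup>T) A)"

definition good_event :: "nat \<Rightarrow> nat \<Rightarrow> real \<Rightarrow> (nat \<times> nat \<times> nat \<times> nat \<Rightarrow> real) \<Rightarrow> bool" where
  "good_event n d \<sigma> g \<longleftrightarrow>
     (\<exists>!X. sdp_solution n d (Amat n d \<sigma> g) X) \<and>
     (\<forall>X. sdp_solution n d (Amat n d \<sigma> g) X \<longrightarrow>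
        vec_space.rank (n*d) X = d \<and>
        (\<exists>R. od_solution n d (Amat n d \<sigma> g) R \<and> X = R * R\<^sup>T))"

end

theory Submission
  imports Defs "HOL-Real_Asymp.Real_Asymp"
begin

text \<open>
  Write X for a solution of the semidefinite program, N = nd, and let Z stack n identity blocks.
  Testing optimality of X against D X D + y y^T, where D is the block diagonal matrix with blocks
  I - eps u_i u_i^T and y_i = sqrt (eps (2 - eps |u_i|^2)) u_i, and letting eps tend to 0 gives a dual
  certificate without any appeal to strong duality: with Lam the block diagonal part of the
  symmetrised product A X, the matrix L = Lam - A is positive semidefinite, and the inner product of L with Y measures the
  optimality gap of every feasible Y, so L annihilates every solution.  It then suffices that the
  kernel of L meets the orthogonal complement of the columns of Z trivially: every solution is
  then R R^T for R the first block column of X.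

  For u in that kernel and orthogonal to Z one has Lam u = sigma W u, so it is enough that
  |Lam u| is at least a constant times n |u|.  In the seminorm q(u)^2 = u^T X u, which is
  Euclidean on vectors supported in one block, q(Lam u) = q(A u) is at least q(Z x) - sigma q(W u).
  Positivity of L on the range of Z bounds q(Z x) from below.  Splitting X along the range of Z and its
  complement bounds q(W u) by the operator norm of the d x d blocks of W Z and by the operator
  norm of W times the distance of X to the range of Z; comparing the objective values of X and Z Z^T
  shows that this distance is O(sigma d).  The resulting requirement
  sigma^2 sqrt(n) d^(3/2) = O(n) is the assumed noise level.  The operator norms are
  controlled by a union bound over a lattice net.
\<close>

section \<open>Matrices and vectors as real functions on an initial segment\<close>

text \<open>The obstacle is that X depends on W, so concentration for a fixed matrix says nothing
  about the blocks of W X. The noise is therefore used only through two bounds valid for all test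
  vectors at once: the operator norm of W and that of each d x d block of W Z, with Z fixed. The
  dependence of X on W is condensed into one scalar, the squared distance \<open>T\<close> of X from
  the range of Z. Its square root multiplies the operator norm of W and is itself bounded by a
  multiple of that norm; this product of two noise factors fixes the exponents of n and d.

  The seminorm is chosen because Lam agrees with A on every Gram vector of X, so inside it Lam may
  be replaced by A, while on a single block it is the Euclidean norm and nothing is lost on the way
  back to Lam.

  The kernel of L contains the columns of X, so it cannot be trivial; excluding vectors orthogonal
  to Z leaves dimension at most d, which yields uniqueness and the rank together.

  The constants are not tuned: 1/25, 1/20 and 1/100 are fractions of n conceded to noise terms, and
  1/1000 is 1/25 divided by the factor 40 of the operator norm bounds.\<close>

definition inner_upto :: "nat \<Rightarrow> (nat \<Rightarrow> real) \<Rightarrow> (nat \<Rightarrow> real) \<Rightarrow> real" where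
  "inner_upto N u v = (\<Sum>p<N. u p * v p)"

definition mat_vec :: "nat \<Rightarrow> (nat \<Rightarrow> nat \<Rightarrow> real) \<Rightarrow> (nat \<Rightarrow> real) \<Rightarrow> nat \<Rightarrow> real" where
  "mat_vec N M u = (\<lambda>p. \<Sum>q<N. M p q * u q)"

definition bilin :: "nat \<Rightarrow> (nat \<Rightarrow> nat \<Rightarrow> real) \<Rightarrow> (nat \<Rightarrow> real) \<Rightarrow> (nat \<Rightarrow> real) \<Rightarrow> real" where
  "bilin N M u v = inner_upto N u (mat_vec N M v)"

definition norm_upto :: "nat \<Rightarrow> (nat \<Rightarrow> real) \<Rightarrow> real" where
  "norm_upto N u = L2_set u {..<N}"

definition sym_upto :: "nat \<Rightarrow> (nat \<Rightarrow> nat \<Rightarrow> real) \<Rightarrow> bool" where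
  "sym_upto N M \<longleftrightarrow> (\<forall>p<N. \<forall>q<N. M p q = M q p)"

definition psd_upto :: "nat \<Rightarrow> (nat \<Rightarrow> nat \<Rightarrow> real) \<Rightarrow> bool" where
  "psd_upto N M \<longleftrightarrow> sym_upto N M \<and> (\<forall>u. bilin N M u u \<ge> 0)"

definition frob_upto :: "nat \<Rightarrow> (nat \<Rightarrow> nat \<Rightarrow> real) \<Rightarrow> (nat \<Rightarrow> nat \<Rightarrow> real) \<Rightarrow> real" where
  "frob_upto N A X = (\<Sum>p<N. \<Sum>q<N. A p q * X p q)"

lemma bilin_eq: "bilin N M u v = (\<Sum>p<N. \<Sum>q<N. M p q * (u p * v q))"
  by (simp add: bilin_def inner_upto_def mat_vec_def sum_distrib_left algebra_simps)

lemma inner_upto_commute: "inner_upto N u v = inner_upto N v u"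
  by (simp add: inner_upto_def mult.commute)

lemma inner_upto_add_right: "inner_upto N u (\<lambda>p. v p + w p) = inner_upto N u v + inner_upto N u w"
  by (simp add: inner_upto_def algebra_simps sum.distrib)

lemma inner_upto_add_left: "inner_upto N (\<lambda>p. v p + w p) u = inner_upto N v u + inner_upto N w u"
  by (simp add: inner_upto_def algebra_simps sum.distrib)

lemma inner_upto_scale_right: "inner_upto N u (\<lambda>p. c * v p) = c * inner_upto N u v"
  by (simp add: inner_upto_def algebra_simps sum_distrib_left)

lemma inner_upto_scale_left: "inner_upto N (\<lambda>p. c * v p) u = c * inner_upto N v u"
  by (simp add: inner_upto_def algebra_simps sum_distrib_left)

lemma inner_upto_sum_right: "inner_upto N u (\<lambda>p. \<Sum>k\<in>K. v k p) = (\<Sum>k\<in>K. inner_upto N u (v k))"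
  unfolding inner_upto_def sum_distrib_left by (rule sum.swap)

lemma mat_vec_add: "mat_vec N M (\<lambda>q. u q + v q) = (\<lambda>p. mat_vec N M u p + mat_vec N M v p)"
  by (simp add: mat_vec_def algebra_simps sum.distrib)

lemma bilin_add_right: "bilin N M u (\<lambda>p. v p + w p) = bilin N M u v + bilin N M u w"
  by (simp add: bilin_def mat_vec_add inner_upto_add_right)

lemma bilin_add_left: "bilin N M (\<lambda>p. v p + w p) u = bilin N M v u + bilin N M w u"
  by (simp add: bilin_def inner_upto_add_left)

lemma bilin_matrix_add: "bilin N (\<lambda>p q. M p q + c * L p q) u v = bilin N M u v + c * bilin N L u v"
  by (simp add: bilin_eq algebra_simps sum.distrib sum_distrib_left)

lemma bilin_commute: "sym_upto N M \<Longrightarrow> bilin N M u v = bilin N M v u"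
  unfolding bilin_eq by (subst sum.swap) (auto simp: sym_upto_def intro!: sum.cong)

lemma inner_upto_self: "inner_upto N u u = (norm_upto N u)\<^sup>2"
  by (simp add: inner_upto_def norm_upto_def L2_set_def sum_nonneg power2_eq_square)

lemma norm_upto_nonneg [simp]: "0 \<le> norm_upto N u"
  by (simp add: norm_upto_def)

lemma norm_upto_eq_0: "norm_upto N u = 0 \<longleftrightarrow> (\<forall>p<N. u p = 0)"
  by (auto simp: norm_upto_def L2_set_eq_0_iff)

lemma norm_upto_scale: "norm_upto N (\<lambda>p. c * u p) = \<bar>c\<bar> * norm_upto N u"
  by (simp add: norm_upto_def L2_set_def power_mult_distrib real_sqrt_mult flip: sum_distrib_left)

lemma norm_upto_cong: "(\<And>p. p < N \<Longrightarrow> u p = v p) \<Longrightarrow> norm_upto N u = norm_upto N v"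
  by (simp add: norm_upto_def L2_set_def)

lemma abs_inner_upto_le: "\<bar>inner_upto N u v\<bar> \<le> norm_upto N u * norm_upto N v"
proof -
  have "\<bar>inner_upto N u v\<bar> \<le> (\<Sum>p<N. \<bar>u p\<bar> * \<bar>v p\<bar>)"
    unfolding inner_upto_def by (rule order_trans[OF sum_abs]) (simp add: abs_mult)
  also have "\<dots> \<le> norm_upto N u * norm_upto N v" unfolding norm_upto_def by (rule L2_set_mult_ineq)
  finally show ?thesis .
qed

lemma inner_upto_delta_left: "p < N \<Longrightarrow> inner_upto N (\<lambda>r. if r = p then 1 else 0) v = v p"
  by (simp add: inner_upto_def if_distrib[of "\<lambda>x. x * _"] cong: if_cong)

lemma mat_vec_delta: "q < N \<Longrightarrow> mat_vec N M (\<lambda>r. if r = q then 1 else 0) = (\<lambda>p. M p q)"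
  by (simp add: mat_vec_def if_distrib cong: if_cong)

lemma bilin_delta: "p < N \<Longrightarrow> q < N \<Longrightarrow>
    bilin N M (\<lambda>r. if r = p then 1 else 0) (\<lambda>r. if r = q then 1 else 0) = M p q"
  by (simp add: bilin_def inner_upto_delta_left mat_vec_delta)

lemma bilin_cong:
  "(\<And>p. p < N \<Longrightarrow> u p = u' p) \<Longrightarrow> (\<And>p. p < N \<Longrightarrow> v p = v' p) \<Longrightarrow> bilin N M u v = bilin N M u' v'"
  by (simp add: bilin_eq)

text \<open>Cholesky elimination of the last coordinate: the last column divided by the square root
  of the pivot is split off as a rank-one term, and the Schur complement \<open>M'\<close> is
  positive semidefinite because its form is the minimum of the given one over the last coordinate. A
  zero pivot forces its column to vanish.\<close>

lemma psd_upto_gram: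
  assumes "psd_upto N M"
  shows "\<exists>V. \<forall>p<N. \<forall>q<N. M p q = (\<Sum>k<N. V k p * V k q)"
  using assms
proof (induction N arbitrary: M)
  case 0
  then show ?case by simp
next
  case (Suc N)
  have sym: "M p q = M q p" if "p < Suc N" "q < Suc N" for p q
    using Suc.prems that by (auto simp: psd_upto_def sym_upto_def)
  have pos: "bilin (Suc N) M u u \<ge> 0" for u
    using Suc.prems by (auto simp: psd_upto_def)
  define m where "m = M N N"
  have split: "bilin (Suc N) M u u = bilin N M u u + 2 * u N * (\<Sum>p<N. M p N * u p) + m * (u N)\<^sup>2" for u
  proof -
    have "(\<Sum>q<N. M N q * (u N * u q)) = u N * (\<Sum>p<N. M p N * u p)"
      unfolding sum_distrib_left by (rule sum.cong) (auto simp: sym)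
    moreover have "(\<Sum>p<N. M p N * (u p * u N)) = u N * (\<Sum>p<N. M p N * u p)"
      unfolding sum_distrib_left by (rule sum.cong) auto
    ultimately show ?thesis
      by (simp add: bilin_eq sum.distrib m_def power2_eq_square)
  qed
  have "m \<ge> 0"
    using pos[of "\<lambda>p. if p = N then 1 else 0"] by (simp add: split bilin_eq m_def)
  \<comment> \<open>For \<open>m = 0\<close> division by zero yields \<open>W = 0\<close>, the right
    term in that case since the last column is zero.\<close>
  define W where "W = (\<lambda>p. M p N / sqrt m)"
  define M' where "M' = (\<lambda>p q. M p q - W p * W q)"
  have zero: "M p N = 0" if "m = 0" "p < N" for p
  proof -
    have *: "M p p + 2 * t * M p N \<ge> 0" for t
    proof -
      define e where "e = (\<lambda>r. if r = p then 1 else if r = N then t else 0 :: real)"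
      have "bilin N M e e = bilin N M (\<lambda>r. if r = p then 1 else 0) (\<lambda>r. if r = p then 1 else 0)"
        by (rule bilin_cong) (auto simp: e_def)
      then have "bilin N M e e = M p p" using that by (simp add: bilin_delta)
      moreover have "(\<Sum>r<N. M r N * e r) = inner_upto N (\<lambda>r. if r = p then 1 else 0) (\<lambda>r. M r N)"
        unfolding inner_upto_def by (rule sum.cong) (auto simp: e_def)
      then have "(\<Sum>r<N. M r N * e r) = M p N" using that by (simp add: inner_upto_delta_left)
      moreover have "e N = t" using that by (simp add: e_def)
      ultimately show ?thesis
        using pos[of e] that by (simp add: split)
    qed
    show ?thesis
    proof (rule ccontr)
      assume "M p N \<noteq> 0"
      \<comment> \<open>This t makes the left-hand side of the inequality equal to -1.\<close>
      then show False using *[of "- (M p p + 1) / (2 * M p N)"] by (simp add: field_simps)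
    qed
  qed
  have bil': "bilin N M' u u = bilin N M u u - (\<Sum>p<N. W p * u p)\<^sup>2" for u
    by (simp add: bilin_eq M'_def algebra_simps sum_subtractf power2_eq_square sum_product)
  have "psd_upto N M'"
    unfolding psd_upto_def
  proof (intro conjI allI)
    show "sym_upto N M'" using sym by (simp add: sym_upto_def M'_def)
    fix u
    \<comment> \<open>The minimiser of the quadratic in the last coordinate; for
      \<open>m = 0\<close> it evaluates to 0.\<close>
    define t where "t = - (\<Sum>p<N. M p N * u p) / m"
    have c: "bilin N M (u(N := t)) (u(N := t)) = bilin N M u u"
      "(\<Sum>p<N. M p N * (u(N := t)) p) = (\<Sum>p<N. M p N * u p)"
      by (simp_all add: bilin_eq)
    have w: "(\<Sum>p<N. W p * u p) = (\<Sum>p<N. M p N * u p) / sqrt m"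
      by (simp add: W_def sum_divide_distrib)
    have "0 \<le> bilin (Suc N) M (u(N := t)) (u(N := t))" by (rule pos)
    also have "\<dots> = bilin N M u u + 2 * t * (\<Sum>p<N. M p N * u p) + m * t\<^sup>2"
      unfolding split c by simp
    also have "\<dots> = bilin N M' u u"
    proof (cases "m = 0")
      case True
      then show ?thesis by (simp add: bil' t_def W_def)
    next
      case False
      then show ?thesis using \<open>m \<ge> 0\<close>
        by (simp add: bil' w t_def power_divide field_simps power2_eq_square)
    qed
    finally show "bilin N M' u u \<ge> 0" .
  qed
  from Suc.IH[OF this] obtain V where V: "\<And>p q. p < N \<Longrightarrow> q < N \<Longrightarrow> M' p q = (\<Sum>k<N. V k p * V k q)"
    by blast
  define V' where "V' = (\<lambda>k p. if k = N then W p else if p = N then 0 else V k p)"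
  have WN: "W p * W N = M p N" if "p < Suc N" for p
  proof (cases "m = 0")
    case True
    then show ?thesis using zero[of p] that by (cases "p = N") (auto simp: W_def m_def)
  next
    case False
    then show ?thesis using \<open>m \<ge> 0\<close> by (simp add: W_def m_def)
  qed
  show ?case
  proof (intro exI[of _ V'] allI impI)
    fix p q assume pq: "p < Suc N" "q < Suc N"
    show "M p q = (\<Sum>k<Suc N. V' k p * V' k q)"
    proof (cases "p = N \<or> q = N")
      case True
      then have "(\<Sum>k<N. V' k p * V' k q) = 0" by (auto simp: V'_def)
      then show ?thesis using True pq WN[of p] WN[of q] sym[of p q]
        by (auto simp: V'_def mult.commute)
    next
      case False
      then have "(\<Sum>k<N. V' k p * V' k q) = M' p q" using V[of p q] pq by (simp add: V'_def)
      then show ?thesis by (simp add: V'_def M'_def)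
    qed
  qed
qed

text \<open>The square system goes through the determinant. It serves to choose combinations of the
  leading columns of X with prescribed block sums.\<close>

lemma injective_imp_surjective:
  fixes G :: "nat \<Rightarrow> nat \<Rightarrow> real"
  assumes inj: "\<And>c. (\<And>a. a < d \<Longrightarrow> mat_vec d G c a = 0) \<Longrightarrow> \<forall>b<d. c b = 0"
  shows "\<exists>c. \<forall>a<d. mat_vec d G c a = y a"
proof -
  define A where "A = mat d d (\<lambda>(a, b). G a b)"
  have A: "A \<in> carrier_mat d d" by (simp add: A_def)
  have mult: "(A *\<^sub>v v) $ a = mat_vec d G (\<lambda>b. vec_index v b) a" if "v \<in> carrier_vec d" "a < d" for v a
    using that by (simp add: A_def mat_vec_def scalar_prod_def lessThan_atLeast0)
  have "det A \<noteq> 0"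
  proof
    assume "det A = 0"
    then obtain v where v: "v \<in> carrier_vec d" "v \<noteq> 0\<^sub>v d" "A *\<^sub>v v = 0\<^sub>v d"
      using det_0_iff_vec_prod_zero_field[OF A] by blast
    then have "\<forall>b<d. vec_index v b = 0" using inj mult[OF v(1)] by simp
    then show False using v by auto
  qed
  then obtain B where B: "B \<in> carrier_mat d d" "A * B = 1\<^sub>m d"
    using det_non_zero_imp_unit[OF A, of "()"] by (force simp: Units_def ring_mat_def)
  define v where "v = B *\<^sub>v vec d y"
  have "A *\<^sub>v v = vec d y"
    unfolding v_def using A B by (simp flip: assoc_mult_mat_vec)
  then have "mat_vec d G (\<lambda>b. vec_index v b) a = y a" if "a < d" for a
    using mult[of v a] that B by (simp add: v_def)
  then show ?thesis by blast
qed

section \<open>First-order optimality of the semidefinite program\<close>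

lemma inner_upto_sum_left: "inner_upto N (\<lambda>p. \<Sum>k\<in>K. v k p) u = (\<Sum>k\<in>K. inner_upto N (v k) u)"
  by (simp add: inner_upto_commute[of N _ u] inner_upto_sum_right)

lemma bilin_scale_right: "bilin N M u (\<lambda>p. c * v p) = c * bilin N M u v"
  by (simp add: bilin_eq sum_distrib_left algebra_simps)

lemma bilin_sum_left: "bilin N M (\<lambda>p. \<Sum>k\<in>K. a k * v k p) u = (\<Sum>k\<in>K. a k * bilin N M (v k) u)"
  by (simp add: bilin_def inner_upto_sum_left inner_upto_scale_left)

text \<open>A null vector minimises a nonnegative form, so the term linear in t of the form at v + t
  e vanishes for each unit vector e.\<close>

lemma psd_upto_kernel:
  assumes L: "psd_upto N L" and v: "bilin N L v v = 0" and p: "p < N"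
  shows "mat_vec N L v p = 0"
proof -
  define e where "e = (\<lambda>q. if q = p then 1 else 0 :: real)"
  define m where "m = mat_vec N L v p"
  have sym: "sym_upto N L" using L by (simp add: psd_upto_def)
  have ev: "bilin N L e v = m"
    using p unfolding bilin_def e_def m_def by (rule inner_upto_delta_left)
  define b where "b = bilin N L e e"
  have "b \<ge> 0" using L by (simp add: psd_upto_def b_def)
  have *: "2 * t * m + t\<^sup>2 * b \<ge> 0" for t
  proof -
    have "0 \<le> bilin N L (\<lambda>q. v q + t * e q) (\<lambda>q. v q + t * e q)"
      using L by (simp add: psd_upto_def)
    also have "\<dots> = 2 * t * m + t\<^sup>2 * b"
      by (simp add: bilin_add_left bilin_add_right bilin_scale_right v bilin_commute[OF sym, of "\<lambda>p. t * e p"] ev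
          bilin_commute[OF sym, of v e] power2_eq_square b_def)
    finally show ?thesis .
  qed
  \<comment> \<open>The step -m / (1 + b) replaces the minimiser -m / b and stays defined when b =
    0.\<close>
  have "0 \<le> (2 * (- m / (1 + b)) * m + (- m / (1 + b))\<^sup>2 * b) * (1 + b)\<^sup>2"
    using *[of "- m / (1 + b)"] by simp
  also have "\<dots> = - (m * m * (2 + b))"
    using \<open>b \<ge> 0\<close> by (simp add: power2_eq_square divide_simps) (simp add: algebra_simps)
  finally have "m * m * (2 + b) \<le> 0" by simp
  moreover have "m * m * (2 + b) \<ge> m * m" using \<open>b \<ge> 0\<close> by (simp add: algebra_simps)
  ultimately have "m * m \<le> 0" by linarith
  then show ?thesis unfolding m_def[symmetric] by (metis mult_eq_0_iff not_real_square_gt_zero not_le)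
qed

text \<open>A factorisation of M as the sum of V k V k^T, with as many vectors as the dimension
  whatever the rank. Pairings with M become sums of quadratic forms in the vectors
  \<open>V k\<close>.\<close>

definition gram :: "nat \<Rightarrow> (nat \<Rightarrow> nat \<Rightarrow> real) \<Rightarrow> (nat \<Rightarrow> nat \<Rightarrow> real) \<Rightarrow> bool" where
  "gram N M V \<longleftrightarrow> (\<forall>p<N. \<forall>q<N. M p q = (\<Sum>k<N. V k p * V k q))"

lemma gram_frob_upto:
  assumes "gram N M V"
  shows "frob_upto N A M = (\<Sum>k<N. bilin N A (V k) (V k))"
proof -
  have "frob_upto N A M = (\<Sum>p<N. \<Sum>q<N. \<Sum>k<N. A p q * (V k p * V k q))"
    using assms by (simp add: frob_upto_def gram_def sum_distrib_left)
  also have "\<dots> = (\<Sum>p<N. \<Sum>k<N. \<Sum>q<N. A p q * (V k p * V k q))"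
    by (intro sum.cong refl sum.swap)
  also have "\<dots> = (\<Sum>k<N. \<Sum>p<N. \<Sum>q<N. A p q * (V k p * V k q))"
    by (rule sum.swap)
  finally show ?thesis by (simp add: bilin_eq)
qed

lemma gram_bilin:
  assumes "gram N M V"
  shows "bilin N M u v = (\<Sum>k<N. inner_upto N (V k) u * inner_upto N (V k) v)"
proof -
  have "bilin N M u v = frob_upto N (\<lambda>p q. u p * v q) M" by (simp add: bilin_eq frob_upto_def mult.commute)
  also have "\<dots> = (\<Sum>k<N. bilin N (\<lambda>p q. u p * v q) (V k) (V k))" by (rule gram_frob_upto[OF assms])
  also have "\<dots> = (\<Sum>k<N. inner_upto N (V k) u * inner_upto N (V k) v)"
    unfolding bilin_eq inner_upto_def sum_product by (simp add: algebra_simps)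
  finally show ?thesis .
qed

lemma gram_trace:
  assumes "gram N M V"
  shows "(\<Sum>p<N. M p p) = (\<Sum>k<N. (norm_upto N (V k))\<^sup>2)"
proof -
  have "(\<Sum>p<N. M p p) = (\<Sum>p<N. \<Sum>k<N. V k p * V k p)"
    using assms by (simp add: gram_def)
  also have "\<dots> = (\<Sum>k<N. \<Sum>p<N. V k p * V k p)" by (rule sum.swap)
  finally show ?thesis by (simp add: inner_upto_self[symmetric] inner_upto_def)
qed

text \<open>Complementary slackness: the pairing of L with Y is a sum of nonnegative values of the
  form of L, so each summand is zero and each \<open>V k\<close> is a null vector of L.\<close>

lemma gram_kernel:
  assumes L: "psd_upto N L" and V: "gram N Y V" and 0: "frob_upto N L Y = 0" and k: "k < N" and p: "p < N"
  shows "mat_vec N L (V k) p = 0"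
proof -
  have "(\<Sum>k<N. bilin N L (V k) (V k)) = 0" using gram_frob_upto[OF V, of L] 0 by simp
  moreover have "\<forall>k\<in>{..<N}. bilin N L (V k) (V k) \<ge> 0" using L by (simp add: psd_upto_def)
  ultimately have "\<forall>k\<in>{..<N}. bilin N L (V k) (V k) = 0"
    by (subst (asm) sum_nonneg_eq_0_iff) auto
  then show ?thesis using psd_upto_kernel[OF L _ p] k by auto
qed

section \<open>The semidefinite program on entry functions and its first-order condition\<close>

definition feasible_fun :: "nat \<Rightarrow> nat \<Rightarrow> (nat \<Rightarrow> nat \<Rightarrow> real) \<Rightarrow> bool" where
  "feasible_fun n d X \<longleftrightarrow> psd_upto (n*d) X \<and>
     (\<forall>p<n*d. \<forall>q<n*d. p div d = q div d \<longrightarrow> X p q = (if p = q then 1 else 0))"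

definition optimal_fun :: "nat \<Rightarrow> nat \<Rightarrow> (nat \<Rightarrow> nat \<Rightarrow> real) \<Rightarrow> (nat \<Rightarrow> nat \<Rightarrow> real) \<Rightarrow> bool" where
  "optimal_fun n d A X \<longleftrightarrow> feasible_fun n d X \<and> (\<forall>Y. feasible_fun n d Y \<longrightarrow> frob_upto (n*d) A Y \<le> frob_upto (n*d) A X)"

definition mat_prod :: "nat \<Rightarrow> (nat \<Rightarrow> nat \<Rightarrow> real) \<Rightarrow> (nat \<Rightarrow> nat \<Rightarrow> real) \<Rightarrow> nat \<Rightarrow> nat \<Rightarrow> real" where
  "mat_prod N A X p q = (\<Sum>r<N. A p r * X r q)"

text \<open>The matrix in the conclusion is D X D + epsilon y y^T with D p q = (if p = q then 1 else 0) -
  epsilon u p u q inside each block, expanded entrywise.\<close>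

lemma perturbed_feasible:
  fixes u :: "nat \<Rightarrow> real"
  assumes X: "feasible_fun n d X" and N: "N = n * d"
    and e0: "\<epsilon> > 0" and eS: "\<epsilon> * (\<Sum>r<N. (u r)\<^sup>2) \<le> 2"
  defines "c \<equiv> \<lambda>p r. if p div d = r div d then u r else 0"
    and "s \<equiv> \<lambda>p. \<Sum>r<N. if p div d = r div d then (u r)\<^sup>2 else 0"
  defines "g \<equiv> \<lambda>p q. mat_vec N X (c p) q" and "h \<equiv> \<lambda>p q. bilin N X (c p) (c q)"
    and "y \<equiv> \<lambda>p. sqrt (2 - \<epsilon> * s p) * u p"
  shows "feasible_fun n d (\<lambda>p q. X p q - \<epsilon> * (u p * g p q + u q * g q p) + \<epsilon>\<^sup>2 * (u p * u q * h p q) + \<epsilon> * (y p * y q))"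
    (is "feasible_fun n d ?Y")
proof -
  have psd: "psd_upto N X" and blk: "\<And>p q. p < N \<Longrightarrow> q < N \<Longrightarrow> p div d = q div d \<Longrightarrow> X p q = (if p = q then 1 else 0)"
    using X by (auto simp: feasible_fun_def N)
  have sym: "sym_upto N X" using psd by (simp add: psd_upto_def)
  have hsym: "h p q = h q p" for p q by (simp add: h_def bilin_commute[OF sym])
  have symY: "sym_upto N ?Y"
    using sym hsym by (simp add: sym_upto_def algebra_simps)
  have nonneg: "bilin N ?Y z z \<ge> 0" for z
  proof -
    \<comment> \<open>In block i, w is u_i times the inner product of u_i and z_i, so z - \<epsilon>
      w is D z and the terms without y add up to the form of X at D z.\<close>
    define w where "w = (\<lambda>q. \<Sum>p<N. (z p * u p) * c p q)"
    have zw: "bilin N X z w = (\<Sum>p<N. \<Sum>q<N. u p * g p q * (z p * z q))"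
    proof -
      have "bilin N X z w = (\<Sum>p<N. z p * u p * bilin N X (c p) z)"
        by (simp add: w_def bilin_sum_left bilin_commute[OF sym, of z])
      also have "\<dots> = (\<Sum>p<N. z p * u p * inner_upto N z (g p))"
        by (simp add: bilin_commute[OF sym, of _ z] bilin_def[of N X z] g_def)
      also have "\<dots> = (\<Sum>p<N. \<Sum>q<N. u p * g p q * (z p * z q))"
        by (simp add: inner_upto_def sum_distrib_left algebra_simps)
      finally show ?thesis .
    qed
    have zw': "bilin N X z w = (\<Sum>p<N. \<Sum>q<N. u q * g q p * (z p * z q))"
      unfolding zw by (subst sum.swap) (simp add: algebra_simps)
    have ww: "bilin N X w w = (\<Sum>p<N. \<Sum>q<N. u p * u q * h p q * (z p * z q))"
    proof -
      have "bilin N X w w = (\<Sum>p<N. z p * u p * bilin N X (c p) w)"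
        by (subst (1) w_def) (simp add: bilin_sum_left)
      also have "\<dots> = (\<Sum>p<N. z p * u p * bilin N X w (c p))"
        by (simp add: bilin_commute[OF sym, of w])
      also have "\<dots> = (\<Sum>p<N. \<Sum>q<N. z p * u p * (z q * u q * h q p))"
        unfolding w_def bilin_sum_left h_def sum_distrib_left ..
      also have "\<dots> = (\<Sum>p<N. \<Sum>q<N. u p * u q * h p q * (z p * z q))"
        by (intro sum.cong refl) (simp add: hsym algebra_simps)
      finally show ?thesis .
    qed
    have yz: "(\<Sum>p<N. \<Sum>q<N. y p * y q * (z p * z q)) = (inner_upto N y z)\<^sup>2"
      unfolding inner_upto_def power2_eq_square sum_product by (simp add: algebra_simps)
    have "bilin N ?Y z z = (\<Sum>p<N. \<Sum>q<N. X p q * (z p * z q)) - \<epsilon> * ((\<Sum>p<N. \<Sum>q<N. u p * g p q * (z p * z q))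
        + (\<Sum>p<N. \<Sum>q<N. u q * g q p * (z p * z q))) + \<epsilon>\<^sup>2 * (\<Sum>p<N. \<Sum>q<N. u p * u q * h p q * (z p * z q))
        + \<epsilon> * (\<Sum>p<N. \<Sum>q<N. y p * y q * (z p * z q))"
      unfolding bilin_eq sum_distrib_left sum.distrib[symmetric] sum_subtractf[symmetric]
      by (intro sum.cong refl) (simp add: algebra_simps)
    also have "\<dots> = bilin N X z z - \<epsilon> * (bilin N X z w + bilin N X z w) + \<epsilon>\<^sup>2 * bilin N X w w + \<epsilon> * (inner_upto N y z)\<^sup>2"
      unfolding ww zw'[symmetric] zw[symmetric] yz by (simp add: bilin_eq)
    also have "\<dots> = bilin N X (\<lambda>p. z p + (-\<epsilon>) * w p) (\<lambda>p. z p + (-\<epsilon>) * w p) + \<epsilon> * (inner_upto N y z)\<^sup>2"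
      by (simp only: bilin_add_left bilin_add_right bilin_scale_right bilin_commute[OF sym, of "\<lambda>p. (-\<epsilon>) * w p"]
          bilin_commute[OF sym, of w z]) (simp add: power2_eq_square algebra_simps)
    also have "\<dots> \<ge> 0" using psd e0 by (auto simp: psd_upto_def)
    finally show ?thesis .
  qed
  have blkY: "?Y p q = (if p = q then 1 else 0)" if pq: "p < N" "q < N" "p div d = q div d" for p q
  proof -
    have g1: "g p r = u r" if "p < N" "r < N" "p div d = r div d" for p r
    proof -
      have "g p r = (\<Sum>t<N. if t = r then u r else 0)"
        unfolding g_def mat_vec_def
      proof (rule sum.cong[OF refl])
        fix t assume t: "t \<in> {..<N}"
        show "X r t * c p t = (if t = r then u r else 0)"
          using blk[of r t] t that by (auto simp: c_def)
      qed
      then show ?thesis using that by simp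
    qed
    have sq: "s q = s p" using pq by (simp add: s_def)
    have "h p q = (\<Sum>r<N. c p r * g q r)" by (simp add: h_def bilin_def inner_upto_def g_def)
    also have "\<dots> = s p"
      unfolding s_def using pq by (intro sum.cong) (auto simp: c_def g1 power2_eq_square)
    finally have h: "h p q = s p" .
    have "s p \<le> (\<Sum>r<N. (u r)\<^sup>2)" unfolding s_def by (rule sum_mono) simp
    then have "\<epsilon> * s p \<le> 2" using e0 eS by (smt (verit) mult_left_mono)
    then have yy: "y p * y q = (2 - \<epsilon> * s p) * (u p * u q)"
      by (simp add: y_def sq)
    \<comment> \<open>Inside a block X is the identity, so D X D deviates from it by -2 \<epsilon> +
      \<epsilon>^2 |u_i|^2 times u_i u_i^T; the radicand in y is chosen to cancel exactly
      this.\<close>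
    show ?thesis
      unfolding h yy using g1[of p q] g1[of q p] blk[of p q] pq
      by (simp add: power2_eq_square algebra_simps)
  qed
  show ?thesis using symY nonneg blkY by (simp add: feasible_fun_def psd_upto_def N)
qed

text \<open>Along the perturbed points the objective changes by \<epsilon> times
  \<open>-2 * B + \<epsilon> * C + F \<epsilon>\<close>, which an optimum makes nonpositive. At
  \<epsilon> = 0 the vector y is sqrt 2 times u, so the rank-one term supplies 2 u^T A u against -2
  B: a quadratic form in u enters at first order in \<epsilon>.\<close>

lemma opt_dual_feasible:
  assumes opt: "optimal_fun n d A X" and N: "N = n * d" and A: "sym_upto N A"
  shows "bilin N A u u \<le> (\<Sum>p<N. \<Sum>q<N. if p div d = q div d then mat_prod N A X p q * (u p * u q) else 0)"
proof -
  define c where "c = (\<lambda>p r. if p div d = r div d then u r else 0)"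
  define s where "s = (\<lambda>p. \<Sum>r<N. if p div d = r div d then (u r)\<^sup>2 else 0)"
  define g where "g = (\<lambda>p q. mat_vec N X (c p) q)"
  define h where "h = (\<lambda>p q. bilin N X (c p) (c q))"
  define y where "y = (\<lambda>\<epsilon> p. sqrt (2 - \<epsilon> * s p) * u p)"
  define B where "B = (\<Sum>p<N. \<Sum>q<N. A p q * (u p * g p q))"
  define C where "C = (\<Sum>p<N. \<Sum>q<N. A p q * (u p * u q * h p q))"
  define F where "F = (\<lambda>\<epsilon>. \<Sum>p<N. \<Sum>q<N. A p q * (y \<epsilon> p * y \<epsilon> q))"
  define S where "S = (\<Sum>r<N. (u r)\<^sup>2)"
  have X: "feasible_fun n d X" using opt by (simp add: optimal_fun_def)
  have sX: "sym_upto N X" using X by (simp add: feasible_fun_def psd_upto_def N)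
  have B': "B = (\<Sum>p<N. \<Sum>q<N. A p q * (u q * g q p))"
    unfolding B_def using A by (subst sum.swap) (auto simp: sym_upto_def intro!: sum.cong)
  have Beq: "B = (\<Sum>p<N. \<Sum>q<N. if p div d = q div d then mat_prod N A X p q * (u p * u q) else 0)"
    unfolding B_def
  proof (rule sum.cong[OF refl])
    fix p assume "p \<in> {..<N}"
    have "(\<Sum>q<N. A p q * (u p * g p q)) = (\<Sum>q<N. \<Sum>r<N. u p * (A p q * X q r * c p r))"
      by (simp add: g_def mat_vec_def sum_distrib_left algebra_simps)
    also have "\<dots> = (\<Sum>r<N. \<Sum>q<N. u p * (A p q * X q r * c p r))" by (rule sum.swap)
    also have "\<dots> = (\<Sum>r<N. u p * c p r * mat_prod N A X p r)"
      by (simp add: mat_prod_def sum_distrib_left algebra_simps)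
    also have "\<dots> = (\<Sum>q<N. if p div d = q div d then mat_prod N A X p q * (u p * u q) else 0)"
      by (rule sum.cong) (auto simp: c_def)
    finally show "(\<Sum>q<N. A p q * (u p * g p q)) = \<dots>" .
  qed
  have S0: "S \<ge> 0" by (simp add: S_def sum_nonneg)
  \<comment> \<open>The bound 2 / (S + 1) keeps the radicands of y nonnegative and is well defined
    also for u = 0.\<close>
  have ineq: "-2 * B + \<epsilon> * C + F \<epsilon> \<le> 0" if e: "0 < \<epsilon>" "\<epsilon> < 2 / (S + 1)" for \<epsilon>
  proof -
    have "\<epsilon> * S \<le> \<epsilon> * (S + 1)" using e by simp
    also have "\<dots> \<le> 2" using e S0 by (simp add: field_simps)
    finally have eS: "\<epsilon> * (\<Sum>r<N. (u r)\<^sup>2) \<le> 2" by (simp add: S_def)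
    define Y where "Y = (\<lambda>p q. X p q - \<epsilon> * (u p * g p q + u q * g q p) + \<epsilon>\<^sup>2 * (u p * u q * h p q)
        + \<epsilon> * (y \<epsilon> p * y \<epsilon> q))"
    have "feasible_fun n d Y"
      using perturbed_feasible[OF X N e(1) eS] unfolding Y_def g_def h_def y_def c_def s_def .
    then have "frob_upto N A Y \<le> frob_upto N A X" using opt by (simp add: optimal_fun_def N)
    moreover have "frob_upto N A Y = frob_upto N A X - \<epsilon> * (B + (\<Sum>p<N. \<Sum>q<N. A p q * (u q * g q p))) + \<epsilon>\<^sup>2 * C + \<epsilon> * F \<epsilon>"
      unfolding frob_upto_def B_def C_def Y_def F_def sum_distrib_left sum.distrib[symmetric] sum_subtractf[symmetric]
      by (intro sum.cong refl) (simp add: algebra_simps)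
    ultimately have "\<epsilon> * (-2 * B + \<epsilon> * C + F \<epsilon>) \<le> 0"
      unfolding B'[symmetric] by (simp add: power2_eq_square algebra_simps)
    then show ?thesis using e by (simp add: mult_le_0_iff)
  qed
  have lim: "((\<lambda>\<epsilon>. -2 * B + \<epsilon> * C + F \<epsilon>)
      \<longlongrightarrow> -2 * B + 0 * C + (\<Sum>p<N. \<Sum>q<N. A p q * ((sqrt (2 - 0 * s p) * u p) * (sqrt (2 - 0 * s q) * u q))))
      (at_right 0)"
    unfolding y_def F_def by (intro tendsto_intros)
  have "eventually (\<lambda>\<epsilon>. \<epsilon> \<in> {0<..<2 / (S + 1)}) (at_right (0::real))"
    using S0 by (intro eventually_at_right_real) auto
  then have "eventually (\<lambda>\<epsilon>. -2 * B + \<epsilon> * C + F \<epsilon> \<le> 0) (at_right 0)"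
    by (rule eventually_mono) (use ineq in auto)
  from tendsto_upperbound[OF lim this]
  have "-2 * B + (\<Sum>p<N. \<Sum>q<N. A p q * ((sqrt 2 * u p) * (sqrt 2 * u q))) \<le> 0" by simp
  moreover have "(\<Sum>p<N. \<Sum>q<N. A p q * ((sqrt 2 * u p) * (sqrt 2 * u q))) = 2 * bilin N A u u"
  proof -
    have K: "A p q * ((sqrt 2 * u p) * (sqrt 2 * u q)) = 2 * (A p q * (u p * u q))" for p q
    proof -
      have K: "A p q * ((sqrt 2 * u p) * (sqrt 2 * u q)) = (sqrt 2 * sqrt 2) * (A p q * (u p * u q))"
        by (simp only: ac_simps)
      then show ?thesis by simp
    qed
    show ?thesis unfolding bilin_eq sum_distrib_left by (intro sum.cong refl K)
  qed
  ultimately show ?thesis unfolding Beq[symmetric] by simp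
qed

section \<open>Deterministic tightness\<close>

lemma sum_blocks:
  fixes f :: "nat \<Rightarrow> 'a::comm_monoid_add"
  shows "(\<Sum>p<n*d. f p) = (\<Sum>i<n. \<Sum>a<d. f (i*d + a))"
proof -
  have "sum f {i*d..<i*d+d} = (\<Sum>a<d. f (i*d + a))" for i
    using sum.shift_bounds_nat_ivl[of f 0 "i*d" d] by (simp add: lessThan_atLeast0 add.commute)
  then show ?thesis by (simp flip: sum.nat_group)
qed

lemma block_div [simp]: "a < d \<Longrightarrow> (i*d + a) div d = i" for a d i :: nat
  by simp

lemma block_less: "i < n \<Longrightarrow> a < d \<Longrightarrow> i*d + a < n*d" for a d i n :: nat
  by (metis add.commute mod_mult_self2 div_less_iff_less_mult gr_implies_not0 block_div gr0I)

text \<open>For Z the stack of n identity blocks, \<open>block_sum\<close> is Z^T u,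
  \<open>stack\<close> is Z x and \<open>consensus\<close> is Z Z^T.\<close>

definition block_sum :: "nat \<Rightarrow> nat \<Rightarrow> (nat \<Rightarrow> real) \<Rightarrow> nat \<Rightarrow> real" where
  "block_sum n d u a = (\<Sum>i<n. u (i*d + a))"

definition stack :: "nat \<Rightarrow> (nat \<Rightarrow> real) \<Rightarrow> nat \<Rightarrow> real" where
  "stack d x p = x (p mod d)"

definition block_vec :: "nat \<Rightarrow> nat \<Rightarrow> (nat \<Rightarrow> real) \<Rightarrow> nat \<Rightarrow> real" where
  "block_vec d i x p = (if p div d = i then x (p mod d) else 0)"

definition consensus :: "nat \<Rightarrow> nat \<Rightarrow> nat \<Rightarrow> real" where
  "consensus d p q = (if p mod d = q mod d then 1 else 0)"

lemma inner_upto_stack: "inner_upto (n*d) (stack d x) v = inner_upto d x (block_sum n d v)"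
proof -
  have "inner_upto (n*d) (stack d x) v = (\<Sum>i<n. \<Sum>a<d. x a * v (i*d + a))"
    by (simp add: inner_upto_def sum_blocks stack_def)
  also have "\<dots> = (\<Sum>a<d. \<Sum>i<n. x a * v (i*d + a))" by (rule sum.swap)
  finally show ?thesis by (simp add: inner_upto_def block_sum_def sum_distrib_left)
qed

lemma inner_upto_block_vec: "i < n \<Longrightarrow> inner_upto (n*d) (block_vec d i x) v = (\<Sum>a<d. x a * v (i*d + a))"
proof -
  assume i: "i < n"
  have "inner_upto (n*d) (block_vec d i x) v = (\<Sum>j<n. \<Sum>a<d. (if j = i then x a else 0) * v (j*d + a))"
    unfolding inner_upto_def sum_blocks by (intro sum.cong refl) (auto simp: block_vec_def)
  also have "\<dots> = (\<Sum>j<n. if j = i then (\<Sum>a<d. x a * v (i*d + a)) else 0)"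
    by (intro sum.cong) auto
  finally show ?thesis using i by simp
qed

lemma norm_upto_block_vec: "i < n \<Longrightarrow> norm_upto (n*d) (block_vec d i x) = norm_upto d x"
proof -
  assume i: "i < n"
  have "(norm_upto (n*d) (block_vec d i x))\<^sup>2 = (norm_upto d x)\<^sup>2"
    using i by (simp add: inner_upto_self[symmetric] inner_upto_block_vec) (simp add: block_vec_def inner_upto_def)
  then show ?thesis by simp
qed

lemma norm_upto_stack: "(norm_upto (n*d) (stack d x))\<^sup>2 = n * (norm_upto d x)\<^sup>2"
  unfolding inner_upto_self[symmetric] inner_upto_stack
  by (simp add: inner_upto_def block_sum_def stack_def sum_distrib_left algebra_simps)

lemma sum_inner_upto_block_vec: "(\<Sum>i<n. inner_upto (n*d) v (block_vec d i x)) = inner_upto (n*d) v (stack d x)"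
  by (subst (1 2) inner_upto_commute, simp add: inner_upto_block_vec) (simp add: inner_upto_def sum_blocks stack_def)

lemma mat_vec_consensus: "d > 0 \<Longrightarrow> mat_vec (n*d) (consensus d) u = stack d (block_sum n d u)"
proof
  fix p assume d: "d > 0"
  have "mat_vec (n*d) (consensus d) u p = (\<Sum>i<n. \<Sum>a<d. if a = p mod d then u (i*d + a) else 0)"
    unfolding mat_vec_def sum_blocks by (intro sum.cong refl) (auto simp: consensus_def)
  then show "mat_vec (n*d) (consensus d) u p = stack d (block_sum n d u) p"
    using d by (simp add: stack_def block_sum_def)
qed

lemma bilin_consensus: "d > 0 \<Longrightarrow> bilin (n*d) (consensus d) u v = inner_upto d (block_sum n d u) (block_sum n d v)"
  by (simp add: bilin_def mat_vec_consensus inner_upto_commute[of _ u] inner_upto_stack inner_upto_commute[of d])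

lemma block_sum_stack: "a < d \<Longrightarrow> block_sum n d (stack d x) a = n * x a"
  by (simp add: block_sum_def stack_def)

lemma feasible_fun_consensus: "d > 0 \<Longrightarrow> feasible_fun n d (consensus d)"
  unfolding feasible_fun_def psd_upto_def sym_upto_def
  by (auto simp: consensus_def bilin_consensus inner_upto_self) (metis div_mult_mod_eq)

lemma inner_upto_cong: "(\<And>q. q < N \<Longrightarrow> u q = u' q) \<Longrightarrow> (\<And>q. q < N \<Longrightarrow> v q = v' q) \<Longrightarrow> inner_upto N u v = inner_upto N u' v'"
  by (simp add: inner_upto_def)

lemma mat_vec_matrix_add: "mat_vec N (\<lambda>p q. M p q + c * L p q) u = (\<lambda>p. mat_vec N M u p + c * mat_vec N L u p)"
  by (simp add: mat_vec_def algebra_simps sum.distrib sum_distrib_left)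

lemma norm_upto_blocks: "(norm_upto (n*d) v)\<^sup>2 = (\<Sum>i<n. (norm_upto d (\<lambda>a. v (i*d + a)))\<^sup>2)"
  by (simp add: inner_upto_self[symmetric] inner_upto_def sum_blocks)

text \<open>Everything random is condensed into two numbers: w for the operator norm of W and f for
  the blocks of W Z. \<open>sw\<close> controls the noise on the range of Z and the final comparison
  on the kernel, \<open>sf\<close> the component of the noise along Z, and \<open>sww\<close> the
  component off Z: there \<sigma> w meets the distance of X from the range of Z, itself of order
  \<sigma> w sqrt (n d) / n, hence the square.\<close>

locale sdp_point =
  fixes n d :: nat and W X :: "nat \<Rightarrow> nat \<Rightarrow> real" and \<sigma> w f :: real and A N V
  defines "N \<equiv> n * d" and "A \<equiv> \<lambda>p q. consensus d p q + \<sigma> * W p q"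
  assumes n: "n > 0" and d: "d > 0"
    and W: "sym_upto N W"
    and Wbd: "\<bar>bilin N W u v\<bar> \<le> w * norm_upto N u * norm_upto N v"
    and fbd: "i < n \<Longrightarrow> \<bar>bilin N W (stack d y) (block_vec d i x)\<bar> \<le> f * norm_upto d x * norm_upto d y"
    and \<sigma>: "\<sigma> \<ge> 0" and w: "w \<ge> 0" and f: "f \<ge> 0"
    and opt: "optimal_fun n d A X"
    and sw: "\<sigma> * w \<le> n / 25" and sf: "\<sigma> * f \<le> n / 25"
    and sww: "3 * (\<sigma> * w)\<^sup>2 * sqrt (n * d) \<le> n\<^sup>2 / 100"
    and V: "gram N X V"
begin

section \<open>The dual certificate\<close>

lemma A_sym: "sym_upto N A"
  using W by (auto simp: sym_upto_def A_def consensus_def)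

lemma X_feasible_fun: "feasible_fun n d X" using opt by (simp add: optimal_fun_def)

lemma X_psd: "psd_upto N X" using X_feasible_fun by (simp add: feasible_fun_def N_def)

lemma X_sym: "sym_upto N X" using X_psd by (simp add: psd_upto_def)

lemma X_block: "p < N \<Longrightarrow> q < N \<Longrightarrow> p div d = q div d \<Longrightarrow> X p q = (if p = q then 1 else 0)"
  using X_feasible_fun by (simp add: feasible_fun_def N_def)

definition Lam :: "nat \<Rightarrow> nat \<Rightarrow> real" where
  "Lam p q = (if p div d = q div d then (mat_prod N A X p q + mat_prod N A X q p) / 2 else 0)"

definition L :: "nat \<Rightarrow> nat \<Rightarrow> real" where
  "L p q = Lam p q + (-1) * A p q"

lemma Lam_sym: "sym_upto N Lam"
  by (auto simp: sym_upto_def Lam_def)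

lemma bilin_Lam: "bilin N Lam u u = (\<Sum>p<N. \<Sum>q<N. if p div d = q div d then mat_prod N A X p q * (u p * u q) else 0)"
proof -
  let ?B = "\<Sum>p<N. \<Sum>q<N. if p div d = q div d then mat_prod N A X p q * (u p * u q) else 0"
  have "?B = (\<Sum>p<N. \<Sum>q<N. if p div d = q div d then mat_prod N A X q p * (u p * u q) else 0)"
    by (subst sum.swap) (intro sum.cong refl, auto)
  then have "2 * ?B = ?B + (\<Sum>p<N. \<Sum>q<N. if p div d = q div d then mat_prod N A X q p * (u p * u q) else 0)"
    by simp
  also have "\<dots> = 2 * bilin N Lam u u"
    unfolding bilin_eq sum_distrib_left sum.distrib[symmetric]
    by (intro sum.cong refl) (auto simp: Lam_def algebra_simps)
  finally show ?thesis by simp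
qed

lemma L_psd: "psd_upto N L"
proof -
  have "bilin N A u u \<le> bilin N Lam u u" for u
    unfolding bilin_Lam by (rule opt_dual_feasible[OF opt N_def[THEN meta_eq_to_obj_eq] A_sym])
  then have "bilin N L u u \<ge> 0" for u
    unfolding L_def bilin_matrix_add by simp
  moreover have "sym_upto N L" using A_sym Lam_sym by (simp add: sym_upto_def L_def)
  ultimately show ?thesis by (simp add: psd_upto_def)
qed

text \<open>Lam is block diagonal and the diagonal blocks of Y are identities, so Lam pairs with
  every feasible Y to the trace of A X, which is the optimal value.\<close>

lemma frob_upto_L: assumes "feasible_fun n d Y" shows "frob_upto N L Y = frob_upto N A X - frob_upto N A Y"
proof -
  have Y: "p < N \<Longrightarrow> q < N \<Longrightarrow> p div d = q div d \<Longrightarrow> Y p q = (if p = q then 1 else 0)" for p q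
    using assms by (simp add: feasible_fun_def N_def)
  have "frob_upto N Lam Y = (\<Sum>p<N. \<Sum>q<N. if q = p then mat_prod N A X p p else 0)"
    unfolding frob_upto_def by (intro sum.cong refl) (auto simp: Lam_def Y)
  also have "\<dots> = (\<Sum>p<N. mat_prod N A X p p)" by simp
  also have "\<dots> = frob_upto N A X"
    unfolding frob_upto_def mat_prod_def using X_sym by (intro sum.cong refl) (auto simp: sym_upto_def)
  finally have "frob_upto N Lam Y = frob_upto N A X" .
  then show ?thesis
    by (simp add: frob_upto_def L_def algebra_simps sum_subtractf)
qed

text \<open>Y is an arbitrary optimum, not only the X from which L is built; this is what lets L
  decide uniqueness.\<close>

lemma L_kernel:
  assumes "optimal_fun n d A Y" "gram N Y U" "k < N" "p < N"
  shows "mat_vec N L (U k) p = 0"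
proof -
  have "frob_upto N A X = frob_upto N A Y" using assms(1) opt by (auto simp: optimal_fun_def N_def intro: antisym)
  then have "frob_upto N L Y = 0" using frob_upto_L[of Y] assms(1) by (simp add: optimal_fun_def)
  then show ?thesis using gram_kernel[OF L_psd assms(2)] assms by blast
qed

lemma mat_vec_L: "mat_vec N L u = (\<lambda>p. mat_vec N Lam u p - mat_vec N A u p)"
  unfolding L_def[abs_def] mat_vec_matrix_add by simp

lemma Lam_V: "k < N \<Longrightarrow> p < N \<Longrightarrow> mat_vec N Lam (V k) p = mat_vec N A (V k) p"
  using L_kernel[OF opt V] by (simp add: mat_vec_L)

section \<open>The seminorm of X\<close>

definition Q :: "(nat \<Rightarrow> real) \<Rightarrow> real" where
  "Q u = L2_set (\<lambda>k. inner_upto N (V k) u) {..<N}"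

lemma Q_sq: "(Q u)\<^sup>2 = bilin N X u u"
  by (simp add: Q_def L2_set_def gram_bilin[OF V] sum_nonneg power2_eq_square)

lemma Q_nonneg [simp]: "Q u \<ge> 0" by (simp add: Q_def)

text \<open>Since \<open>Q\<close> is written through the Gram factor, as the norm of V^T u, the
  Minkowski and Cauchy-Schwarz inequalities of R^N apply to it directly.\<close>

lemma Q_add: "Q (\<lambda>p. u p + v p) \<le> Q u + Q v"
  unfolding Q_def inner_upto_add_right by (rule L2_set_triangle_ineq)

lemma Q_scale: "c \<ge> 0 \<Longrightarrow> Q (\<lambda>p. c * u p) = c * Q u"
  unfolding Q_def inner_upto_scale_right by (simp add: L2_set_right_distrib)

lemma Q_block:
  assumes "\<And>p. p < N \<Longrightarrow> p div d \<noteq> i \<Longrightarrow> u p = 0"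
  shows "Q u = norm_upto N u"
proof -
  have "bilin N X u u = (\<Sum>p<N. \<Sum>q<N. if q = p then u p * u p else 0)"
    unfolding bilin_eq
  proof (intro sum.cong refl)
    fix p q assume "p \<in> {..<N}" "q \<in> {..<N}"
    then have pq: "p < N" "q < N" by auto
    show "X p q * (u p * u q) = (if q = p then u p * u p else 0)"
    proof (cases "p div d = q div d")
      case True
      then show ?thesis using X_block[OF pq] by simp
    next
      case False
      then have "u p = 0 \<or> u q = 0" using assms pq by metis
      then show ?thesis using False by auto
    qed
  qed
  also have "\<dots> = (norm_upto N u)\<^sup>2" by (simp add: inner_upto_self[symmetric] inner_upto_def)
  finally show ?thesis by (simp flip: Q_sq)
qed

lemma Q_block_vec: "i < n \<Longrightarrow> Q (block_vec d i x) = norm_upto d x"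
  using Q_block[of i "block_vec d i x"] norm_upto_block_vec[of i n d x] by (simp add: block_vec_def N_def)

lemma Q_Lam_block_vec: "Q (mat_vec N Lam (block_vec d i x)) = norm_upto N (mat_vec N Lam (block_vec d i x))"
  by (rule Q_block[of i]) (auto simp: mat_vec_def Lam_def block_vec_def)

text \<open>The Gram vectors lie in the kernel of L, where Lam and A agree. Both matrices are
  symmetric, so Lam is moved onto \<open>V k\<close>, exchanged for A there, and A is moved
  back.\<close>

lemma Q_Lam: "Q (mat_vec N Lam u) = Q (mat_vec N A u)"
  unfolding Q_def
proof (rule L2_set_cong[OF refl])
  fix k assume k: "k \<in> {..<N}"
  have "inner_upto N (V k) (mat_vec N Lam u) = inner_upto N u (mat_vec N Lam (V k))"
    using bilin_commute[OF Lam_sym, of "V k" u] by (simp add: bilin_def)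
  also have "\<dots> = inner_upto N u (mat_vec N A (V k))"
    using k by (intro inner_upto_cong) (auto simp: Lam_V)
  also have "\<dots> = inner_upto N (V k) (mat_vec N A u)"
    using bilin_commute[OF A_sym, of "V k" u] by (simp add: bilin_def)
  finally show "inner_upto N (V k) (mat_vec N Lam u) = inner_upto N (V k) (mat_vec N A u)" .
qed

lemma mat_vec_A: "mat_vec N A u = (\<lambda>p. stack d (block_sum n d u) p + \<sigma> * mat_vec N W u p)"
  unfolding A_def mat_vec_matrix_add by (simp add: N_def mat_vec_consensus d)

lemma mat_vec_A_block_vec: "i < n \<Longrightarrow> mat_vec N A (block_vec d i x) = (\<lambda>p. stack d x p + \<sigma> * mat_vec N W (block_vec d i x) p)"
proof -
  assume i: "i < n"
  have "block_sum n d (block_vec d i x) a = x a" if "a < d" for a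
    using that i by (simp add: block_sum_def block_vec_def)
  then show ?thesis unfolding mat_vec_A using d by (simp add: stack_def)
qed

text \<open>The bilinear bound is tested on W u itself, and one factor of its norm is
  cancelled.\<close>

lemma norm_upto_mat_vec_W: "norm_upto N (mat_vec N W u) \<le> w * norm_upto N u"
proof (cases "norm_upto N (mat_vec N W u) = 0")
  case True
  then show ?thesis using w by simp
next
  case False
  have "norm_upto N (mat_vec N W u) * norm_upto N (mat_vec N W u) = bilin N W (mat_vec N W u) u"
    by (simp add: bilin_def inner_upto_self power2_eq_square)
  also have "\<dots> \<le> w * norm_upto N (mat_vec N W u) * norm_upto N u" using Wbd[of "mat_vec N W u" u] by linarith
  finally show ?thesis using False
    by (simp add: mult.assoc mult.left_commute[of w] mult_le_cancel_left_pos less_le)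
qed

text \<open>Z x is a sum of n single-block vectors of seminorm |x|, and Cauchy-Schwarz over the
  blocks gives the factor. The purpose is to dominate the Gram matrix of the block averages by the
  identity.\<close>

lemma Q_stack_le: "(Q (stack d x))\<^sup>2 \<le> n\<^sup>2 * (norm_upto d x)\<^sup>2"
proof -
  have "(Q (stack d x))\<^sup>2 = (\<Sum>k<N. (\<Sum>i<n. inner_upto N (V k) (block_vec d i x))\<^sup>2)"
    unfolding N_def sum_inner_upto_block_vec by (simp add: Q_def L2_set_def sum_nonneg N_def)
  also have "\<dots> \<le> (\<Sum>k<N. (\<Sum>i<n. (inner_upto N (V k) (block_vec d i x))\<^sup>2) * n)"
    by (intro sum_mono order_trans[OF sum_squared_le_sum_of_squares]) auto
  also have "\<dots> = n * (\<Sum>k<N. \<Sum>i<n. (inner_upto N (V k) (block_vec d i x))\<^sup>2)"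
    by (simp add: sum_distrib_left mult.commute)
  also have "\<dots> = n * (\<Sum>i<n. (Q (block_vec d i x))\<^sup>2)"
    by (subst sum.swap) (simp add: Q_def L2_set_def sum_nonneg)
  also have "\<dots> = n\<^sup>2 * (norm_upto d x)\<^sup>2" by (simp add: Q_block_vec power2_eq_square)
  finally show ?thesis .
qed

section \<open>Distance of X from the range of Z\<close>

definition zc :: "nat \<Rightarrow> nat \<Rightarrow> real" where "zc k a = block_sum n d (V k) a / n"
definition ec :: "nat \<Rightarrow> nat \<Rightarrow> real" where "ec k p = V k p - stack d (zc k) p"
text \<open>The squared distance of a Gram factor of X from the range of Z.\<close>

definition T :: real where "T = (\<Sum>k<N. (norm_upto N (ec k))\<^sup>2)"

lemma T_nonneg: "T \<ge> 0" by (simp add: T_def sum_nonneg)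

lemma V_split: "V k = (\<lambda>p. ec k p + stack d (zc k) p)"
  by (simp add: ec_def)

lemma block_sum_ec: "a < d \<Longrightarrow> block_sum n d (ec k) a = 0"
  using n by (simp add: block_sum_def ec_def sum_subtractf stack_def zc_def)

lemma inner_upto_stack_ec: "inner_upto N (stack d x) (ec k) = 0"
  unfolding N_def inner_upto_stack by (simp add: inner_upto_def block_sum_ec)

text \<open>Pythagoras: the block sums of \<open>ec k\<close> vanish, so the stack of
  \<open>zc k\<close> is the orthogonal projection of \<open>V k\<close> onto the range of
  Z.\<close>

lemma norm_upto_V: "(norm_upto N (V k))\<^sup>2 = n * (norm_upto d (zc k))\<^sup>2 + (norm_upto N (ec k))\<^sup>2"
proof -
  have "(norm_upto N (V k))\<^sup>2 = inner_upto N (ec k) (ec k) + 2 * inner_upto N (stack d (zc k)) (ec k) + inner_upto N (stack d (zc k)) (stack d (zc k))"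
    unfolding inner_upto_self[symmetric] V_split[of k]
    by (simp add: inner_upto_add_left inner_upto_add_right inner_upto_commute[of N "ec k" "stack d (zc k)"])
  then show ?thesis using norm_upto_stack[of n d "zc k"] by (simp add: inner_upto_stack_ec inner_upto_self flip: N_def)
qed

text \<open>The trace of X is n d, its diagonal being 1; T is the part of the trace that the range
  of Z does not carry.\<close>

lemma sum_norm_upto_zc: "n * (\<Sum>k<N. (norm_upto d (zc k))\<^sup>2) = n * d - T"
proof -
  have "(\<Sum>p<N. X p p) = (\<Sum>p<N. 1)" by (intro sum.cong) (auto simp: X_block)
  then have "real n * d = (\<Sum>k<N. (norm_upto N (V k))\<^sup>2)"
    using gram_trace[OF V] by (simp add: N_def)
  also have "\<dots> = n * (\<Sum>k<N. (norm_upto d (zc k))\<^sup>2) + T"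
    by (simp add: norm_upto_V sum.distrib sum_distrib_left T_def)
  finally show ?thesis by simp
qed

lemma inner_upto_zc: "inner_upto d (zc k) x = inner_upto N (V k) (stack d x) / n"
proof -
  have "inner_upto N (V k) (stack d x) = inner_upto d (block_sum n d (V k)) x"
    unfolding N_def by (subst inner_upto_commute) (simp add: inner_upto_stack inner_upto_commute[of d x])
  then show ?thesis by (simp add: inner_upto_def zc_def sum_divide_distrib)
qed

lemma sum_inner_upto_zc_sq: "(\<Sum>k<N. (inner_upto d (zc k) x)\<^sup>2) \<le> (norm_upto d x)\<^sup>2"
proof -
  have "(\<Sum>k<N. (inner_upto d (zc k) x)\<^sup>2) = (Q (stack d x))\<^sup>2 / n\<^sup>2"
    by (simp add: inner_upto_zc power_divide Q_def L2_set_def sum_nonneg sum_divide_distrib)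
  also have "\<dots> \<le> (norm_upto d x)\<^sup>2"
    using Q_stack_le[of x] n by (simp add: divide_le_eq mult.commute)
  finally show ?thesis .
qed

lemma bilin_W_stack: "bilin N W (stack d x) (stack d y)
    = bilin d (\<lambda>a b. \<Sum>i<n. \<Sum>j<n. W (i*d + a) (j*d + b)) x y"
proof -
  have "bilin N W (stack d x) (stack d y) = (\<Sum>i<n. \<Sum>a<d. \<Sum>j<n. \<Sum>b<d. W (i*d+a) (j*d+b) * (x a * y b))"
    unfolding bilin_eq N_def sum_blocks by (simp add: stack_def)
  also have "\<dots> = (\<Sum>a<d. \<Sum>i<n. \<Sum>j<n. \<Sum>b<d. W (i*d+a) (j*d+b) * (x a * y b))"
    by (rule sum.swap)
  also have "\<dots> = (\<Sum>a<d. \<Sum>i<n. \<Sum>b<d. \<Sum>j<n. W (i*d+a) (j*d+b) * (x a * y b))"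
    by (intro sum.cong refl sum.swap)
  also have "\<dots> = (\<Sum>a<d. \<Sum>b<d. \<Sum>i<n. \<Sum>j<n. W (i*d+a) (j*d+b) * (x a * y b))"
    by (intro sum.cong refl sum.swap)
  finally show ?thesis by (simp add: bilin_eq sum_distrib_right)
qed

lemma frob_upto_W_consensus: "frob_upto N W (consensus d) = (\<Sum>a<d. \<Sum>i<n. \<Sum>j<n. W (i*d + a) (j*d + a))"
proof -
  have "frob_upto N W (consensus d) = (\<Sum>i<n. \<Sum>a<d. \<Sum>j<n. \<Sum>b<d. if b = a then W (i*d+a) (j*d+b) else 0)"
    unfolding frob_upto_def N_def sum_blocks by (intro sum.cong refl) (auto simp: consensus_def)
  also have "\<dots> = (\<Sum>i<n. \<Sum>a<d. \<Sum>j<n. W (i*d+a) (j*d+a))" by simp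
  also have "\<dots> = (\<Sum>a<d. \<Sum>i<n. \<Sum>j<n. W (i*d+a) (j*d+a))" by (rule sum.swap)
  finally show ?thesis .
qed

text \<open>The Gram matrix of the block averages zc is dominated by the identity, and the difference has
  trace T / n; expanding it into a Gram sum of its own turns the left-hand side into values of
  the quadratic form of W on the range of Z.\<close>

lemma consensus_noise:
  "(\<Sum>k<N. bilin N W (stack d (zc k)) (stack d (zc k))) - frob_upto N W (consensus d) \<le> w * T"
proof -
  define H where "H = (\<lambda>a b. \<Sum>i<n. \<Sum>j<n. W (i*d + a) (j*d + b))"
  define Y where "Y = (\<lambda>a b. (if a = b then 1 else 0) - (\<Sum>k<N. zc k a * zc k b))"
  have bilY: "bilin d Y x x = (norm_upto d x)\<^sup>2 - (\<Sum>k<N. (inner_upto d (zc k) x)\<^sup>2)" for x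
  proof -
    have "bilin d Y x x = (\<Sum>a<d. \<Sum>b<d. (if b = a then x a * x a else 0) - (\<Sum>k<N. (zc k a * x a) * (zc k b * x b)))"
      unfolding bilin_eq Y_def
      by (intro sum.cong refl) (auto simp: algebra_simps sum_distrib_left sum_distrib_right)
    also have "\<dots> = (\<Sum>a<d. x a * x a) - (\<Sum>a<d. \<Sum>b<d. \<Sum>k<N. (zc k a * x a) * (zc k b * x b))"
      by (simp add: sum_subtractf)
    also have "(\<Sum>a<d. \<Sum>b<d. \<Sum>k<N. (zc k a * x a) * (zc k b * x b))
        = (\<Sum>a<d. \<Sum>k<N. \<Sum>b<d. (zc k a * x a) * (zc k b * x b))"
      by (intro sum.cong refl sum.swap)
    also have "\<dots> = (\<Sum>k<N. \<Sum>a<d. \<Sum>b<d. (zc k a * x a) * (zc k b * x b))"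
      by (rule sum.swap)
    also have "\<dots> = (\<Sum>k<N. (inner_upto d (zc k) x)\<^sup>2)"
      by (simp add: inner_upto_def power2_eq_square sum_product)
    finally show ?thesis by (simp add: inner_upto_self[symmetric] inner_upto_def)
  qed
  have "sym_upto d Y" by (auto simp: sym_upto_def Y_def mult.commute)
  then have "psd_upto d Y" using sum_inner_upto_zc_sq by (simp add: psd_upto_def bilY)
  then obtain U where U: "gram d Y U" using psd_upto_gram[of d Y] by (auto simp: gram_def)
  have trY: "n * (\<Sum>a<d. Y a a) = T"
  proof -
    have "(\<Sum>a<d. Y a a) = d - (\<Sum>a<d. \<Sum>k<N. zc k a * zc k a)"
      by (simp add: Y_def sum_subtractf)
    also have "(\<Sum>a<d. \<Sum>k<N. zc k a * zc k a) = (\<Sum>k<N. (norm_upto d (zc k))\<^sup>2)"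
      by (subst sum.swap) (simp add: inner_upto_self[symmetric] inner_upto_def)
    finally have "(\<Sum>a<d. Y a a) = d - (\<Sum>k<N. (norm_upto d (zc k))\<^sup>2)" .
    then show ?thesis using sum_norm_upto_zc by (simp add: right_diff_distrib)
  qed
  have "frob_upto d H Y = (\<Sum>a<d. \<Sum>b<d. (if b = a then H a a else 0) - (\<Sum>k<N. H a b * (zc k a * zc k b)))"
    unfolding frob_upto_def Y_def by (intro sum.cong refl) (auto simp: algebra_simps sum_distrib_left)
  also have "\<dots> = (\<Sum>a<d. H a a) - (\<Sum>a<d. \<Sum>b<d. \<Sum>k<N. H a b * (zc k a * zc k b))"
    by (simp add: sum_subtractf)
  also have "(\<Sum>a<d. \<Sum>b<d. \<Sum>k<N. H a b * (zc k a * zc k b))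
      = (\<Sum>a<d. \<Sum>k<N. \<Sum>b<d. H a b * (zc k a * zc k b))"
    by (intro sum.cong refl sum.swap)
  also have "\<dots> = (\<Sum>k<N. \<Sum>a<d. \<Sum>b<d. H a b * (zc k a * zc k b))" by (rule sum.swap)
  also have "\<dots> = (\<Sum>k<N. bilin N W (stack d (zc k)) (stack d (zc k)))"
    by (simp add: bilin_W_stack bilin_eq[of d] H_def)
  also have "(\<Sum>a<d. H a a) = frob_upto N W (consensus d)" by (simp add: H_def frob_upto_W_consensus)
  finally have "(\<Sum>k<N. bilin N W (stack d (zc k)) (stack d (zc k))) - frob_upto N W (consensus d) = - frob_upto d H Y" by simp
  also have "\<dots> = (\<Sum>l<d. - bilin N W (stack d (U l)) (stack d (U l)))"
    by (simp add: gram_frob_upto[OF U] bilin_W_stack H_def sum_negf)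
  also have "\<dots> \<le> (\<Sum>l<d. w * (n * (norm_upto d (U l))\<^sup>2))"
  proof (rule sum_mono)
    fix l
    show "- bilin N W (stack d (U l)) (stack d (U l)) \<le> w * (n * (norm_upto d (U l))\<^sup>2)"
      using Wbd[of "stack d (U l)" "stack d (U l)"] norm_upto_stack[of n d "U l"]
      by (simp add: N_def power2_eq_square mult.assoc)
  qed
  also have "\<dots> = w * (n * (\<Sum>a<d. Y a a))"
    by (simp add: gram_trace[OF U] sum_distrib_left)
  finally show ?thesis by (simp add: trY)
qed

text \<open>Compared with Z Z^T the signal part of the objective loses exactly n T, so optimality
  forces the noise gain \<sigma> P to be at least n T. Bounding the noise at X and at Z Z^T
  separately would leave an error of order w n d; their difference costs only 2 w T and a cross term
  2 w sqrt (T n d). The T term is absorbed on the left and one factor sqrt T is divided out.\<close>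

lemma T_bound: "n * sqrt T \<le> 3 * (\<sigma> * w) * sqrt (n * d)"
proof -
  define P where "P = (\<Sum>k<N. bilin N W (V k) (V k)) - frob_upto N W (consensus d)"
  have objJ: "frob_upto N A (consensus d) = real n * n * d + \<sigma> * frob_upto N W (consensus d)"
  proof -
    have "frob_upto N A (consensus d) = frob_upto N (consensus d) (consensus d) + \<sigma> * frob_upto N W (consensus d)"
      by (simp add: frob_upto_def A_def algebra_simps sum.distrib sum_distrib_left)
    moreover have "frob_upto N (consensus d) (consensus d) = (\<Sum>i<n. \<Sum>a<d. \<Sum>j<n. \<Sum>b<d. if b = a then 1 else 0)"
      unfolding frob_upto_def N_def sum_blocks by (intro sum.cong refl) (auto simp: consensus_def)
    ultimately show ?thesis by simp
  qed
  have objX: "frob_upto N A X = real n * (real n * d - T) + \<sigma> * (\<Sum>k<N. bilin N W (V k) (V k))"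
  proof -
    have J: "bilin N (consensus d) (V k) (V k) = n * (n * (norm_upto d (zc k))\<^sup>2)" for k
    proof -
      have "inner_upto d (block_sum n d (V k)) (block_sum n d (V k)) = inner_upto d (\<lambda>a. n * zc k a) (\<lambda>a. n * zc k a)"
        using n by (simp add: zc_def)
      then show ?thesis
        by (simp add: N_def bilin_consensus d inner_upto_scale_left inner_upto_scale_right inner_upto_self)
    qed
    have "frob_upto N A X = (\<Sum>k<N. n * (n * (norm_upto d (zc k))\<^sup>2) + \<sigma> * bilin N W (V k) (V k))"
      unfolding gram_frob_upto[OF V] by (simp add: A_def bilin_matrix_add J)
    also have "\<dots> = n * (n * (\<Sum>k<N. (norm_upto d (zc k))\<^sup>2)) + \<sigma> * (\<Sum>k<N. bilin N W (V k) (V k))"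
      by (simp add: sum.distrib sum_distrib_left)
    finally show ?thesis by (simp add: sum_norm_upto_zc)
  qed
  have "frob_upto N A (consensus d) \<le> frob_upto N A X" using opt feasible_fun_consensus[OF d] by (simp add: optimal_fun_def N_def)
  then have 1: "n * T \<le> \<sigma> * P" unfolding objJ objX P_def by (simp add: algebra_simps)
  have cross: "(\<Sum>k<N. norm_upto N (ec k) * norm_upto N (stack d (zc k))) \<le> sqrt T * sqrt (n * d)"
  proof -
    have "(\<Sum>k<N. norm_upto N (ec k) * norm_upto N (stack d (zc k)))
        \<le> L2_set (\<lambda>k. norm_upto N (ec k)) {..<N} * L2_set (\<lambda>k. norm_upto N (stack d (zc k))) {..<N}"
      using L2_set_mult_ineq[of "\<lambda>k. norm_upto N (ec k)" "\<lambda>k. norm_upto N (stack d (zc k))" "{..<N}"] by simp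
    also have "L2_set (\<lambda>k. norm_upto N (ec k)) {..<N} = sqrt T" by (simp add: L2_set_def T_def)
    also have "L2_set (\<lambda>k. norm_upto N (stack d (zc k))) {..<N} = sqrt (n * d - T)"
      by (simp add: L2_set_def norm_upto_stack[of n d, folded N_def] sum_norm_upto_zc flip: sum_distrib_left)
    also have "\<dots> \<le> sqrt (n * d)" using T_nonneg by simp
    finally show ?thesis by (simp add: mult_left_mono T_nonneg)
  qed
  have "P = (\<Sum>k<N. bilin N W (ec k) (ec k)) + 2 * (\<Sum>k<N. bilin N W (ec k) (stack d (zc k)))
      + ((\<Sum>k<N. bilin N W (stack d (zc k)) (stack d (zc k))) - frob_upto N W (consensus d))"
  proof -
    have "bilin N W (V k) (V k) = bilin N W (ec k) (ec k) + 2 * bilin N W (ec k) (stack d (zc k))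
        + bilin N W (stack d (zc k)) (stack d (zc k))" for k
      unfolding V_split[of k]
      by (simp add: bilin_add_left bilin_add_right bilin_commute[OF W, of "stack d (zc k)" "ec k"])
    then show ?thesis by (simp add: P_def sum.distrib sum_distrib_left)
  qed
  also have "\<dots> \<le> w * T + 2 * (w * (sqrt T * sqrt (n * d))) + w * T"
  proof (intro add_mono mult_left_mono consensus_noise)
    have "(\<Sum>k<N. bilin N W (ec k) (ec k)) \<le> (\<Sum>k<N. w * (norm_upto N (ec k))\<^sup>2)"
      by (rule sum_mono) (use Wbd in \<open>auto simp: power2_eq_square abs_le_iff algebra_simps\<close>)
    then show "(\<Sum>k<N. bilin N W (ec k) (ec k)) \<le> w * T" by (simp add: T_def sum_distrib_left)
    have "(\<Sum>k<N. bilin N W (ec k) (stack d (zc k))) \<le> (\<Sum>k<N. w * (norm_upto N (ec k) * norm_upto N (stack d (zc k))))"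
      by (rule sum_mono) (use Wbd in \<open>auto simp: abs_le_iff algebra_simps\<close>)
    also have "\<dots> \<le> w * (sqrt T * sqrt (n * d))"
      using cross w by (simp add: mult_left_mono flip: sum_distrib_left)
    finally show "(\<Sum>k<N. bilin N W (ec k) (stack d (zc k))) \<le> w * (sqrt T * sqrt (n * d))" .
  qed simp
  finally have "\<sigma> * P \<le> \<sigma> * (w * T + 2 * (w * (sqrt T * sqrt (n * d))) + w * T)"
    using \<sigma> by (rule mult_left_mono)
  then have 2: "n * T \<le> 2 * (\<sigma> * w) * T + 2 * (\<sigma> * w) * sqrt T * sqrt (n * d)"
    using 1 by (simp add: algebra_simps)
  \<comment> \<open>By \<open>sw\<close> at most 2/25 of n T moves to the left; 2 divided by the
    remaining 23/25 is below the claimed 3.\<close>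
  have "2 * (\<sigma> * w) * T \<le> 2 * (n / 25) * T"
    using sw T_nonneg by (intro mult_right_mono) auto
  then have "23 / 25 * n * T \<le> 2 * (\<sigma> * w) * sqrt T * sqrt (n * d)" using 2 by simp
  moreover have "sqrt T * (23 / 25 * n * sqrt T) = 23 / 25 * n * T"
    using T_nonneg by (simp add: mult.left_commute[of "sqrt T"])
  moreover have "2 * (\<sigma> * w) * sqrt T * sqrt (n * d) = sqrt T * (2 * (\<sigma> * w) * sqrt (n * d))"
    by (simp only: ac_simps)
  ultimately have 3: "sqrt T * (23 / 25 * n * sqrt T) \<le> sqrt T * (2 * (\<sigma> * w) * sqrt (n * d))"
    by linarith
  show ?thesis
  proof (cases "T = 0")
    case True
    then show ?thesis using \<sigma> w by simp
  next
    case False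
    then have "23 / 25 * n * sqrt T \<le> 2 * (\<sigma> * w) * sqrt (n * d)"
      using 3 T_nonneg by (simp add: mult_le_cancel_left_pos)
    moreover have "0 \<le> (\<sigma> * w) * sqrt (n * d)" using \<sigma> w by simp
    ultimately show ?thesis by linarith
  qed
qed

text \<open>The general estimate of \<open>Q\<close> by sqrt n times the norm would ask for \<sigma>
  sqrt d = O(1), with no gain in n. Splitting the Gram vectors avoids this: their part along Z sees
  only the block sums of W u, of norm at most f |x|, and acts on them as a contraction; their
  remainder sees all of W u but has total weight sqrt T. The fraction 1/20 is 1/100 from the
  remainder plus 1/25 from the part along Z.\<close>

lemma noise_Q: 
  assumes i: "i < n"
  shows "\<sigma> * Q (mat_vec N W (block_vec d i x)) \<le> n / 20 * norm_upto d x"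
proof -
  define u where "u = block_vec d i x"
  define y where "y = mat_vec N W u"
  have ny: "norm_upto N y \<le> w * norm_upto d x"
    using norm_upto_mat_vec_W[of u] norm_upto_block_vec[OF i, of d x] by (simp add: y_def u_def N_def)
  have nz: "norm_upto d (block_sum n d y) \<le> f * norm_upto d x"
  proof (cases "norm_upto d (block_sum n d y) = 0")
    case True
    then show ?thesis using f by simp
  next
    case False
    \<comment> \<open>Duality: testing on the stack of the block sums of W u turns the bound
      \<open>fbd\<close> on the form into a bound on their norm.\<close>
    have "norm_upto d (block_sum n d y) * norm_upto d (block_sum n d y) = bilin N W (stack d (block_sum n d y)) u"
      by (simp add: bilin_def N_def inner_upto_stack inner_upto_self power2_eq_square y_def)
    also have "\<dots> \<le> f * norm_upto d x * norm_upto d (block_sum n d y)" 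
      using fbd[OF i, of "block_sum n d y" x] unfolding u_def by linarith
    finally show ?thesis using False by (simp add: mult_le_cancel_right_pos less_le)
  qed
  have "Q y = L2_set (\<lambda>k. inner_upto N (ec k) y + inner_upto d (zc k) (block_sum n d y)) {..<N}"
    unfolding Q_def
    by (subst V_split) (simp add: inner_upto_add_left N_def inner_upto_stack)
  also have "\<dots> \<le> L2_set (\<lambda>k. inner_upto N (ec k) y) {..<N} + L2_set (\<lambda>k. inner_upto d (zc k) (block_sum n d y)) {..<N}"
    by (rule L2_set_triangle_ineq)
  also have "\<dots> \<le> sqrt T * (w * norm_upto d x) + f * norm_upto d x"
  proof (rule add_mono)
    have "(\<Sum>k<N. (inner_upto N (ec k) y)\<^sup>2) \<le> (\<Sum>k<N. (norm_upto N (ec k))\<^sup>2 * (norm_upto N y)\<^sup>2)"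
    proof (rule sum_mono)
      fix k
      show "(inner_upto N (ec k) y)\<^sup>2 \<le> (norm_upto N (ec k))\<^sup>2 * (norm_upto N y)\<^sup>2"
        using abs_inner_upto_le[of N "ec k" y] by (simp add: abs_le_square_iff[symmetric] flip: power_mult_distrib)
    qed
    then have "L2_set (\<lambda>k. inner_upto N (ec k) y) {..<N} \<le> sqrt (T * (norm_upto N y)\<^sup>2)"
      by (simp add: L2_set_def T_def sum_distrib_right)
    also have "\<dots> = sqrt T * norm_upto N y" by (simp add: real_sqrt_mult)
    also have "\<dots> \<le> sqrt T * (w * norm_upto d x)" using ny T_nonneg by (intro mult_left_mono) auto
    finally show "L2_set (\<lambda>k. inner_upto N (ec k) y) {..<N} \<le> sqrt T * (w * norm_upto d x)" .
    have "L2_set (\<lambda>k. inner_upto d (zc k) (block_sum n d y)) {..<N} \<le> sqrt ((norm_upto d (block_sum n d y))\<^sup>2)"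
      unfolding L2_set_def using sum_inner_upto_zc_sq by (intro real_sqrt_le_mono)
    then show "L2_set (\<lambda>k. inner_upto d (zc k) (block_sum n d y)) {..<N} \<le> f * norm_upto d x" using nz by simp
  qed
  finally have "\<sigma> * Q y \<le> \<sigma> * (sqrt T * (w * norm_upto d x) + f * norm_upto d x)"
    using \<sigma> by (intro mult_left_mono)
  also have "\<dots> = (\<sigma> * w * sqrt T + \<sigma> * f) * norm_upto d x" by (simp add: algebra_simps)
  also have "\<dots> \<le> (n / 100 + n / 25) * norm_upto d x"
  proof (intro mult_right_mono add_mono sf)
    have "\<sigma> * w * (n * sqrt T) \<le> \<sigma> * w * (3 * (\<sigma> * w) * sqrt (n * d))"
      using T_bound \<sigma> w by (intro mult_left_mono) auto
    also have "\<dots> \<le> n\<^sup>2 / 100" using sww by (simp add: power2_eq_square algebra_simps)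
    finally have "n * (\<sigma> * w * sqrt T) \<le> n * (n / 100)" by (simp add: power2_eq_square algebra_simps)
    then show "\<sigma> * w * sqrt T \<le> n / 100" using n by (simp only: mult_le_cancel_left_pos of_nat_0_less_iff)
  qed simp
  finally show ?thesis by (simp add: y_def u_def)
qed

text \<open>On Z x the form of Lam is the sum over i of the form of A X at x placed in block i.
  Inserting A = Z Z^T + \<sigma> W makes this the square of Q (Z x) plus noise of at most n^2/20
  |x|^2, while the form of A is at least (1 - 1/25) n^2 |x|^2. Positivity of L compares the
  two.\<close>

lemma Q_stack_ge: "Q (stack d x) \<ge> 94 / 100 * n * norm_upto d x"
proof -
  have AXm: "mat_prod N A X p q = (\<Sum>k<N. mat_vec N A (V k) p * V k q)" if "q < N" for p q
  proof -
    have "mat_prod N A X p q = (\<Sum>r<N. \<Sum>k<N. A p r * (V k r * V k q))"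
      using V that by (simp add: mat_prod_def gram_def sum_distrib_left)
    also have "\<dots> = (\<Sum>k<N. \<Sum>r<N. A p r * (V k r * V k q))" by (rule sum.swap)
    finally show ?thesis by (simp add: mat_vec_def sum_distrib_right mult.assoc)
  qed
  have blockAX: "bilin N (mat_prod N A X) u u = (\<Sum>k<N. inner_upto N (V k) (mat_vec N A u) * inner_upto N (V k) u)" for u
  proof -
    have "bilin N (mat_prod N A X) u u = (\<Sum>p<N. \<Sum>q<N. \<Sum>k<N. (mat_vec N A (V k) p * u p) * (V k q * u q))"
      unfolding bilin_eq by (intro sum.cong refl) (simp add: AXm sum_distrib_left sum_distrib_right algebra_simps)
    also have "\<dots> = (\<Sum>p<N. \<Sum>k<N. \<Sum>q<N. (mat_vec N A (V k) p * u p) * (V k q * u q))"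
      by (intro sum.cong refl sum.swap)
    also have "\<dots> = (\<Sum>k<N. \<Sum>p<N. \<Sum>q<N. (mat_vec N A (V k) p * u p) * (V k q * u q))" by (rule sum.swap)
    also have "\<dots> = (\<Sum>k<N. inner_upto N (mat_vec N A (V k)) u * inner_upto N (V k) u)" by (simp add: inner_upto_def sum_product)
    also have "\<dots> = (\<Sum>k<N. inner_upto N (V k) (mat_vec N A u) * inner_upto N (V k) u)"
      using bilin_commute[OF A_sym] by (simp add: inner_upto_commute[of N _ u] bilin_def)
    finally show ?thesis .
  qed
  have "bilin N Lam (stack d x) (stack d x) = (\<Sum>i<n. bilin N (mat_prod N A X) (block_vec d i x) (block_vec d i x))"
  proof -
    have "(\<Sum>i<n. bilin N (mat_prod N A X) (block_vec d i x) (block_vec d i x))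
        = (\<Sum>i<n. \<Sum>p<N. \<Sum>q<N. mat_prod N A X p q * (block_vec d i x p * block_vec d i x q))" by (simp add: bilin_eq)
    also have "\<dots> = (\<Sum>p<N. \<Sum>i<n. \<Sum>q<N. mat_prod N A X p q * (block_vec d i x p * block_vec d i x q))" by (rule sum.swap)
    also have "\<dots> = (\<Sum>p<N. \<Sum>q<N. \<Sum>i<n. mat_prod N A X p q * (block_vec d i x p * block_vec d i x q))"
      by (intro sum.cong refl sum.swap)
    also have "\<dots> = bilin N Lam (stack d x) (stack d x)"
      unfolding bilin_Lam
    proof (intro sum.cong refl)
      fix p q assume "p \<in> {..<N}" "q \<in> {..<N}"
      then have "p div d < n" using d by (simp add: N_def div_less_iff_less_mult)
      have "(\<Sum>i<n. mat_prod N A X p q * (block_vec d i x p * block_vec d i x q))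
          = (\<Sum>i<n. if i = p div d then (if p div d = q div d then mat_prod N A X p q * (stack d x p * stack d x q) else 0) else 0)"
        by (intro sum.cong refl) (auto simp: block_vec_def stack_def)
      then show "(\<Sum>i<n. mat_prod N A X p q * (block_vec d i x p * block_vec d i x q)) =
          (if p div d = q div d then mat_prod N A X p q * (stack d x p * stack d x q) else 0)"
        using \<open>p div d < n\<close> by simp
    qed
    finally show ?thesis by simp
  qed
  also have "\<dots> = (\<Sum>i<n. (\<Sum>k<N. inner_upto N (V k) (stack d x) * inner_upto N (V k) (block_vec d i x))
      + \<sigma> * (\<Sum>k<N. inner_upto N (V k) (mat_vec N W (block_vec d i x)) * inner_upto N (V k) (block_vec d i x)))"
    unfolding blockAX
    by (intro sum.cong refl)
      (simp add: mat_vec_A_block_vec inner_upto_add_right inner_upto_scale_right algebra_simps sum.distrib sum_distrib_left)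
  also have "\<dots> \<le> (\<Sum>i<n. (\<Sum>k<N. inner_upto N (V k) (stack d x) * inner_upto N (V k) (block_vec d i x)) + n / 20 * norm_upto d x * norm_upto d x)"
  proof (intro sum_mono add_left_mono)
    fix i assume i: "i \<in> {..<n}"
    have "(\<Sum>k<N. inner_upto N (V k) (mat_vec N W (block_vec d i x)) * inner_upto N (V k) (block_vec d i x))
        \<le> (\<Sum>k<N. \<bar>inner_upto N (V k) (mat_vec N W (block_vec d i x))\<bar> * \<bar>inner_upto N (V k) (block_vec d i x)\<bar>)"
      by (intro sum_mono) (simp flip: abs_mult)
    also have "\<dots> \<le> Q (mat_vec N W (block_vec d i x)) * Q (block_vec d i x)"
      unfolding Q_def by (rule L2_set_mult_ineq)
    finally have "\<sigma> * (\<Sum>k<N. inner_upto N (V k) (mat_vec N W (block_vec d i x)) * inner_upto N (V k) (block_vec d i x))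
        \<le> \<sigma> * (Q (mat_vec N W (block_vec d i x)) * Q (block_vec d i x))" using \<sigma> by (rule mult_left_mono)
    also have "\<dots> = \<sigma> * Q (mat_vec N W (block_vec d i x)) * norm_upto d x" using i by (simp add: Q_block_vec)
    also have "\<dots> \<le> n / 20 * norm_upto d x * norm_upto d x"
      using i by (intro mult_right_mono noise_Q) auto
    finally show "\<sigma> * (\<Sum>k<N. inner_upto N (V k) (mat_vec N W (block_vec d i x)) * inner_upto N (V k) (block_vec d i x)) \<le> n / 20 * norm_upto d x * norm_upto d x" .
  qed
  also have "\<dots> = (\<Sum>i<n. \<Sum>k<N. inner_upto N (V k) (stack d x) * inner_upto N (V k) (block_vec d i x)) + n\<^sup>2 / 20 * (norm_upto d x)\<^sup>2"
    by (simp add: sum.distrib power2_eq_square)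
  also have "(\<Sum>i<n. \<Sum>k<N. inner_upto N (V k) (stack d x) * inner_upto N (V k) (block_vec d i x))
      = (\<Sum>k<N. \<Sum>i<n. inner_upto N (V k) (stack d x) * inner_upto N (V k) (block_vec d i x))" by (rule sum.swap)
  also have "\<dots> = (\<Sum>k<N. (inner_upto N (V k) (stack d x))\<^sup>2)"
    unfolding sum_distrib_left[symmetric] N_def sum_inner_upto_block_vec by (simp add: power2_eq_square)
  also have "\<dots> = (Q (stack d x))\<^sup>2" by (simp add: Q_def L2_set_def sum_nonneg)
  finally have up: "bilin N Lam (stack d x) (stack d x) \<le> (Q (stack d x))\<^sup>2 + n\<^sup>2 / 20 * (norm_upto d x)\<^sup>2" .
  have "0 \<le> bilin N L (stack d x) (stack d x)" using L_psd by (simp add: psd_upto_def)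
  then have "bilin N A (stack d x) (stack d x) \<le> bilin N Lam (stack d x) (stack d x)"
    unfolding L_def[abs_def] bilin_matrix_add by simp
  moreover have "bilin N A (stack d x) (stack d x) = n\<^sup>2 * (norm_upto d x)\<^sup>2 + \<sigma> * bilin N W (stack d x) (stack d x)"
  proof -
    have "inner_upto d (block_sum n d (stack d x)) (block_sum n d (stack d x)) = inner_upto d (\<lambda>a. n * x a) (\<lambda>a. n * x a)"
      by (intro inner_upto_cong) (auto simp: block_sum_stack)
    then show ?thesis unfolding A_def bilin_matrix_add
      by (simp add: N_def bilin_consensus d inner_upto_scale_left inner_upto_scale_right inner_upto_self power2_eq_square)
  qed
  moreover have "\<sigma> * bilin N W (stack d x) (stack d x) \<ge> - (n\<^sup>2 / 25 * (norm_upto d x)\<^sup>2)"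
  proof -
    have "\<sigma> * \<bar>bilin N W (stack d x) (stack d x)\<bar> \<le> \<sigma> * (w * (n * (norm_upto d x)\<^sup>2))"
      using Wbd[of "stack d x" "stack d x"] norm_upto_stack[of n d x] \<sigma>
      by (intro mult_left_mono) (auto simp: N_def power2_eq_square mult.assoc)
    also have "\<dots> = (\<sigma> * w) * (n * (norm_upto d x)\<^sup>2)" by simp
    also have "\<dots> \<le> n / 25 * (n * (norm_upto d x)\<^sup>2)" using sw by (intro mult_right_mono) auto
    finally have "\<bar>\<sigma> * bilin N W (stack d x) (stack d x)\<bar> \<le> n\<^sup>2 / 25 * (norm_upto d x)\<^sup>2"
      using \<sigma> by (simp add: abs_mult power2_eq_square)
    then show ?thesis by linarith
  qed
  \<comment> \<open>91/100 is 1 - 1/20 - 1/25, and the square of 94/100 lies below it.\<close>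
  ultimately have "n\<^sup>2 * (norm_upto d x)\<^sup>2 * (91 / 100) \<le> (Q (stack d x))\<^sup>2" using up by simp
  moreover have "(94 / 100 * n * norm_upto d x)\<^sup>2 \<le> n\<^sup>2 * (norm_upto d x)\<^sup>2 * (91 / 100)"
  proof -
    have "(94 / 100 * n * norm_upto d x)\<^sup>2 = n\<^sup>2 * (norm_upto d x)\<^sup>2 * (94 / 100)\<^sup>2"
      by (simp only: power_mult_distrib of_nat_power ac_simps)
    also have "\<dots> \<le> n\<^sup>2 * (norm_upto d x)\<^sup>2 * (91 / 100)" by (intro mult_left_mono) (auto simp: power2_eq_square)
    finally show ?thesis .
  qed
  ultimately show ?thesis by (meson Q_nonneg order_trans power2_le_imp_le)
qed

text \<open>Lam keeps u in its block, so |Lam u| = Q (A u), and A u differs from Z x only by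
  \<sigma> W u. The constant is 94/100 - 1/20.\<close>

lemma Lam_expands_block:
  assumes i: "i < n"
  shows "norm_upto N (mat_vec N Lam (block_vec d i x)) \<ge> 89 / 100 * n * norm_upto d x"
proof -
  \<comment> \<open>The sign is placed inside W because for \<open>Q\<close> only the triangle
    inequality for sums and nonnegative scaling are at hand.\<close>
  have "Q (stack d x) \<le> Q (mat_vec N A (block_vec d i x)) + Q (\<lambda>p. \<sigma> * mat_vec N W (\<lambda>p. -1 * block_vec d i x p) p)"
  proof -
    have "mat_vec N W (\<lambda>p. -1 * block_vec d i x p) p = - mat_vec N W (block_vec d i x) p" for p
      by (simp add: mat_vec_def sum_negf)
    then have "stack d x = (\<lambda>p. mat_vec N A (block_vec d i x) p + \<sigma> * mat_vec N W (\<lambda>p. -1 * block_vec d i x p) p)"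
      by (simp add: mat_vec_A_block_vec[OF i])
    then show ?thesis using Q_add by metis
  qed
  also have "Q (\<lambda>p. \<sigma> * mat_vec N W (\<lambda>p. -1 * block_vec d i x p) p) \<le> n / 20 * norm_upto d x"
  proof -
    have "(\<lambda>p. -1 * block_vec d i x p) = block_vec d i (\<lambda>a. -1 * x a)" by (auto simp: block_vec_def)
    then show ?thesis
      using noise_Q[OF i, of "\<lambda>a. -1 * x a"] norm_upto_scale[of d "-1" x] by (simp add: Q_scale \<sigma>)
  qed
  finally have "94 / 100 * n * norm_upto d x \<le> Q (mat_vec N A (block_vec d i x)) + n / 20 * norm_upto d x"
    using Q_stack_ge[of x] by simp
  then show ?thesis by (simp add: Q_Lam_block_vec[symmetric] Q_Lam)
qed

text \<open>Lam acts block by block, so the squared norms of the images of the blocks add up and the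
  constant of a single block persists.\<close>

lemma Lam_expands: "norm_upto N (mat_vec N Lam u) \<ge> 89 / 100 * n * norm_upto N u"
proof -
  let ?u = "\<lambda>i a. u (i*d + a)"
  have blk: "mat_vec N Lam u (i*d + a) = mat_vec N Lam (block_vec d i (?u i)) (i*d + a)" if "a < d" for i a
    unfolding mat_vec_def
  proof (rule sum.cong[OF refl])
    fix q show "Lam (i*d+a) q * u q = Lam (i*d+a) q * block_vec d i (?u i) q"
      using that div_mult_mod_eq[of q d] by (auto simp: Lam_def block_vec_def)
  qed
  have zero: "mat_vec N Lam (block_vec d i y) (j*d + a) = 0" if "a < d" "j \<noteq> i" for i j a y
    unfolding mat_vec_def using that by (intro sum.neutral) (auto simp: Lam_def block_vec_def)
  have nb: "(norm_upto d (\<lambda>a. mat_vec N Lam u (i*d + a)))\<^sup>2 = (norm_upto N (mat_vec N Lam (block_vec d i (?u i))))\<^sup>2" if i: "i < n" for i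
  proof -
    have "(norm_upto N (mat_vec N Lam (block_vec d i (?u i))))\<^sup>2
        = (\<Sum>j<n. if j = i then (norm_upto d (\<lambda>a. mat_vec N Lam u (i*d + a)))\<^sup>2 else 0)"
      unfolding N_def norm_upto_blocks
    proof (intro sum.cong refl)
      fix j assume "j \<in> {..<n}"
      show "(norm_upto d (\<lambda>a. mat_vec (n*d) Lam (block_vec d i (?u i)) (j*d + a)))\<^sup>2
          = (if j = i then (norm_upto d (\<lambda>a. mat_vec (n*d) Lam u (i*d + a)))\<^sup>2 else 0)"
      proof (cases "j = i")
        case True
        then show ?thesis
          by (simp add: norm_upto_cong[where u="\<lambda>a. mat_vec (n*d) Lam (block_vec d i (?u i)) (i*d + a)"
                and v="\<lambda>a. mat_vec (n*d) Lam u (i*d + a)"] blk[unfolded N_def])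
      next
        case False
        then have "norm_upto d (\<lambda>a. mat_vec (n*d) Lam (block_vec d i (?u i)) (j*d + a)) = 0"
          unfolding norm_upto_eq_0 using zero[unfolded N_def] by blast
        then show ?thesis using False by simp
      qed
    qed
    then show ?thesis using i by simp
  qed
  have "(89 / 100 * n * norm_upto N u)\<^sup>2 = (\<Sum>i<n. (89 / 100 * n * norm_upto d (?u i))\<^sup>2)"
    unfolding power_mult_distrib N_def norm_upto_blocks sum_distrib_left ..
  also have "\<dots> \<le> (\<Sum>i<n. (norm_upto N (mat_vec N Lam (block_vec d i (?u i))))\<^sup>2)"
    by (intro sum_mono power_mono Lam_expands_block) auto
  also have "\<dots> = (norm_upto N (mat_vec N Lam u))\<^sup>2"
    unfolding N_def norm_upto_blocks[of n d "mat_vec (n*d) Lam u"]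
    by (intro sum.cong refl) (simp add: nb[unfolded N_def])
  finally show ?thesis using power2_le_imp_le norm_upto_nonneg by blast
qed

section \<open>The kernel of L, uniqueness and factorisation\<close>

lemma L_kernel_trivial:
  assumes L: "\<And>p. p < N \<Longrightarrow> mat_vec N L u p = 0" and Z: "\<And>a. a < d \<Longrightarrow> block_sum n d u a = 0"
  shows "\<forall>p<N. u p = 0"
proof -
  have "stack d (block_sum n d u) p = 0" for p using Z d by (simp add: stack_def)
  then have "mat_vec N Lam u p = \<sigma> * mat_vec N W u p" if "p < N" for p
    using L[OF that] by (simp add: mat_vec_L mat_vec_A)
  then have "norm_upto N (mat_vec N Lam u) = norm_upto N (\<lambda>p. \<sigma> * mat_vec N W u p)" by (rule norm_upto_cong)
  also have "\<dots> \<le> \<sigma> * (w * norm_upto N u)"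
    using norm_upto_mat_vec_W[of u] \<sigma> by (simp add: norm_upto_scale mult_left_mono)
  also have "\<dots> = \<sigma> * w * norm_upto N u" by simp
  also have "\<dots> \<le> n / 25 * norm_upto N u" using sw by (intro mult_right_mono) auto
  finally have "89 / 100 * n * norm_upto N u \<le> n / 25 * norm_upto N u" using Lam_expands[of u] by linarith
  then have "n * norm_upto N u \<le> 0" by simp
  then have "norm_upto N u = 0" using n by (simp add: mult_le_0_iff antisym)
  then show ?thesis by (simp add: norm_upto_eq_0)
qed

lemma L_X: "mat_vec N L (\<lambda>r. Y r q) p = 0" if Y: "optimal_fun n d A Y" and pq: "p < N" "q < N" for Y p q
proof -
  have "psd_upto N Y" using Y by (simp add: optimal_fun_def feasible_fun_def N_def)
  then obtain U where U: "gram N Y U" using psd_upto_gram[of N Y] by (auto simp: gram_def)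
  have "mat_vec N L (\<lambda>r. Y r q) p = (\<Sum>r<N. \<Sum>k<N. L p r * (U k r * U k q))"
    using U pq by (simp add: mat_vec_def gram_def sum_distrib_left)
  also have "\<dots> = (\<Sum>k<N. \<Sum>r<N. L p r * (U k r * U k q))" by (rule sum.swap)
  also have "\<dots> = (\<Sum>k<N. U k q * mat_vec N L (U k) p)"
    by (simp add: mat_vec_def sum_distrib_left algebra_simps)
  also have "\<dots> = 0" using L_kernel[OF Y U] pq by simp
  finally show ?thesis .
qed

lemma first_block: "a < d \<Longrightarrow> a < N"
  using n by (metis N_def One_nat_def Suc_leI less_le_trans mult_le_mono1 nat_mult_1)

text \<open>The combinations \<open>R c\<close> of the first d columns of X lie in the kernel. A
  combination with zero block sums vanishes, and its first block is c, so c is mapped injectively to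
  the block sums; the map is d x d, hence onto. Some \<open>R c\<close> thus has the block sums of
  u, the difference is in the kernel and orthogonal to Z, hence zero, and the first block shows that
  c is the first block of u.\<close>

lemma L_kernel_span:
  assumes L: "\<And>p. p < N \<Longrightarrow> mat_vec N L u p = 0" and p: "p < N"
  shows "u p = (\<Sum>b<d. X p b * u b)"
proof -
  define G where "G = (\<lambda>a b. block_sum n d (\<lambda>p. X p b) a)"
  define R where "R = (\<lambda>c p. \<Sum>b<d. c b * X p b)"
  have G: "mat_vec d G c a = block_sum n d (R c) a" for c a
  proof -
    have "mat_vec d G c a = (\<Sum>b<d. \<Sum>i<n. c b * X (i*d+a) b)"
      by (simp add: mat_vec_def G_def block_sum_def sum_distrib_left sum_distrib_right mult.commute)
    also have "\<dots> = (\<Sum>i<n. \<Sum>b<d. c b * X (i*d+a) b)" by (rule sum.swap)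
    finally show ?thesis by (simp add: block_sum_def R_def)
  qed
  have LR: "mat_vec N L (R c) p = 0" if "p < N" for c p
  proof -
    have "mat_vec N L (R c) p = (\<Sum>q<N. \<Sum>b<d. c b * (L p q * X q b))"
      by (simp add: mat_vec_def R_def sum_distrib_left algebra_simps)
    also have "\<dots> = (\<Sum>b<d. \<Sum>q<N. c b * (L p q * X q b))" by (rule sum.swap)
    also have "\<dots> = (\<Sum>b<d. c b * mat_vec N L (\<lambda>r. X r b) p)"
      by (simp add: mat_vec_def sum_distrib_left)
    also have "\<dots> = 0" using L_X[OF opt that first_block] by simp
    finally show ?thesis .
  qed
  have R0: "R c b = c b" if "b < d" for c b
  proof -
    have "R c b = (\<Sum>a<d. if a = b then c b else 0)"
      unfolding R_def
    proof (rule sum.cong[OF refl])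
      fix a assume "a \<in> {..<d}"
      then show "c a * X b a = (if a = b then c b else 0)"
        using that X_block[of b a] first_block by auto
    qed
    then show ?thesis using that by simp
  qed
  have "\<exists>c. \<forall>a<d. mat_vec d G c a = block_sum n d u a"
  proof (rule injective_imp_surjective)
    fix c assume "\<And>a. a < d \<Longrightarrow> mat_vec d G c a = 0"
    then have "\<forall>p<N. R c p = 0" using L_kernel_trivial[of "R c"] LR G by simp
    then show "\<forall>b<d. c b = 0" using R0 first_block by metis
  qed
  then obtain c where c: "\<And>a. a < d \<Longrightarrow> block_sum n d (R c) a = block_sum n d u a" using G by auto
  have "\<forall>p<N. u p + (-1) * R c p = 0"
  proof (rule L_kernel_trivial)
    show "mat_vec N L (\<lambda>p. u p + (-1) * R c p) p = 0" if "p < N" for p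
      using LR[OF that, of c] L[OF that]
      by (simp add: mat_vec_def algebra_simps sum_subtractf)
    show "block_sum n d (\<lambda>p. u p + (-1) * R c p) a = 0" if "a < d" for a
      using c[OF that] by (simp add: block_sum_def sum_subtractf)
  qed
  then have u: "u p = R c p" if "p < N" for p using that by simp
  then have "c b = u b" if "b < d" for b using R0[OF that] first_block[OF that] by simp
  then show ?thesis using u[OF p] by (simp add: R_def mult.commute)
qed

text \<open>The columns of Y lie in the kernel of L, so each is determined by its first block; since
  the first diagonal block of Y is the identity, the first block column of Y is that of X. Y = X
  gives the factorisation of X, arbitrary Y gives uniqueness.\<close>

lemma opt_unique:
  assumes Y: "optimal_fun n d A Y" and p: "p < N" and q: "q < N"
  shows "Y p q = (\<Sum>b<d. X p b * X q b)"
proof -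
  have Ysym: "Y r s = Y s r" if "r < N" "s < N" for r s
    using Y that by (auto simp: optimal_fun_def feasible_fun_def psd_upto_def sym_upto_def N_def)
  have col: "Y r s = (\<Sum>b<d. X r b * Y b s)" if "r < N" "s < N" for r s
    using L_kernel_span[of "\<lambda>r. Y r s"] L_X[OF Y] that by blast
  have first: "Y r b = X r b" if "r < N" "b < d" for r b
  proof -
    have "Y r b = (\<Sum>c<d. if c = b then X r b else 0)"
      unfolding col[OF that(1) first_block[OF that(2)]]
    proof (rule sum.cong[OF refl])
      fix c assume "c \<in> {..<d}"
      then have "Y c b = (if c = b then 1 else 0)"
        using Y that first_block by (auto simp: optimal_fun_def feasible_fun_def N_def)
      then show "X r c * Y c b = (if c = b then X r b else 0)" by simp
    qed
    then show ?thesis using that by simp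
  qed
  have "Y p q = (\<Sum>b<d. X p b * Y q b)"
    unfolding col[OF p q] using Ysym q first_block by (intro sum.cong) auto
  then show ?thesis using first q by simp
qed

end

section \<open>Gaussian forms\<close>

interpretation std_gauss: prob_space std_gauss
  unfolding std_gauss_def by (rule prob_space_normal_density) simp

lemma sets_std_gauss [simp, measurable_cong]: "sets std_gauss = sets borel"
  by (simp add: std_gauss_def)

lemma space_std_gauss [simp]: "space std_gauss = UNIV"
  by (simp add: std_gauss_def)

text \<open>Completing the square turns the tilted density into a multiple of the normal density
  with mean a.\<close>

lemma std_gauss_mgf: "(\<integral>\<^sup>+ x. ennreal (exp (a * x)) \<partial>std_gauss) = ennreal (exp (a\<^sup>2 / 2))"
proof -
  have *: "std_normal_density x * exp (a * x) = exp (a\<^sup>2 / 2) * normal_density a 1 x" for x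
  proof -
    have "- x\<^sup>2 / 2 + a * x = a\<^sup>2 / 2 + - (x - a)\<^sup>2 / 2" by (simp add: power2_eq_square field_simps)
    then show ?thesis by (simp add: normal_density_def mult_exp_exp)
  qed
  have "(\<integral>\<^sup>+ x. ennreal (exp (a * x)) \<partial>std_gauss)
      = (\<integral>\<^sup>+ x. ennreal (std_normal_density x * exp (a * x)) \<partial>lborel)"
    unfolding std_gauss_def by (subst nn_integral_density) (auto simp: ennreal_mult')
  also have "\<dots> = (\<integral>\<^sup>+ x. ennreal (exp (a\<^sup>2 / 2)) * ennreal (normal_density a 1 x) \<partial>lborel)"
    unfolding * by (simp add: ennreal_mult')
  also have "\<dots> = ennreal (exp (a\<^sup>2 / 2)) * (\<integral>\<^sup>+ x. ennreal (normal_density a 1 x) \<partial>lborel)"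
    by (rule nn_integral_cmult) simp
  also have "(\<integral>\<^sup>+ x. ennreal (normal_density a 1 x) \<partial>lborel) = 1"
    by (subst nn_integral_eq_integral) auto
  finally show ?thesis by simp
qed

text \<open>Chernoff bound. The number s only dominates the variance, so that one estimate serves
  all net points.\<close>

lemma gauss_upper_tail:
  fixes c :: "'i \<Rightarrow> real"
  assumes I: "finite I" and s: "(\<Sum>i\<in>I. (c i)\<^sup>2) \<le> s" "s > 0" and t: "t \<ge> 0"
  shows "measure (PiM I (\<lambda>_. std_gauss)) {g \<in> space (PiM I (\<lambda>_. std_gauss)). t < (\<Sum>i\<in>I. c i * g i)}
    \<le> exp (- t\<^sup>2 / (2 * s))"
proof -
  define P where "P = PiM I (\<lambda>_::'i. std_gauss)"
  interpret product_sigma_finite "\<lambda>_::'i. std_gauss" by standard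
  interpret R: prob_space P unfolding P_def by (intro prob_space_PiM std_gauss.prob_space_axioms)
  \<comment> \<open>The minimiser of the exponent \<theta>^2 s / 2 - \<theta> t.\<close>
  define \<theta> where "\<theta> = t / s"
  define u where "u = (\<lambda>g. ennreal (exp (\<theta> * (\<Sum>i\<in>I. c i * g i))))"
  have [measurable]: "(\<lambda>g. \<Sum>i\<in>I. c i * g i) \<in> borel_measurable P"
    unfolding P_def by measurable
  have "(\<integral>\<^sup>+ g. u g \<partial>P) = (\<integral>\<^sup>+ g. (\<Prod>i\<in>I. ennreal (exp (\<theta> * c i * g i))) \<partial>P)"
    by (simp add: u_def exp_sum[OF I] sum_distrib_left prod_ennreal mult.assoc)
  also have "\<dots> = (\<Prod>i\<in>I. \<integral>\<^sup>+ x. ennreal (exp (\<theta> * c i * x)) \<partial>std_gauss)"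
    unfolding P_def by (rule product_nn_integral_prod) (use I in auto)
  also have "\<dots> = ennreal (exp (\<Sum>i\<in>I. (\<theta> * c i)\<^sup>2 / 2))"
    by (simp add: std_gauss_mgf exp_sum[OF I] prod_ennreal)
  also have "\<dots> \<le> ennreal (exp (\<theta>\<^sup>2 * s / 2))"
    using s by (intro ennreal_leI)
      (simp add: power_mult_distrib mult_left_mono flip: sum_divide_distrib sum_distrib_left)
  finally have int: "(\<integral>\<^sup>+ g. u g \<partial>P) \<le> ennreal (exp (\<theta>\<^sup>2 * s / 2))" .
  have "emeasure P {g \<in> space P. t < (\<Sum>i\<in>I. c i * g i)}
      \<le> emeasure P {g \<in> space P. 1 \<le> ennreal (exp (- \<theta> * t)) * u g}"
  proof (rule emeasure_mono)
    show "{g \<in> space P. t < (\<Sum>i\<in>I. c i * g i)} \<subseteq> {g \<in> space P. 1 \<le> ennreal (exp (- \<theta> * t)) * u g}"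
    proof safe
      fix g assume "t < (\<Sum>i\<in>I. c i * g i)"
      then have "\<theta> * t \<le> \<theta> * (\<Sum>i\<in>I. c i * g i)" using t s by (intro mult_left_mono) (auto simp: \<theta>_def)
      then have "1 \<le> exp (- \<theta> * t) * exp (\<theta> * (\<Sum>i\<in>I. c i * g i))"
        by (simp add: mult_exp_exp)
      then show "1 \<le> ennreal (exp (- \<theta> * t)) * u g"
        by (simp add: u_def flip: ennreal_mult')
    qed
    show "{g \<in> space P. 1 \<le> ennreal (exp (- \<theta> * t)) * u g} \<in> sets P"
      unfolding u_def by measurable
  qed
  also have "\<dots> \<le> ennreal (exp (- \<theta> * t)) * (\<integral>\<^sup>+ g. u g * indicator (space P) g \<partial>P)"
    by (rule nn_integral_Markov_inequality) (auto simp: u_def)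
  also have "(\<integral>\<^sup>+ g. u g * indicator (space P) g \<partial>P) = (\<integral>\<^sup>+ g. u g \<partial>P)"
    by (intro nn_integral_cong) auto
  also have "ennreal (exp (- \<theta> * t)) * (\<integral>\<^sup>+ g. u g \<partial>P)
      \<le> ennreal (exp (- \<theta> * t)) * ennreal (exp (\<theta>\<^sup>2 * s / 2))"
    using int by (intro mult_left_mono) auto
  also have "\<dots> = ennreal (exp (- t\<^sup>2 / (2 * s)))"
  proof -
    have "- \<theta> * t + \<theta>\<^sup>2 * s / 2 = - t\<^sup>2 / (2 * s)"
      using s by (simp add: \<theta>_def power2_eq_square field_simps)
    then show ?thesis by (simp add: mult_exp_exp flip: ennreal_mult')
  qed
  finally show ?thesis unfolding R.emeasure_eq_measure by (simp add: P_def)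
qed

lemma gauss_tail:
  fixes c :: "'i \<Rightarrow> real"
  assumes I: "finite I" and s: "(\<Sum>i\<in>I. (c i)\<^sup>2) \<le> s" "s > 0" and t: "t \<ge> 0"
  shows "measure (PiM I (\<lambda>_. std_gauss)) {g \<in> space (PiM I (\<lambda>_. std_gauss)). t < \<bar>\<Sum>i\<in>I. c i * g i\<bar>}
    \<le> 2 * exp (- t\<^sup>2 / (2 * s))"
proof -
  define P where "P = PiM I (\<lambda>_::'i. std_gauss)"
  interpret R: prob_space P unfolding P_def by (intro prob_space_PiM std_gauss.prob_space_axioms)
  define S where "S = (\<lambda>c :: 'i \<Rightarrow> real. {g \<in> space P. t < (\<Sum>i\<in>I. c i * g i)})"
  have meas: "S c \<in> sets P" for c unfolding S_def P_def by measurable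
  have "{g \<in> space P. t < \<bar>\<Sum>i\<in>I. c i * g i\<bar>} = S c \<union> S (\<lambda>i. - c i)"
    by (auto simp: S_def sum_negf abs_if)
  then have "measure P {g \<in> space P. t < \<bar>\<Sum>i\<in>I. c i * g i\<bar>} \<le> measure P (S c) + measure P (S (\<lambda>i. - c i))"
    using meas by (simp add: measure_Un_le)
  also have "\<dots> \<le> exp (- t\<^sup>2 / (2 * s)) + exp (- t\<^sup>2 / (2 * s))"
    unfolding S_def P_def by (intro add_mono gauss_upper_tail I s t) (use s in auto)
  finally show ?thesis by (simp add: P_def)
qed

section \<open>An explicit net of the unit ball\<close>

definition lattice_net :: "nat \<Rightarrow> (nat \<Rightarrow> int) set" where
  "lattice_net N = {k \<in> PiE {..<N} (\<lambda>_. {- 4 * int N..4 * int N}). (\<Sum>p<N. (k p)\<^sup>2) \<le> 16 * int N}"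

text \<open>With mesh 1 / (4 sqrt N), an error of one mesh width in each of N coordinates has norm
  at most 1/4, and the condition on the sum of squares in \<open>lattice_net\<close> says that the
  point lies in the unit ball.\<close>

definition lattice_vec :: "nat \<Rightarrow> (nat \<Rightarrow> int) \<Rightarrow> nat \<Rightarrow> real" where
  "lattice_vec N k p = of_int (k p) / (4 * sqrt N)"

lemma finite_lattice_net [simp]: "finite (lattice_net N)"
proof -
  have "finite (PiE {..<N} (\<lambda>_. {- 4 * int N..4 * int N}))" by (intro finite_PiE) auto
  then show ?thesis by (simp add: lattice_net_def)
qed

text \<open>Two geometric series with sum at most 2 each, the term at 0 being counted in
  both.\<close>

lemma sum_half_powers_le: "(\<Sum>k\<in>{- B..B}. (1/2::real) ^ nat \<bar>k\<bar>) \<le> 4" for B :: int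
proof -
  let ?f = "\<lambda>k::int. (1/2::real) ^ nat \<bar>k\<bar>"
  define m where "m = nat B"
  have geo: "(\<Sum>j\<le>m. (1/2::real) ^ j) \<le> 2" for m
    using sum_gp0[of "1/2::real" m] by simp
  have "{- B..B} \<subseteq> int ` {..m} \<union> (\<lambda>j. - int j) ` {..m}"
  proof
    fix k assume k: "k \<in> {- B..B}"
    then have "nat \<bar>k\<bar> \<le> m" by (auto simp: m_def)
    moreover have "k = int (nat \<bar>k\<bar>) \<or> k = - int (nat \<bar>k\<bar>)" by auto
    ultimately show "k \<in> int ` {..m} \<union> (\<lambda>j. - int j) ` {..m}" by blast
  qed
  then have "sum ?f {- B..B} \<le> sum ?f (int ` {..m} \<union> (\<lambda>j. - int j) ` {..m})"
    by (intro sum_mono2) auto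
  also have "\<dots> \<le> sum ?f (int ` {..m}) + sum ?f ((\<lambda>j. - int j) ` {..m})"
    by (simp add: sum_Un sum_nonneg)
  also have "\<dots> = (\<Sum>j\<le>m. (1/2::real) ^ j) + (\<Sum>j\<le>m. (1/2::real) ^ j)"
    by (simp add: sum.reindex inj_on_def)
  finally show ?thesis using geo[of m] by simp
qed

text \<open>Each point of the net has weight 2 ^ (16 N) times the product of the (1/2) ^ \<bar>k p\<bar>, which is at
  least 1, and the total weight over the box factorises.\<close>

lemma card_lattice_net: "real (card (lattice_net N)) \<le> 2 ^ (18 * N)"
proof -
  let ?E = "PiE {..<N} (\<lambda>_. {- 4 * int N..4 * int N})"
  have fin: "finite ?E" by (intro finite_PiE) auto
  have "real (card (lattice_net N)) = (\<Sum>k\<in>lattice_net N. 1)" by simp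
  also have "\<dots> \<le> (\<Sum>k\<in>lattice_net N. 2 ^ (16 * N) * (\<Prod>p<N. (1/2::real) ^ nat \<bar>k p\<bar>))"
  proof (rule sum_mono)
    fix k assume k: "k \<in> lattice_net N"
    have "int (\<Sum>p<N. nat \<bar>k p\<bar>) = (\<Sum>p<N. \<bar>k p\<bar>)" by simp
    also have "\<dots> \<le> (\<Sum>p<N. (k p)\<^sup>2)"
    proof (rule sum_mono)
      fix p
      have "\<bar>k p\<bar> * 1 \<le> \<bar>k p\<bar> * \<bar>k p\<bar>" by (cases "k p = 0") (simp, intro mult_left_mono, auto)
      then show "\<bar>k p\<bar> \<le> (k p)\<^sup>2" by (simp add: power2_eq_square)
    qed
    also have "\<dots> \<le> int (16 * N)" using k by (simp add: lattice_net_def)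
    finally have le: "(\<Sum>p<N. nat \<bar>k p\<bar>) \<le> 16 * N" by linarith
    have "(1::real) = 2 ^ (16 * N) * (1/2) ^ (16 * N)" by (simp add: power_one_over)
    also have "\<dots> \<le> 2 ^ (16 * N) * (1/2) ^ (\<Sum>p<N. nat \<bar>k p\<bar>)"
      by (intro mult_left_mono power_decreasing le) auto
    finally show "1 \<le> 2 ^ (16 * N) * (\<Prod>p<N. (1/2::real) ^ nat \<bar>k p\<bar>)" by (simp add: power_sum)
  qed
  also have "\<dots> \<le> (\<Sum>k\<in>?E. 2 ^ (16 * N) * (\<Prod>p<N. (1/2::real) ^ nat \<bar>k p\<bar>))"
    using fin by (intro sum_mono2) (auto simp: lattice_net_def prod_nonneg)
  also have "\<dots> = 2 ^ (16 * N) * (\<Prod>p<N. \<Sum>k\<in>{- 4 * int N..4 * int N}. (1/2::real) ^ nat \<bar>k\<bar>)"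
    by (subst prod_sum_PiE) (auto simp: sum_distrib_left)
  also have "\<dots> \<le> 2 ^ (16 * N) * (\<Prod>p<N. 4)"
    using sum_half_powers_le[of "4 * int N"]
    by (intro mult_left_mono prod_mono) (auto intro: sum_nonneg)
  also have "\<dots> = 2 ^ (18 * N)"
  proof -
    have "(4::real) ^ N = 2 ^ (2 * N)" by (simp add: power_mult)
    then show ?thesis by (simp flip: power_add)
  qed
  finally show ?thesis .
qed

lemma abs_le_norm_upto: "p < N \<Longrightarrow> \<bar>u p\<bar> \<le> norm_upto N u"
  unfolding norm_upto_def using member_le_L2_set[of "{..<N}" p "\<lambda>p. \<bar>u p\<bar>"] by (simp add: L2_set_def)

text \<open>Rounding towards 0 keeps the coordinates, hence the norm, from growing.\<close>

lemma lattice_approximation: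
  assumes N: "N > 0" and u: "norm_upto N u \<le> 1"
  obtains k where "k \<in> lattice_net N" "norm_upto N (\<lambda>p. u p - lattice_vec N k p) \<le> 1 / 4"
proof -
  define r where "r = (\<lambda>p. 4 * sqrt N * u p)"
  define z where "z = (\<lambda>p. if r p \<ge> 0 then \<lfloor>r p\<rfloor> else \<lceil>r p\<rceil>)"
  define k where "k = restrict z {..<N}"
  have z1: "\<bar>of_int (z p)\<bar> \<le> \<bar>r p\<bar>" and z2: "\<bar>r p - of_int (z p)\<bar> \<le> 1" for p
    unfolding z_def by (simp_all split: if_splits) linarith+
  have sq: "(sqrt (real N))\<^sup>2 = N" by simp
  have "(\<Sum>p<N. (u p)\<^sup>2) \<le> 1"
    using u by (simp add: norm_upto_def L2_set_def)
  have "real_of_int (\<Sum>p<N. (k p)\<^sup>2) \<le> (\<Sum>p<N. (r p)\<^sup>2)"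
  proof -
    have "(real_of_int (z p))\<^sup>2 \<le> (r p)\<^sup>2" for p using z1[of p] by (simp add: abs_le_square_iff)
    then show ?thesis by (simp add: k_def sum_mono)
  qed
  also have "\<dots> = 16 * N * (\<Sum>p<N. (u p)\<^sup>2)"
    by (simp add: r_def power_mult_distrib sum_distrib_left)
  also have "\<dots> \<le> 16 * N" using \<open>(\<Sum>p<N. (u p)\<^sup>2) \<le> 1\<close> by (simp add: mult_left_le)
  finally have k1: "(\<Sum>p<N. (k p)\<^sup>2) \<le> 16 * int N" by linarith
  have k2: "k p \<in> {- 4 * int N..4 * int N}" if "p < N" for p
  proof -
    have "\<bar>u p\<bar> \<le> 1" using abs_le_norm_upto[OF that, of u] u by linarith
    then have "\<bar>r p\<bar> \<le> 4 * sqrt N" by (simp add: r_def abs_mult mult_left_le)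
    also have "sqrt N \<le> N" using N
      by (intro real_le_lsqrt) (auto simp: power2_eq_square simp flip: of_nat_mult)
    finally have "\<bar>real_of_int (z p)\<bar> \<le> 4 * N" using z1[of p] by linarith
    then have "\<bar>z p\<bar> \<le> 4 * int N" by linarith
    then show ?thesis using that by (auto simp: k_def)
  qed
  have "k \<in> lattice_net N"
    using k1 k2 by (auto simp: lattice_net_def k_def)
  moreover have "norm_upto N (\<lambda>p. u p - lattice_vec N k p) \<le> 1 / 4"
  proof -
    have "(\<Sum>p<N. (u p - lattice_vec N k p)\<^sup>2) \<le> (\<Sum>p<N. 1 / (16 * N))"
    proof (rule sum_mono)
      fix p assume "p \<in> {..<N}"
      then have "u p - lattice_vec N k p = (r p - of_int (z p)) / (4 * sqrt N)"
        using N by (simp add: lattice_vec_def k_def r_def diff_divide_distrib)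
      then have "(u p - lattice_vec N k p)\<^sup>2 = (r p - of_int (z p))\<^sup>2 / (16 * N)"
        by (simp add: power_divide power_mult_distrib)
      also have "\<dots> \<le> 1 / (16 * N)"
        using z2[of p] by (intro divide_right_mono) (auto simp: abs_square_le_1)
      finally show "(u p - lattice_vec N k p)\<^sup>2 \<le> 1 / (16 * N)" .
    qed
    also have "\<dots> = (1 / 4)\<^sup>2" using N by (simp add: power2_eq_square)
    finally show ?thesis unfolding norm_upto_def L2_set_def by (intro real_le_lsqrt) (auto simp: sum_nonneg)
  qed
  ultimately show ?thesis using that by blast
qed

lemma norm_upto_lattice_vec: "k \<in> lattice_net N \<Longrightarrow> norm_upto N (lattice_vec N k) \<le> 1"
proof -
  assume "k \<in> lattice_net N"
  then have "(\<Sum>p<N. (k p)\<^sup>2) \<le> 16 * int N" by (simp add: lattice_net_def)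
  then have "real_of_int (\<Sum>p<N. (k p)\<^sup>2) \<le> real_of_int (16 * int N)" by (simp only: of_int_le_iff)
  then have "(\<Sum>p<N. (real_of_int (k p))\<^sup>2) \<le> 16 * N" by simp
  then have "(\<Sum>p<N. (lattice_vec N k p)\<^sup>2) \<le> 1"
    by (simp add: lattice_vec_def power_divide power_mult_distrib divide_le_eq_1 flip: sum_divide_distrib)
      auto
  then show ?thesis by (simp add: norm_upto_def L2_set_def)
qed

lemma bilin_scale_left: "bilin N M (\<lambda>p. c * u p) v = c * bilin N M u v"
  by (simp add: bilin_def inner_upto_scale_left)

lemma bilin_homogeneous_bound:
  assumes "\<And>u v. norm_upto N u \<le> 1 \<Longrightarrow> norm_upto N v \<le> 1 \<Longrightarrow> \<bar>bilin N M u v\<bar> \<le> s"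
  shows "\<bar>bilin N M u v\<bar> \<le> s * norm_upto N u * norm_upto N v"
proof (cases "norm_upto N u = 0 \<or> norm_upto N v = 0")
  case True
  then have "bilin N M u v = 0" by (auto simp: norm_upto_eq_0 bilin_eq)
  then show ?thesis using True by auto
next
  case False
  define a b where "a = norm_upto N u" and "b = norm_upto N v"
  have ab: "a > 0" "b > 0" using False by (auto simp: a_def b_def less_le)
  have "\<bar>bilin N M (\<lambda>p. (1/a) * u p) (\<lambda>p. (1/b) * v p)\<bar> \<le> s"
    using ab by (intro assms; subst norm_upto_scale) (auto simp: a_def b_def)
  then have "\<bar>bilin N M u v\<bar> / (a * b) \<le> s"
    unfolding bilin_scale_left bilin_scale_right using ab by (simp add: abs_mult)
  then show ?thesis using ab by (simp add: a_def b_def divide_le_eq mult_ac)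
qed

text \<open>Approximating both arguments within 1/4 bounds the supremum S over the unit balls by t +
  S/4 + S/4. Absorbing S requires it to be finite, which the sum of the absolute entries
  ensures.\<close>

lemma lattice_net_bound:
  assumes N: "N > 0"
    and net: "\<And>k l. k \<in> lattice_net N \<Longrightarrow> l \<in> lattice_net N \<Longrightarrow>
      \<bar>bilin N M (lattice_vec N k) (lattice_vec N l)\<bar> \<le> t"
  shows "\<bar>bilin N M u v\<bar> \<le> 2 * t * norm_upto N u * norm_upto N v"
proof (rule bilin_homogeneous_bound)
  define U where "U = {\<bar>bilin N M u v\<bar> | u v. norm_upto N u \<le> 1 \<and> norm_upto N v \<le> 1}"
  define S where "S = Sup U"
  have bdd: "bdd_above U"
  proof (rule bdd_aboveI)
    fix y assume "y \<in> U"
    then obtain u v where uv: "y = \<bar>bilin N M u v\<bar>" "norm_upto N u \<le> 1" "norm_upto N v \<le> 1" by (auto simp: U_def)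
    have 1: "\<bar>u p\<bar> \<le> 1" "\<bar>v p\<bar> \<le> 1" if "p < N" for p
      using abs_le_norm_upto[OF that, of u] abs_le_norm_upto[OF that, of v] uv by linarith+
    have "y \<le> (\<Sum>p<N. \<Sum>q<N. \<bar>M p q * (u p * v q)\<bar>)"
      unfolding uv bilin_eq by (intro order_trans[OF sum_abs] sum_mono) auto
    also have "\<dots> \<le> (\<Sum>p<N. \<Sum>q<N. \<bar>M p q\<bar>)"
    proof (intro sum_mono)
      fix p q assume "p \<in> {..<N}" "q \<in> {..<N}"
      then have "\<bar>u p\<bar> * \<bar>v q\<bar> \<le> 1 * 1" by (intro mult_mono) (auto simp: 1)
      then show "\<bar>M p q * (u p * v q)\<bar> \<le> \<bar>M p q\<bar>" by (simp add: abs_mult mult_left_le)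
    qed
    finally show "y \<le> (\<Sum>p<N. \<Sum>q<N. \<bar>M p q\<bar>)" .
  qed
  have upper: "\<bar>bilin N M u v\<bar> \<le> S" if "norm_upto N u \<le> 1" "norm_upto N v \<le> 1" for u v
    unfolding S_def using that by (intro cSup_upper bdd) (auto simp: U_def)
  have "S \<le> t + S / 4 + S / 4"
    unfolding S_def
  proof (rule cSup_least)
    have "norm_upto N (\<lambda>_. 0) \<le> 1" by (simp add: norm_upto_def L2_set_def)
    then show "U \<noteq> {}" by (auto simp: U_def)
    fix y assume "y \<in> U"
    then obtain u v where uv: "y = \<bar>bilin N M u v\<bar>" "norm_upto N u \<le> 1" "norm_upto N v \<le> 1" by (auto simp: U_def)
    obtain k where k: "k \<in> lattice_net N" "norm_upto N (\<lambda>p. u p - lattice_vec N k p) \<le> 1 / 4"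
      using lattice_approximation[OF N uv(2)] .
    obtain l where l: "l \<in> lattice_net N" "norm_upto N (\<lambda>p. v p - lattice_vec N l p) \<le> 1 / 4"
      using lattice_approximation[OF N uv(3)] .
    define a b where "a = (\<lambda>p. u p - lattice_vec N k p)" and "b = (\<lambda>p. v p - lattice_vec N l p)"
    have "bilin N M u v = bilin N M (\<lambda>p. lattice_vec N k p + a p) v"
      by (simp add: a_def)
    also have "\<dots> = bilin N M (lattice_vec N k) (\<lambda>p. lattice_vec N l p + b p) + bilin N M a v"
      by (simp add: bilin_add_left b_def)
    finally have "bilin N M u v = bilin N M (lattice_vec N k) (lattice_vec N l)
        + bilin N M (lattice_vec N k) b + bilin N M a v" by (simp add: bilin_add_right)
    moreover have "\<bar>bilin N M (lattice_vec N k) b\<bar> \<le> S * norm_upto N (lattice_vec N k) * norm_upto N b"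
      by (rule bilin_homogeneous_bound) (rule upper)
    moreover have "\<bar>bilin N M a v\<bar> \<le> S * norm_upto N a * norm_upto N v"
      by (rule bilin_homogeneous_bound) (rule upper)
    moreover have "0 \<le> S" using upper[of "\<lambda>_. 0" "\<lambda>_. 0"] by (simp add: norm_upto_def L2_set_def bilin_eq)
    then have "S * (norm_upto N (lattice_vec N k) * norm_upto N b) \<le> S * (1 * (1 / 4))" "S * (norm_upto N a * norm_upto N v) \<le> S * (1 / 4 * 1)"
      using k l uv norm_upto_lattice_vec[OF k(1)]
      by (auto simp only: a_def b_def intro!: mult_left_mono mult_mono norm_upto_nonneg)
    moreover have "\<bar>bilin N M (lattice_vec N k) (lattice_vec N l)\<bar> \<le> t" by (rule net[OF k(1) l(1)])
    ultimately show "y \<le> t + Sup U / 4 + Sup U / 4" unfolding uv S_def[symmetric] by (simp add: mult.assoc)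
  qed
  then have "S \<le> 2 * t" by simp
  then show "\<bar>bilin N M u v\<bar> \<le> 2 * t" if "norm_upto N u \<le> 1" "norm_upto N v \<le> 1" for u v
    using upper[OF that] by linarith
qed

text \<open>Union bound over the pairs of net points. The failure set is returned as an event E, so
  that measurability of an operator norm does not arise. The form is left abstract because it is
  applied in dimension n d to the noise matrix and in dimension d to each block of W Z.\<close>

lemma gaussian_form_bound:
  fixes C :: "(nat \<Rightarrow> real) \<Rightarrow> (nat \<Rightarrow> real) \<Rightarrow> 'i \<Rightarrow> real" and M :: "('i \<Rightarrow> real) \<Rightarrow> nat \<Rightarrow> nat \<Rightarrow> real"
  assumes N: "N > 0" and I: "finite I" and s: "s > 0" and t: "t \<ge> 0"
    and lin: "\<And>g u v. bilin N (M g) u v = (\<Sum>e\<in>I. C u v e * g e)"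
    and var: "\<And>u v. norm_upto N u \<le> 1 \<Longrightarrow> norm_upto N v \<le> 1 \<Longrightarrow> (\<Sum>e\<in>I. (C u v e)\<^sup>2) \<le> s"
  obtains E where "E \<in> sets (PiM I (\<lambda>_. std_gauss))"
    "measure (PiM I (\<lambda>_. std_gauss)) E \<le> 2 * 2 ^ (36 * N) * exp (- t\<^sup>2 / (2 * s))"
    "\<And>g u v. g \<in> space (PiM I (\<lambda>_. std_gauss)) - E \<Longrightarrow> \<bar>bilin N (M g) u v\<bar> \<le> 2 * t * norm_upto N u * norm_upto N v"
proof -
  define P where "P = PiM I (\<lambda>_::'i. std_gauss)"
  interpret R: prob_space P unfolding P_def by (intro prob_space_PiM std_gauss.prob_space_axioms)
  define F where "F = (\<lambda>(k, l). {g \<in> space P. t < \<bar>\<Sum>e\<in>I. C (lattice_vec N k) (lattice_vec N l) e * g e\<bar>})"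
  define K where "K = lattice_net N \<times> lattice_net N"
  define E where "E = (\<Union>kl\<in>K. F kl)"
  have fin: "finite K" by (simp add: K_def)
  have meas: "F kl \<in> sets P" for kl
    unfolding F_def P_def by (cases kl) simp
  have "measure P E \<le> (\<Sum>kl\<in>K. measure P (F kl))"
    unfolding E_def using fin meas by (intro R.finite_measure_subadditive_finite) auto
  also have "\<dots> \<le> (\<Sum>kl\<in>K. 2 * exp (- t\<^sup>2 / (2 * s)))"
  proof (rule sum_mono)
    fix kl assume kl: "kl \<in> K"
    obtain k l where [simp]: "kl = (k, l)" by (cases kl)
    show "measure P (F kl) \<le> 2 * exp (- t\<^sup>2 / (2 * s))"
      using kl unfolding F_def P_def \<open>kl = (k, l)\<close> prod.case
      by (intro gauss_tail I s t var norm_upto_lattice_vec) (auto simp: K_def)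
  qed
  also have "\<dots> = real (card (lattice_net N)) * real (card (lattice_net N)) * (2 * exp (- t\<^sup>2 / (2 * s)))"
    by (simp add: K_def card_cartesian_product)
  also have "\<dots> \<le> 2 ^ (18 * N) * 2 ^ (18 * N) * (2 * exp (- t\<^sup>2 / (2 * s)))"
    by (intro mult_right_mono mult_mono card_lattice_net) auto
  also have "\<dots> = 2 * 2 ^ (36 * N) * exp (- t\<^sup>2 / (2 * s))"
    by (simp flip: power_add)
  finally have 1: "measure P E \<le> 2 * 2 ^ (36 * N) * exp (- t\<^sup>2 / (2 * s))" .
  have 2: "\<bar>bilin N (M g) u v\<bar> \<le> 2 * t * norm_upto N u * norm_upto N v" if "g \<in> space P - E" for g u v
  proof (rule lattice_net_bound[OF N])
    fix k l assume "k \<in> lattice_net N" "l \<in> lattice_net N"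
    then have "g \<notin> F (k, l)" using that by (auto simp: E_def K_def)
    then show "\<bar>bilin N (M g) (lattice_vec N k) (lattice_vec N l)\<bar> \<le> t"
      using that by (simp add: F_def lin)
  qed
  have 3: "E \<in> sets P" unfolding E_def using fin meas by (intro sets.finite_UN) auto
  show ?thesis using that[of E] 1 2 3 unfolding P_def by blast
qed

section \<open>The noise matrix\<close>

definition noise_mat :: "nat \<Rightarrow> (nat \<times> nat \<times> nat \<times> nat \<Rightarrow> real) \<Rightarrow> nat \<Rightarrow> nat \<Rightarrow> real" where
  "noise_mat d g p q = (if p div d < q div d then g (p div d, q div d, p mod d, q mod d)
     else if q div d < p div d then g (q div d, p div d, q mod d, p mod d) else 0)"

text \<open>The coefficient of one Gaussian variable in u^T W v; the variable occurs at two
  transposed positions of W.\<close>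

definition noise_coeff :: "nat \<Rightarrow> (nat \<Rightarrow> real) \<Rightarrow> (nat \<Rightarrow> real) \<Rightarrow> nat \<times> nat \<times> nat \<times> nat \<Rightarrow> real" where
  "noise_coeff d u v = (\<lambda>(i, j, a, b). u (i*d + a) * v (j*d + b) + u (j*d + b) * v (i*d + a))"

lemma sym_upto_noise_mat: "sym_upto N (noise_mat d g)"
  by (auto simp: sym_upto_def noise_mat_def)

lemma finite_gidx [simp]: "finite (gidx n d)"
proof -
  have "gidx n d \<subseteq> {..<n} \<times> {..<n} \<times> {..<d} \<times> {..<d}" by (auto simp: gidx_def)
  then show ?thesis by (rule finite_subset) auto
qed

lemma sum_gidx:
  assumes d: "d > 0"
  shows "(\<Sum>e\<in>gidx n d. F e) = (\<Sum>p<n*d. \<Sum>q<n*d.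
    if p div d < q div d then F (p div d, q div d, p mod d, q mod d) else 0 :: real)"
proof -
  define G where "G = (\<lambda>(p, q). F (p div d, q div d, p mod d, q mod d))"
  define K where "K = {pq \<in> {..<n*d} \<times> {..<n*d}. fst pq div d < snd pq div d}"
  have "(\<Sum>e\<in>gidx n d. F e) = sum G K"
  proof (rule sum.reindex_bij_witness[of _ "\<lambda>(p, q). (p div d, q div d, p mod d, q mod d)"
        "\<lambda>(i, j, a, b). (i*d + a, j*d + b)"])
    show "(case e of (i, j, a, b) \<Rightarrow> (i*d + a, j*d + b)) \<in> K" if "e \<in> gidx n d" for e
      using that block_less[of _ n _ d] by (auto simp: gidx_def K_def)
    show "(case pq of (p, q) \<Rightarrow> (p div d, q div d, p mod d, q mod d)) \<in> gidx n d" if "pq \<in> K" for pq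
      using that d by (auto simp: gidx_def K_def div_less_iff_less_mult)
  qed (auto simp: gidx_def K_def G_def)
  also have "\<dots> = (\<Sum>pq\<in>{..<n*d} \<times> {..<n*d}. if fst pq div d < snd pq div d then G pq else 0)"
    unfolding K_def by (rule sum.inter_filter) simp
  also have "\<dots> = (\<Sum>p<n*d. \<Sum>q<n*d. if p div d < q div d then G (p, q) else 0)"
    by (simp add: sum.cartesian_product case_prod_unfold cong: if_cong)
  finally show ?thesis by (simp add: G_def cong: if_cong)
qed

lemma bilin_noise_mat:
  assumes d: "d > 0"
  shows "bilin (n*d) (noise_mat d g) u v = (\<Sum>e\<in>gidx n d. noise_coeff d u v e * g e)"
proof -
  let ?g = "\<lambda>p q. g (p div d, q div d, p mod d, q mod d)"
  have "bilin (n*d) (noise_mat d g) u v = (\<Sum>p<n*d. \<Sum>q<n*d. if p div d < q div d then ?g p q * (u p * v q) else 0)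
      + (\<Sum>p<n*d. \<Sum>q<n*d. if q div d < p div d then ?g q p * (u p * v q) else 0)"
    unfolding bilin_eq sum.distrib[symmetric] by (intro sum.cong refl) (auto simp: noise_mat_def)
  also have "(\<Sum>p<n*d. \<Sum>q<n*d. if q div d < p div d then ?g q p * (u p * v q) else 0)
      = (\<Sum>p<n*d. \<Sum>q<n*d. if p div d < q div d then ?g p q * (u q * v p) else 0)"
    by (rule sum.swap)
  finally show ?thesis
    unfolding sum_gidx[OF d] sum.distrib[symmetric]
    by (simp only:) (intro sum.cong refl, auto simp: noise_coeff_def algebra_simps)
qed

text \<open>After (a + b)^2 \<le> 2 a^2 + 2 b^2, exchanging p and q moves the second sum to the
  pairs in reversed block order, so both sums together are part of one full sum and the constant
  stays 2.\<close>

lemma noise_coeff_sum_squares: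
  assumes d: "d > 0"
  shows "(\<Sum>e\<in>gidx n d. (noise_coeff d u v e)\<^sup>2) \<le> 2 * (norm_upto (n*d) u)\<^sup>2 * (norm_upto (n*d) v)\<^sup>2"
proof -
  let ?N = "n*d"
  have "(\<Sum>e\<in>gidx n d. (noise_coeff d u v e)\<^sup>2) = (\<Sum>p<?N. \<Sum>q<?N. if p div d < q div d then (u p * v q + u q * v p)\<^sup>2 else 0)"
    unfolding sum_gidx[OF d] by (intro sum.cong refl) (auto simp: noise_coeff_def)
  also have "\<dots> \<le> (\<Sum>p<?N. \<Sum>q<?N. (if p div d < q div d then 2 * ((u p)\<^sup>2 * (v q)\<^sup>2) else 0)
      + (if p div d < q div d then 2 * ((u q)\<^sup>2 * (v p)\<^sup>2) else 0))"
  proof (intro sum_mono)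
    fix p q
    have "0 \<le> (u p * v q - u q * v p)\<^sup>2" by simp
    then show "(if p div d < q div d then (u p * v q + u q * v p)\<^sup>2 else 0)
      \<le> (if p div d < q div d then 2 * ((u p)\<^sup>2 * (v q)\<^sup>2) else 0)
      + (if p div d < q div d then 2 * ((u q)\<^sup>2 * (v p)\<^sup>2) else 0)"
      by (simp add: power2_eq_square algebra_simps)
  qed
  also have "\<dots> = (\<Sum>p<?N. \<Sum>q<?N. (if p div d < q div d then 2 * ((u p)\<^sup>2 * (v q)\<^sup>2) else 0))
      + (\<Sum>p<?N. \<Sum>q<?N. (if p div d < q div d then 2 * ((u q)\<^sup>2 * (v p)\<^sup>2) else 0))"
    by (simp add: sum.distrib)
  also have "(\<Sum>p<?N. \<Sum>q<?N. (if p div d < q div d then 2 * ((u q)\<^sup>2 * (v p)\<^sup>2) else 0))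
      = (\<Sum>p<?N. \<Sum>q<?N. (if q div d < p div d then 2 * ((u p)\<^sup>2 * (v q)\<^sup>2) else 0))"
    by (rule sum.swap)
  also have "(\<Sum>p<?N. \<Sum>q<?N. (if p div d < q div d then 2 * ((u p)\<^sup>2 * (v q)\<^sup>2) else 0)) + \<dots>
      \<le> (\<Sum>p<?N. \<Sum>q<?N. 2 * ((u p)\<^sup>2 * (v q)\<^sup>2))"
    unfolding sum.distrib[symmetric] by (intro sum_mono) auto
  also have "\<dots> = 2 * (norm_upto ?N u)\<^sup>2 * (norm_upto ?N v)\<^sup>2"
    unfolding inner_upto_self[symmetric] inner_upto_def mult.assoc sum_product
    by (simp add: power2_eq_square sum_distrib_left mult.assoc)
  finally show ?thesis .
qed

lemma two_power_le_exp: "(2::real) ^ k \<le> exp (real k)"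
proof -
  have "(2::real) \<le> exp 1" using exp_ge_add_one_self[of 1] by simp
  then have "(2::real) ^ k \<le> exp 1 ^ k" by (intro power_mono) auto
  then show ?thesis by (simp flip: exp_of_nat_mult)
qed

text \<open>For the blocks of W Z the bound is 40 (n d)^(3/4), above their typical order sqrt (n d).
  The surplus produces an exponent of order d sqrt (n d), enough for the union over n blocks with a
  failure probability depending on n alone. It is affordable because \<sigma> (n d)^(3/4) = O(n) is
  again the assumed noise level.\<close>

lemma noise_event:
  assumes n: "n > 0" and d: "d > 0"
  shows "\<exists>E\<in>sets (gauss_space n d).
    measure (gauss_space n d) E \<le> 2 * exp (- real n) + 2 * real n * exp (- sqrt n) \<and>
    (\<forall>g\<in>space (gauss_space n d) - E.
      (\<forall>u v. \<bar>bilin (n*d) (noise_mat d g) u v\<bar> \<le> 40 * sqrt (real n * real d) * norm_upto (n*d) u * norm_upto (n*d) v) \<and>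
      (\<forall>i<n. \<forall>x y. \<bar>bilin (n*d) (noise_mat d g) (stack d y) (block_vec d i x)\<bar>
         \<le> 40 * sqrt (real n * real d * sqrt (real n * real d)) * norm_upto d x * norm_upto d y))"
proof -
  interpret prob_space "gauss_space n d"
    unfolding gauss_space_def by (intro prob_space_PiM std_gauss.prob_space_axioms)
  let ?N = "n * d"
  have N: "?N > 0" using n d by simp
  \<comment> \<open>With s = 2 the level 20 sqrt (n d) gives the exponent 100 n d, of which the net
    takes at most 36 n d.\<close>
  obtain E0 where E0: "E0 \<in> events" "prob E0 \<le> 2 * 2 ^ (36 * ?N) * exp (- (20 * sqrt ?N)\<^sup>2 / (2 * 2))"
    "\<And>g u v. g \<in> space (gauss_space n d) - E0 \<Longrightarrow>
      \<bar>bilin ?N (noise_mat d g) u v\<bar> \<le> 2 * (20 * sqrt ?N) * norm_upto ?N u * norm_upto ?N v"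
  proof (rule gaussian_form_bound[OF N finite_gidx[of n d], of 2 "20 * sqrt ?N" "noise_mat d" "noise_coeff d", folded gauss_space_def])
    show "bilin ?N (noise_mat d g) u v = (\<Sum>e\<in>gidx n d. noise_coeff d u v e * g e)" for g u v
      by (rule bilin_noise_mat[OF d])
    show "(\<Sum>e\<in>gidx n d. (noise_coeff d u v e)\<^sup>2) \<le> 2" if "norm_upto ?N u \<le> 1" "norm_upto ?N v \<le> 1" for u v
    proof -
      have "(norm_upto ?N u)\<^sup>2 * (norm_upto ?N v)\<^sup>2 \<le> 1 * 1"
        using that by (intro mult_mono) (auto simp: power_le_one)
      then show ?thesis using noise_coeff_sum_squares[OF d, where n=n and u=u and v=v] by linarith
    qed
  qed (use that in auto)
  \<comment> \<open>Half of the block bound, since the net loses a factor 2. With s = 2 n the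
    exponent is 100 d sqrt (n d), against at most 36 d from the net.\<close>
  define t where "t = 20 * sqrt (n * d * sqrt (n * d))"
  have ex: "\<exists>E \<in> events. prob E \<le> 2 * 2 ^ (36 * d) * exp (- t\<^sup>2 / (2 * (2 * n))) \<and>
      (\<forall>g x y. g \<in> space (gauss_space n d) - E \<longrightarrow>
        \<bar>bilin ?N (noise_mat d g) (stack d y) (block_vec d i x)\<bar> \<le> 2 * t * norm_upto d y * norm_upto d x)" if i: "i < n" for i
  proof -
    \<comment> \<open>The i-th d x d block of Z^T W.\<close>
    define M where "M = (\<lambda>g a b. \<Sum>j<n. noise_mat d g (j*d + a) (i*d + b))"
    have M: "bilin d (M g) y x = bilin ?N (noise_mat d g) (stack d y) (block_vec d i x)" for g x y
    proof -
      have "bilin ?N (noise_mat d g) (stack d y) (block_vec d i x) = inner_upto ?N (mat_vec ?N (noise_mat d g) (stack d y)) (block_vec d i x)"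
        by (subst bilin_commute[OF sym_upto_noise_mat]) (simp add: bilin_def inner_upto_commute)
      also have "\<dots> = (\<Sum>b<d. x b * mat_vec ?N (noise_mat d g) (stack d y) (i*d + b))"
        by (subst inner_upto_commute) (rule inner_upto_block_vec[OF i])
      also have "\<dots> = (\<Sum>b<d. \<Sum>j<n. \<Sum>a<d. noise_mat d g (j*d + a) (i*d + b) * (y a * x b))"
        unfolding mat_vec_def sum_blocks sum_distrib_left
        using sym_upto_noise_mat[of ?N d g] block_less[of _ n _ d] i
        by (intro sum.cong refl) (auto simp: sym_upto_def stack_def)
      also have "\<dots> = (\<Sum>b<d. \<Sum>a<d. \<Sum>j<n. noise_mat d g (j*d + a) (i*d + b) * (y a * x b))"
        by (intro sum.cong refl sum.swap)
      also have "\<dots> = (\<Sum>a<d. \<Sum>b<d. \<Sum>j<n. noise_mat d g (j*d + a) (i*d + b) * (y a * x b))"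
        by (rule sum.swap)
      finally show ?thesis by (simp add: bilin_eq M_def sum_distrib_right)
    qed
    obtain E where E: "E \<in> events" "prob E \<le> 2 * 2 ^ (36 * d) * exp (- t\<^sup>2 / (2 * (2 * n)))"
      "\<And>g u v. g \<in> space (gauss_space n d) - E \<Longrightarrow> \<bar>bilin d (M g) u v\<bar> \<le> 2 * t * norm_upto d u * norm_upto d v"
    proof (rule gaussian_form_bound[OF d finite_gidx[of n d], of "2 * n" t M
          "\<lambda>y x. noise_coeff d (stack d y) (block_vec d i x)", folded gauss_space_def])
      show "bilin d (M g) u v = (\<Sum>e\<in>gidx n d. noise_coeff d (stack d u) (block_vec d i v) e * g e)" for g u v
        unfolding M by (rule bilin_noise_mat[OF d])
      show "(\<Sum>e\<in>gidx n d. (noise_coeff d (stack d u) (block_vec d i v) e)\<^sup>2) \<le> real (2 * n)"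
        if "norm_upto d u \<le> 1" "norm_upto d v \<le> 1" for u v
      proof -
        have "(norm_upto d u)\<^sup>2 * (norm_upto d v)\<^sup>2 \<le> 1 * 1"
          using that by (intro mult_mono) (auto simp: power_le_one)
        then have "n * ((norm_upto d u)\<^sup>2 * (norm_upto d v)\<^sup>2) \<le> real n * (1 * 1)"
          by (intro mult_left_mono) auto
        then have "(norm_upto ?N (stack d u))\<^sup>2 * (norm_upto ?N (block_vec d i v))\<^sup>2 \<le> n * 1"
          unfolding norm_upto_stack norm_upto_block_vec[OF i] by (simp add: mult.assoc)
        then show ?thesis using noise_coeff_sum_squares[OF d, where n=n and u="stack d u" and v="block_vec d i v"] by simp
      qed
    qed (use n in \<open>auto simp: t_def\<close>)
    then show ?thesis unfolding M by blast
  qed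
  then obtain E where E: "\<And>i. i < n \<Longrightarrow> E i \<in> events"
    "\<And>i. i < n \<Longrightarrow> prob (E i) \<le> 2 * 2 ^ (36 * d) * exp (- t\<^sup>2 / (2 * (2 * n)))"
    "\<And>i g x y. i < n \<Longrightarrow> g \<in> space (gauss_space n d) - E i \<Longrightarrow>
        \<bar>bilin ?N (noise_mat d g) (stack d y) (block_vec d i x)\<bar> \<le> 2 * t * norm_upto d y * norm_upto d x"
    by metis
  have p0: "prob E0 \<le> 2 * exp (- real n)"
  proof -
    have "(2::real) ^ (36 * ?N) * exp (- (20 * sqrt ?N)\<^sup>2 / (2 * 2)) \<le> exp (real (36 * ?N)) * exp (- (20 * sqrt ?N)\<^sup>2 / (2 * 2))"
      by (intro mult_right_mono two_power_le_exp) auto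
    also have "\<dots> = exp (- (64 * real ?N))"
      by (simp add: mult_exp_exp power_mult_distrib del: of_nat_mult)
    also have "\<dots> \<le> exp (- real n)"
    proof -
      have "real n * 1 \<le> real n * real d" using d by (intro mult_left_mono) auto
      then have "real n \<le> real ?N" by simp
      then have "real n \<le> 64 * real ?N" by linarith
      then show ?thesis by simp
    qed
    finally show ?thesis using E0(2) by linarith
  qed
  have pi: "prob (E i) \<le> 2 * exp (- sqrt n)" if i: "i < n" for i
  proof -
    have t2: "t\<^sup>2 / (2 * (2 * n)) = 100 * (d * sqrt (n * d))"
    proof -
      have "t\<^sup>2 = 400 * (n * d * sqrt (n * d))"
        unfolding t_def power_mult_distrib by simp
      then show ?thesis using n by (simp add: field_simps)
    qed
    have "(2::real) ^ (36 * d) * exp (- t\<^sup>2 / (2 * (2 * n))) \<le> exp (real (36 * d)) * exp (- t\<^sup>2 / (2 * (2 * n)))"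
      by (intro mult_right_mono two_power_le_exp) auto
    also have "\<dots> = exp (36 * d - 100 * (d * sqrt (n * d)))"
      using t2 by (simp add: mult_exp_exp)
    also have "\<dots> \<le> exp (- sqrt n)"
    proof -
      have "sqrt (real n) \<le> sqrt (n * d)"
        using d mult_left_mono[of 1 "real d" "real n"] by simp
      moreover have "1 \<le> sqrt (real n * d)" using n d
        by (simp add: Suc_le_eq flip: of_nat_mult)
      moreover have "real d \<ge> 1" using d by simp
      ultimately have "36 * real d \<le> 36 * (d * sqrt (n * d))" "sqrt (n * d) \<le> d * sqrt (n * d)"
        using mult_left_mono[of 1 "sqrt (n * d)" "real d"] mult_right_mono[of 1 "real d" "sqrt (n * d)"]
        by simp_all
      then show ?thesis using \<open>sqrt (real n) \<le> sqrt (n * d)\<close> unfolding exp_le_cancel_iff by linarith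
    qed
    finally show ?thesis using E(2)[OF i] by linarith
  qed
  define B where "B = E0 \<union> (\<Union>i<n. E i)"
  have "prob B \<le> prob E0 + prob (\<Union>i<n. E i)"
    unfolding B_def using E0(1) E(1) by (intro measure_Un_le) auto
  also have "prob (\<Union>i<n. E i) \<le> (\<Sum>i<n. prob (E i))"
    using E(1) by (intro finite_measure_subadditive_finite) auto
  also have "\<dots> \<le> (\<Sum>i<n. 2 * exp (- sqrt n))" by (intro sum_mono pi) auto
  finally have prob: "prob B \<le> 2 * exp (- real n) + 2 * real n * exp (- sqrt n)" using p0 by simp
  have ev: "B \<in> events" unfolding B_def using E0(1) E(1) by auto
  have b1: "\<bar>bilin ?N (noise_mat d g) u v\<bar> \<le> 40 * sqrt (n * d) * norm_upto ?N u * norm_upto ?N v"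
    if "g \<in> space (gauss_space n d) - B" for g u v
    using E0(3)[of g u v] that unfolding B_def by auto
  have b2: "\<bar>bilin ?N (noise_mat d g) (stack d y) (block_vec d i x)\<bar> \<le> 40 * sqrt (n * d * sqrt (n * d)) * norm_upto d x * norm_upto d y"
    if "g \<in> space (gauss_space n d) - B" "i < n" for g i x y
  proof -
    have "g \<in> space (gauss_space n d) - E i" using that by (auto simp: B_def)
    then have "\<bar>bilin ?N (noise_mat d g) (stack d y) (block_vec d i x)\<bar> \<le> 2 * t * norm_upto d y * norm_upto d x"
      using E(3) that(2) by blast
    also have "\<dots> = 40 * sqrt (n * d * sqrt (n * d)) * norm_upto d x * norm_upto d y" by (simp add: t_def)
    finally show ?thesis .
  qed
  show ?thesis
    by (intro bexI[OF _ ev] conjI prob ballI allI impI b1[unfolded of_nat_mult] b2[unfolded of_nat_mult])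
qed

text \<open>In a = n^(1/4) and b = d^(1/4) everything is polynomial and the hypothesis reads
  \<sigma> b^3 \<le> a / 1000. The second bound matches it in the powers of n and d, the third
  matches its square, with 3 times 40^2 / 1000^2 below 1/100, and the first has powers to
  spare.\<close>

lemma noise_level_bounds:
  fixes n d :: nat and \<sigma> :: real
  assumes n: "n > 0" and d: "d > 0" and \<sigma>: "\<sigma> > 0"
    and le: "\<sigma> \<le> 1 / 1000 * real n powr (1/4) / real d powr (3/4)"
  shows "\<sigma> * (40 * sqrt (real n * real d)) \<le> n / 25"
    and "\<sigma> * (40 * sqrt (real n * real d * sqrt (real n * real d))) \<le> n / 25"
    and "3 * (\<sigma> * (40 * sqrt (real n * real d)))\<^sup>2 * sqrt (real n * real d) \<le> n\<^sup>2 / 100"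
proof -
  define a b where "a = real n powr (1/4)" and "b = real d powr (1/4)"
  have a4: "real n = a ^ 4" and b4: "real d = b ^ 4"
    using n d by (simp_all add: a_def b_def powr_powr flip: powr_realpow)
  have a1: "a \<ge> 1" and b1: "b \<ge> 1" using n d by (simp_all add: a_def b_def ge_one_powr_ge_zero)
  have "real d powr (3/4) = b ^ 3" using d by (simp add: b_def powr_powr flip: powr_realpow)
  then have s: "\<sigma> * b ^ 3 \<le> a / 1000" using le b1 by (simp add: a_def[symmetric] field_simps)
  have r: "sqrt (real n * real d) = a\<^sup>2 * b\<^sup>2"
    using a1 b1 by (intro real_sqrt_unique) (auto simp: a4 b4 power2_eq_square power4_eq_xxxx)
  have r': "sqrt (real n * real d * sqrt (real n * real d)) = a ^ 3 * b ^ 3"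
    unfolding r using a1 b1
    by (intro real_sqrt_unique) (auto simp: a4 b4 power2_eq_square power4_eq_xxxx power3_eq_cube)
  have s2: "\<sigma> * b\<^sup>2 \<le> a / 1000"
  proof -
    have "b\<^sup>2 \<le> b ^ 3" using b1 by (intro power_increasing) auto
    then have "\<sigma> * b\<^sup>2 \<le> \<sigma> * b ^ 3" using \<sigma> by (intro mult_left_mono) auto
    then show ?thesis using s by linarith
  qed
  have "\<sigma> * (40 * sqrt (real n * real d)) = 40 * a\<^sup>2 * (\<sigma> * b\<^sup>2)" unfolding r by simp
  also have "\<dots> \<le> 40 * a\<^sup>2 * (a / 1000)" using s2 by (intro mult_left_mono) auto
  also have "\<dots> = a ^ 3 / 25" by (simp add: power2_eq_square power3_eq_cube)
  also have "\<dots> \<le> a ^ 4 / 25" using a1 by (intro divide_right_mono power_increasing) auto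
  finally show "\<sigma> * (40 * sqrt (real n * real d)) \<le> n / 25" by (simp add: a4)
  have "\<sigma> * (40 * sqrt (real n * real d * sqrt (real n * real d))) = 40 * a ^ 3 * (\<sigma> * b ^ 3)" unfolding r' by simp
  also have "\<dots> \<le> 40 * a ^ 3 * (a / 1000)" using s a1 by (intro mult_left_mono) auto
  also have "\<dots> = n / 25" by (simp add: a4 power3_eq_cube power4_eq_xxxx)
  finally show "\<sigma> * (40 * sqrt (real n * real d * sqrt (real n * real d))) \<le> n / 25" .
  have "3 * (\<sigma> * (40 * sqrt (real n * real d)))\<^sup>2 * sqrt (real n * real d) = 4800 * a ^ 6 * (\<sigma> * b ^ 3)\<^sup>2"
    unfolding r by (simp add: power2_eq_square power3_eq_cube eval_nat_numeral)
  also have "\<dots> \<le> 4800 * a ^ 6 * (a / 1000)\<^sup>2"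
    using s a1 b1 \<sigma> by (intro mult_left_mono power_mono) auto
  also have "\<dots> = (a ^ 4)\<^sup>2 * (4800 / 1000000)"
    by (simp add: power2_eq_square eval_nat_numeral)
  also have "\<dots> \<le> (a ^ 4)\<^sup>2 * (1 / 100)" by (intro mult_left_mono) auto
  finally show "3 * (\<sigma> * (40 * sqrt (real n * real d)))\<^sup>2 * sqrt (real n * real d) \<le> n\<^sup>2 / 100" by (simp add: a4)
qed

section \<open>Measurability of the tightness event\<close>

text \<open>The tube lemma: if the fibre {x} x K avoids C, so do the fibres over a neighbourhood of
  x.\<close>

lemma closed_projection_compact:
  fixes C :: "('a::topological_space \<times> 'b::topological_space) set"
  assumes K: "compact K" and C: "closed C"
  shows "closed {x. \<exists>k\<in>K. (x, k) \<in> C}"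
proof -
  have "open {x. \<forall>k\<in>K. (x, k) \<in> - C}"
  proof (subst open_subopen, safe)
    fix x assume "\<forall>k\<in>K. (x, k) \<in> - C"
    then have "{x} \<times> K \<subseteq> - C" by auto
    from Elementary_Topology.tube_lemma[OF K _ this] C
    obtain X0 where "x \<in> X0" "open X0" "X0 \<times> K \<subseteq> - C" by auto
    then show "\<exists>T. open T \<and> x \<in> T \<and> T \<subseteq> {x. \<forall>k\<in>K. (x, k) \<in> - C}" by blast
  qed
  moreover have "{x. \<exists>k\<in>K. (x, k) \<in> C} = - {x. \<forall>k\<in>K. (x, k) \<in> - C}" by auto
  ultimately show ?thesis by (simp add: closed_def)
qed

lemma continuous_on_entry:
  fixes f :: "'a::topological_space \<Rightarrow> nat \<Rightarrow> nat \<Rightarrow> real"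
  assumes "continuous_on S f"
  shows "continuous_on S (\<lambda>x. f x p q)"
proof -
  have "continuous_on S (\<lambda>x. f x p)" using assms by (rule continuous_on_product_then_coordinatewise)
  then show ?thesis by (rule continuous_on_product_then_coordinatewise)
qed

text \<open>Tychonoff, once for each index, since matrices are curried functions.\<close>

lemma compact_entry_box:
  fixes B :: "nat \<Rightarrow> nat \<Rightarrow> real set"
  assumes "\<And>p q. compact (B p q)"
  shows "compact {f. \<forall>p q. f p q \<in> B p q}"
proof -
  have inner: "compact (PiE UNIV (B p))" for p
    using compactin_PiE[of "\<lambda>_::nat. euclidean :: real topology" UNIV "B p"] assms
    by (simp add: euclidean_product_topology)
  have "compact (PiE UNIV (\<lambda>p. PiE UNIV (B p)))"
    using compactin_PiE[of "\<lambda>_::nat. euclidean :: (nat \<Rightarrow> real) topology" UNIV "\<lambda>p. PiE UNIV (B p)"] inner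
    by (simp add: euclidean_product_topology)
  moreover have "PiE UNIV (\<lambda>p. PiE UNIV (B p)) = {f. \<forall>p q. f p q \<in> B p q}"
    by (auto simp: PiE_def Pi_def)
  ultimately show ?thesis by simp
qed

text \<open>Zero entries outside the n d x n d square make the entry function of a matrix unique and
  the feasible set compact in the product topology.\<close>

definition feasible_fun_set :: "nat \<Rightarrow> nat \<Rightarrow> (nat \<Rightarrow> nat \<Rightarrow> real) set" where
  "feasible_fun_set n d = {f. feasible_fun n d f \<and> (\<forall>p q. \<not> (p < n*d \<and> q < n*d) \<longrightarrow> f p q = 0)}"

definition trunc :: "nat \<Rightarrow> (nat \<Rightarrow> nat \<Rightarrow> real) \<Rightarrow> nat \<Rightarrow> nat \<Rightarrow> real" where
  "trunc N f p q = (if p < N \<and> q < N then f p q else 0)"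

lemma feasible_fun_cong: "(\<And>p q. p < n*d \<Longrightarrow> q < n*d \<Longrightarrow> f p q = h p q) \<Longrightarrow> feasible_fun n d f = feasible_fun n d h"
  by (auto simp: feasible_fun_def psd_upto_def sym_upto_def bilin_eq)

lemma frob_upto_cong:
  "(\<And>p q. p < N \<Longrightarrow> q < N \<Longrightarrow> A p q = A' p q) \<Longrightarrow> (\<And>p q. p < N \<Longrightarrow> q < N \<Longrightarrow> f p q = h p q) \<Longrightarrow>
    frob_upto N A f = frob_upto N A' h"
  by (simp add: frob_upto_def)

lemma trunc_feasible_fun: "feasible_fun n d f \<Longrightarrow> trunc (n*d) f \<in> feasible_fun_set n d"
  using feasible_fun_cong[of n d "trunc (n*d) f" f] by (auto simp: feasible_fun_set_def trunc_def)

lemma frob_upto_trunc: "frob_upto N A (trunc N f) = frob_upto N A f"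
  by (rule frob_upto_cong) (auto simp: trunc_def)

text \<open>The form at e_p + e_q and at e_p - e_q, with diagonal entries 1.\<close>

lemma feasible_fun_abs_le_1:
  assumes f: "feasible_fun n d f" and p: "p < n*d" and q: "q < n*d"
  shows "\<bar>f p q\<bar> \<le> 1"
proof -
  let ?N = "n*d"
  let ?e = "\<lambda>p r. if r = p then 1 else 0 :: real"
  have psd: "psd_upto ?N f" and diag: "f p p = 1" "f q q = 1" using f p q by (auto simp: feasible_fun_def)
  have sym: "sym_upto ?N f" using psd by (simp add: psd_upto_def)
  have "0 \<le> bilin ?N f (\<lambda>r. ?e p r + c * ?e q r) (\<lambda>r. ?e p r + c * ?e q r)" for c
    using psd by (simp add: psd_upto_def)
  then have "0 \<le> f p p + c * f p q + (c * f q p + c * (c * f q q))" for c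
    unfolding bilin_add_left bilin_add_right bilin_scale_right bilin_scale_left bilin_delta[OF p p] bilin_delta[OF p q]
      bilin_delta[OF q p] bilin_delta[OF q q] by (simp add: algebra_simps)
  from this[of 1] this[of "-1"] show ?thesis
    using sym p q by (auto simp: diag sym_upto_def)
qed

lemma compact_feasible_fun_set: "compact (feasible_fun_set n d)"
proof -
  let ?N = "n*d"
  define B where "B = {f :: nat \<Rightarrow> nat \<Rightarrow> real. \<forall>p q. f p q \<in> (if p < ?N \<and> q < ?N then {-1..1} else {0})}"
  have "compact B" unfolding B_def by (rule compact_entry_box) auto
  moreover have "closed {f. feasible_fun n d f}"
    unfolding feasible_fun_def psd_upto_def sym_upto_def bilin_eq
    by (intro closed_Collect_conj closed_Collect_all closed_Collect_imp closed_Collect_le closed_Collect_eq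
        open_Collect_const continuous_on_sum continuous_on_mult continuous_on_const
        continuous_on_entry continuous_on_id)
  moreover have "feasible_fun_set n d = {f. feasible_fun n d f} \<inter> B"
    using feasible_fun_abs_le_1[of n d] by (auto simp: feasible_fun_set_def B_def abs_le_iff split: if_splits)
  ultimately show ?thesis by (simp add: compact_Int_closed closed_Int_compact)
qed

text \<open>The first-order analysis starts from an optimum, so attainment is settled by
  compactness.\<close>

lemma opt_exists:
  assumes d: "d > 0"
  shows "\<exists>f. optimal_fun n d A f"
proof -
  have "feasible_fun_set n d \<noteq> {}" using trunc_feasible_fun[OF feasible_fun_consensus[OF d]] by blast
  then obtain f where f: "f \<in> feasible_fun_set n d" "\<And>h. h \<in> feasible_fun_set n d \<Longrightarrow> frob_upto (n*d) A h \<le> frob_upto (n*d) A f"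
  proof -
    have "continuous_on (feasible_fun_set n d) (frob_upto (n*d) A)"
      unfolding frob_upto_def[abs_def]
      by (intro continuous_on_sum continuous_on_mult continuous_on_const continuous_on_entry continuous_on_id)
    from continuous_attains_sup[OF compact_feasible_fun_set \<open>feasible_fun_set n d \<noteq> {}\<close> this] show ?thesis using that by blast
  qed
  have "frob_upto (n*d) A h \<le> frob_upto (n*d) A f" if "feasible_fun n d h" for h
    using f(2)[OF trunc_feasible_fun[OF that]] by (simp add: frob_upto_trunc)
  then show ?thesis using f(1) by (auto simp: optimal_fun_def feasible_fun_set_def)
qed

lemma opt_cong:
  assumes "\<And>p q. p < n*d \<Longrightarrow> q < n*d \<Longrightarrow> A p q = A' p q" "\<And>p q. p < n*d \<Longrightarrow> q < n*d \<Longrightarrow> f p q = h p q"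
  shows "optimal_fun n d A f = optimal_fun n d A' h"
proof -
  have "feasible_fun n d f = feasible_fun n d h" by (rule feasible_fun_cong) (rule assms(2))
  moreover have "frob_upto (n*d) A Y = frob_upto (n*d) A' Y" for Y by (rule frob_upto_cong) (use assms in auto)
  moreover have "frob_upto (n*d) A f = frob_upto (n*d) A' h" by (rule frob_upto_cong) (use assms in auto)
  ultimately show ?thesis by (simp add: optimal_fun_def)
qed

lemma opt_feasible_fun_set: "f \<in> feasible_fun_set n d \<Longrightarrow> optimal_fun n d A f \<longleftrightarrow> (\<forall>h\<in>feasible_fun_set n d. frob_upto (n*d) A h \<le> frob_upto (n*d) A f)"
proof
  assume f: "f \<in> feasible_fun_set n d" and *: "\<forall>h\<in>feasible_fun_set n d. frob_upto (n*d) A h \<le> frob_upto (n*d) A f"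
  have "frob_upto (n*d) A h \<le> frob_upto (n*d) A f" if "feasible_fun n d h" for h
    using * trunc_feasible_fun[OF that] frob_upto_trunc[of "n*d" A h] by auto
  then show "optimal_fun n d A f" using f by (simp add: optimal_fun_def feasible_fun_set_def)
qed (auto simp: optimal_fun_def feasible_fun_set_def)

text \<open>For feasible f this says f = R R^T with R the first block column of f, since the first
  diagonal block is the identity; in this form it is a closed condition.\<close>

definition factored :: "nat \<Rightarrow> nat \<Rightarrow> (nat \<Rightarrow> nat \<Rightarrow> real) \<Rightarrow> bool" where
  "factored n d f \<longleftrightarrow> (\<forall>p<n*d. \<forall>q<n*d. f p q = (\<Sum>b<d. f p b * f q b))"

definition data_mat :: "nat \<Rightarrow> real \<Rightarrow> (nat \<times> nat \<times> nat \<times> nat \<Rightarrow> real) \<Rightarrow> nat \<Rightarrow> nat \<Rightarrow> real" where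
  "data_mat d \<sigma> g p q = consensus d p q + \<sigma> * noise_mat d g p q"

text \<open>A form of \<open>good_event\<close> without ranks and without quantifiers over factors
  R: it quantifies over one compact set, as the measurability argument requires.\<close>

definition sdp_tight :: "nat \<Rightarrow> nat \<Rightarrow> real \<Rightarrow> (nat \<times> nat \<times> nat \<times> nat \<Rightarrow> real) \<Rightarrow> bool" where
  "sdp_tight n d \<sigma> g \<longleftrightarrow> (\<exists>f\<in>feasible_fun_set n d. factored n d f \<and> optimal_fun n d (data_mat d \<sigma> g) f) \<and>
    (\<forall>f\<in>feasible_fun_set n d. \<forall>h\<in>feasible_fun_set n d. optimal_fun n d (data_mat d \<sigma> g) f \<longrightarrow> optimal_fun n d (data_mat d \<sigma> g) h \<longrightarrow> f = h)"

lemma continuous_on_data_mat: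
  fixes f :: "'a::topological_space \<Rightarrow> nat \<times> nat \<times> nat \<times> nat \<Rightarrow> real"
  assumes "continuous_on S f"
  shows "continuous_on S (\<lambda>x. data_mat d \<sigma> (f x) p q)"
proof -
  have coord: "continuous_on S (\<lambda>x. f x e)" for e
    using assms by (rule continuous_on_product_then_coordinatewise)
  have "continuous_on S (\<lambda>x. noise_mat d (f x) p q)"
    by (cases "p div d" "q div d" rule: linorder_cases) (simp_all add: noise_mat_def coord)
  then show ?thesis unfolding data_mat_def by (intro continuous_on_add continuous_on_mult continuous_on_const)
qed

text \<open>Non-measurable sets have measure 0, so measurability cannot be skipped.  Existence of a factored
  optimum, and of two optima differing by at least 1 / Suc k in entry (p, q), are closed
  conditions, being projections of closed sets along a compact set.\<close>

lemma borel_sdp_tight: "{g. sdp_tight n d \<sigma> g} \<in> sets borel"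
proof -
  let ?N = "n*d"
  define le where "le = (\<lambda>(g, f). \<forall>h\<in>feasible_fun_set n d. frob_upto ?N (data_mat d \<sigma> g) h \<le> frob_upto ?N (data_mat d \<sigma> g) f)"
  have closed_le: "closed {x. le (u x, v x)}" if "continuous_on UNIV u" "continuous_on UNIV v"
    for u :: "'z::topological_space \<Rightarrow> _" and v
    unfolding le_def frob_upto_def prod.case Ball_def
    by (intro closed_Collect_all closed_Collect_imp open_Collect_const closed_Collect_le continuous_on_sum
        continuous_on_mult continuous_on_const continuous_on_data_mat[OF that(1)] continuous_on_entry[OF that(2)])
  define S1 where "S1 = {g. \<exists>f\<in>feasible_fun_set n d. (g, f) \<in> {x. factored n d (snd x) \<and> le (fst x, snd x)}}"
  define S2 where "S2 = (\<lambda>p q k. {g. \<exists>fh\<in>feasible_fun_set n d \<times> feasible_fun_set n d. (g, fh) \<in>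
      {x. 1 / real (Suc k) \<le> \<bar>fst (snd x) p q - snd (snd x) p q\<bar> \<and> le (fst x, fst (snd x)) \<and> le (fst x, snd (snd x))}})"
  have "closed S1"
    unfolding S1_def factored_def
    by (intro closed_projection_compact compact_feasible_fun_set closed_Collect_conj closed_le closed_Collect_all
        closed_Collect_imp open_Collect_const closed_Collect_eq continuous_on_sum continuous_on_mult
        continuous_on_entry continuous_on_fst continuous_on_snd continuous_on_id)
  moreover have "closed (S2 p q k)" for p q k
    unfolding S2_def
    by (intro closed_projection_compact compact_Times compact_feasible_fun_set closed_Collect_conj closed_le
        closed_Collect_le continuous_on_const continuous_on_rabs continuous_on_diff
        continuous_on_entry continuous_on_fst continuous_on_snd continuous_on_id)
  moreover have "{g. sdp_tight n d \<sigma> g} = S1 - (\<Union>p. \<Union>q. \<Union>k. S2 p q k)"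
  proof -
    have opt: "f \<in> feasible_fun_set n d \<Longrightarrow> optimal_fun n d (data_mat d \<sigma> g) f \<longleftrightarrow> le (g, f)" for f g
      by (simp add: le_def opt_feasible_fun_set)
    have S2: "(\<exists>p q k. g \<in> S2 p q k) \<longleftrightarrow> (\<exists>f\<in>feasible_fun_set n d. \<exists>h\<in>feasible_fun_set n d. f \<noteq> h \<and> le (g, f) \<and> le (g, h))" for g
    proof
      assume "\<exists>f\<in>feasible_fun_set n d. \<exists>h\<in>feasible_fun_set n d. f \<noteq> h \<and> le (g, f) \<and> le (g, h)"
      then obtain f h where fh: "f \<in> feasible_fun_set n d" "h \<in> feasible_fun_set n d" "f \<noteq> h" "le (g, f)" "le (g, h)" by blast
      then obtain p q where "f p q \<noteq> h p q" by (meson ext)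
      then obtain k where "1 / real (Suc k) < \<bar>f p q - h p q\<bar>"
        using nat_approx_posE[of "\<bar>f p q - h p q\<bar>"] by auto
      then have "1 / real (Suc k) \<le> \<bar>f p q - h p q\<bar>" by simp
      then have "g \<in> S2 p q k" unfolding S2_def using fh by (intro CollectI bexI[of _ "(f, h)"]) auto
      then show "\<exists>p q k. g \<in> S2 p q k" by blast
    next
      assume "\<exists>p q k. g \<in> S2 p q k"
      then obtain p q k f h where *: "f \<in> feasible_fun_set n d" "h \<in> feasible_fun_set n d"
        "1 / real (Suc k) \<le> \<bar>f p q - h p q\<bar>" "le (g, f)" "le (g, h)"
        by (auto simp: S2_def)
      have "0 < 1 / real (Suc k)" by simp
      then have "f \<noteq> h" using *(3) by auto
      then show "\<exists>f\<in>feasible_fun_set n d. \<exists>h\<in>feasible_fun_set n d. f \<noteq> h \<and> le (g, f) \<and> le (g, h)" using * by blast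
    qed
    show ?thesis
    proof (rule Set.set_eqI)
      fix g
      have "sdp_tight n d \<sigma> g \<longleftrightarrow> (\<exists>f\<in>feasible_fun_set n d. factored n d f \<and> le (g, f)) \<and>
          \<not> (\<exists>f\<in>feasible_fun_set n d. \<exists>h\<in>feasible_fun_set n d. f \<noteq> h \<and> le (g, f) \<and> le (g, h))"
        unfolding sdp_tight_def by (simp add: opt cong: bex_cong ball_cong) blast
      also have "\<dots> \<longleftrightarrow> g \<in> S1 \<and> \<not> (\<exists>p q k. g \<in> S2 p q k)"
        unfolding S2 by (simp add: S1_def)
      finally show "g \<in> {g. sdp_tight n d \<sigma> g} \<longleftrightarrow> g \<in> S1 - (\<Union>p. \<Union>q. \<Union>k. S2 p q k)" by simp
    qed
  qed
  ultimately show ?thesis by (auto intro!: sets.countable_UN borel_closed)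
qed

text \<open>The target carries the Borel sets of all functions on quadruples. A coordinate outside
  \<open>gidx\<close> is constantly \<open>undefined\<close> on the product space, hence
  measurable.\<close>

lemma gauss_space_borel: "(\<lambda>g. g) \<in> borel_measurable (gauss_space n d)"
proof (rule measurable_coordinatewise_then_product)
  fix e
  show "(\<lambda>g. g e) \<in> borel_measurable (gauss_space n d)"
  proof (cases "e \<in> gidx n d")
    case True
    then have "(\<lambda>g. g e) \<in> measurable (gauss_space n d) std_gauss"
      unfolding gauss_space_def by (rule measurable_component_singleton)
    then show ?thesis by (simp add: measurable_cong_sets[OF refl sets_std_gauss])
  next
    case False
    have "(\<lambda>g. g e) \<in> borel_measurable (gauss_space n d) \<longleftrightarrow>
        (\<lambda>g. undefined :: real) \<in> borel_measurable (gauss_space n d)"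
      using False by (intro measurable_cong) (auto simp: gauss_space_def space_PiM dest: PiE_arb)
    then show ?thesis by simp
  qed
qed

lemma sdp_tight_measurable: "{g \<in> space (gauss_space n d). sdp_tight n d \<sigma> g} \<in> sets (gauss_space n d)"
proof -
  have "(\<lambda>g. g) -` {g. sdp_tight n d \<sigma> g} \<inter> space (gauss_space n d) \<in> sets (gauss_space n d)"
    by (rule measurable_sets[OF gauss_space_borel borel_sdp_tight])
  then show ?thesis by (simp add: vimage_def Int_def conj_commute)
qed

lemma sdp_tight_if_noise_bounded:
  fixes n d :: nat
  assumes n: "n > 0" and d: "d > 0" and \<sigma>: "\<sigma> > 0"
    and Wbd: "\<And>u v. \<bar>bilin (n*d) (noise_mat d g) u v\<bar> \<le> w * norm_upto (n*d) u * norm_upto (n*d) v"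
    and fbd: "\<And>i x y. i < n \<Longrightarrow> \<bar>bilin (n*d) (noise_mat d g) (stack d y) (block_vec d i x)\<bar> \<le> f * norm_upto d x * norm_upto d y"
    and w: "w \<ge> 0" and f: "f \<ge> 0"
    and lev: "\<sigma> * w \<le> n / 25" "\<sigma> * f \<le> n / 25" "3 * (\<sigma> * w)\<^sup>2 * sqrt (real n * real d) \<le> n\<^sup>2 / 100"
  shows "sdp_tight n d \<sigma> g"
proof -
  have A: "data_mat d \<sigma> g = (\<lambda>p q. consensus d p q + \<sigma> * noise_mat d g p q)" by (simp add: data_mat_def fun_eq_iff)
  obtain X0 where X0: "optimal_fun n d (data_mat d \<sigma> g) X0" using opt_exists[OF d] by blast
  \<comment> \<open>The representative of the optimum in \<open>feasible_fun_set\<close>, needed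
    because \<open>sdp_tight\<close> compares whole functions.\<close>
  define X where "X = trunc (n*d) X0"
  have XF: "X \<in> feasible_fun_set n d" using X0 by (auto simp: X_def optimal_fun_def intro: trunc_feasible_fun)
  have X: "optimal_fun n d (data_mat d \<sigma> g) X"
    using X0 opt_cong[of n d "data_mat d \<sigma> g" "data_mat d \<sigma> g" X X0] by (simp add: X_def trunc_def)
  then have "psd_upto (n*d) X" by (simp add: optimal_fun_def feasible_fun_def)
  then obtain V where V: "gram (n*d) X V" using psd_upto_gram[of "n*d" X] by (auto simp: gram_def)
  interpret sdp_point n d "noise_mat d g" X \<sigma> w f "data_mat d \<sigma> g" "n*d" V
    using n d \<sigma> Wbd fbd w f lev X V
    by unfold_locales (auto simp: A sym_upto_noise_mat)
  have eq: "Y p q = (\<Sum>b<d. X p b * X q b)" if "optimal_fun n d (data_mat d \<sigma> g) Y" "p < n*d" "q < n*d" for Y p q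
    using opt_unique[of Y p q] that by (simp add: A)
  have uniq: "Y = X" if "Y \<in> feasible_fun_set n d" "optimal_fun n d (data_mat d \<sigma> g) Y" for Y
  proof (intro ext)
    fix p q
    show "Y p q = X p q"
    proof (cases "p < n*d \<and> q < n*d")
      case True
      then show ?thesis using eq[OF that(2), of p q] eq[OF X, of p q] by metis
    next
      case False
      then show ?thesis using that(1) XF by (simp add: feasible_fun_set_def)
    qed
  qed
  have "factored n d X" unfolding factored_def by (intro allI impI) (rule eq[OF X])
  then have "\<exists>f\<in>feasible_fun_set n d. factored n d f \<and> optimal_fun n d (data_mat d \<sigma> g) f" using X XF by (intro bexI[of _ X]) simp_all
  moreover have "f = h" if "f \<in> feasible_fun_set n d" "h \<in> feasible_fun_set n d" "optimal_fun n d (data_mat d \<sigma> g) f" "optimal_fun n d (data_mat d \<sigma> g) h" for f h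
    using uniq[OF that(1,3)] uniq[OF that(2,4)] by simp
  ultimately show ?thesis unfolding sdp_tight_def by (intro conjI ballI impI)
qed

section \<open>Matrices and the main theorem\<close>

text \<open>The leading d columns are independent because their top block is the identity, and every
  column combines them with its own first d entries as coefficients. They form a maximal independent
  set of columns, of size d since they are distinct.\<close>

lemma (in vec_space) rank_eq_leading_columns:
  assumes X: "X \<in> carrier_mat n n" and d: "d \<le> n"
    and id: "\<And>a b. a < d \<Longrightarrow> b < d \<Longrightarrow> X $$ (a, b) = (if a = b then 1 else 0)"
    and gen: "\<And>p q. p < n \<Longrightarrow> q < n \<Longrightarrow> X $$ (p, q) = (\<Sum>b<d. X $$ (p, b) * X $$ (b, q))"
  shows "rank X = d"
proof -
  define B where "B = mat n d (\<lambda>(p, b). X $$ (p, b))"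
  have B: "B \<in> carrier_mat n d" by (simp add: B_def)
  define S where "S = set (cols B)"
  have SX: "S \<subseteq> set (cols X)"
  proof
    fix v assume "v \<in> S"
    then obtain b where b: "b < d" "v = col B b" using B by (auto simp: S_def cols_def)
    then have "v = col X b" using X d by (auto simp: B_def)
    then show "v \<in> set (cols X)" using b d X by (auto simp: cols_def)
  qed
  have carr: "set (cols X) \<subseteq> carrier_vec n" using cols_dim[of X] X by auto
  have dist: "distinct (cols B)"
    unfolding distinct_conv_nth
  proof (intro allI impI)
    fix a b assume ab: "a < length (cols B)" "b < length (cols B)" "a \<noteq> b"
    then have ad: "a < d" "b < d" using B by auto
    then have "vec_index (col B a) a = 1" "vec_index (col B b) a = 0"
      using d ab(3) by (simp_all add: B_def id)
    then have "col B a \<noteq> col B b" by auto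
    then show "cols B ! a \<noteq> cols B ! b" using ad B by simp
  qed
  have Bv: "vec_index (B *\<^sub>v v) p = (\<Sum>b<d. X $$ (p, b) * vec_index v b)"
    if "v \<in> carrier_vec d" "p < n" for v p
    using that by (simp add: B_def scalar_prod_def lessThan_atLeast0)
  have indpt: "lin_indpt S"
  proof
    assume "lin_dep S"
    then obtain v where v: "v \<in> carrier_vec d" "v \<noteq> 0\<^sub>v d" "B *\<^sub>v v = 0\<^sub>v n"
      using lin_depE[OF B _ dist] unfolding S_def by blast
    have "vec_index v a = 0" if a: "a < d" for a
    proof -
      have "(\<Sum>b<d. X $$ (a, b) * vec_index v b) = (\<Sum>b<d. if b = a then vec_index v a else 0)"
        using a by (intro sum.cong refl) (auto simp: id)
      then show ?thesis using Bv[OF v(1), of a] v(3) a d by simp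
    qed
    then show False using v by auto
  qed
  have "maximal S (\<lambda>T. T \<subseteq> set (cols X) \<and> lin_indpt T)"
    unfolding maximal_def
  proof (intro conjI allI impI SX indpt)
    fix T assume T: "S \<subseteq> T \<and> T \<subseteq> set (cols X) \<and> lin_indpt T"
    show "T = S"
    proof (rule ccontr)
      assume "T \<noteq> S"
      then obtain t where t: "t \<in> T" "t \<notin> S" using T by blast
      then obtain q where q: "q < n" "t = col X q" using T X by (auto simp: cols_def)
      define v where "v = vec d (\<lambda>b. X $$ (b, q))"
      have v: "v \<in> carrier_vec d" by (simp add: v_def)
      have "t = B *\<^sub>v v"
      proof (rule eq_vecI)
        show "dim_vec t = dim_vec (B *\<^sub>v v)" using q X B by simp
        fix p assume "p < dim_vec (B *\<^sub>v v)"
        then have p: "p < n" using B by simp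
        then show "vec_index t p = vec_index (B *\<^sub>v v) p"
          using q X gen[OF p q(1)] unfolding Bv[OF v p] by (simp add: v_def)
      qed
      also have "\<dots> = lincomb (\<lambda>a. vec_index v (find_first a (cols B))) S"
        unfolding S_def by (rule lincomb_eq_mat_mult[OF B v dist, symmetric])
      finally have "t \<in> span S" unfolding span_def S_def by blast
      moreover have "t \<in> carrier_vec n" using t T carr by blast
      ultimately have "lin_dep (S \<union> {t})"
        using lin_dep_iff_in_span[of S t] indpt SX carr t(2) by auto
      moreover have "lin_indpt (S \<union> {t})" using subset_li_is_li[of T "S \<union> {t}"] T t by blast
      ultimately show False by blast
    qed
  qed
  then have "rank X = card S" by (rule rank_card_indpt[OF X])
  also have "\<dots> = d" using dist B by (simp add: S_def distinct_card)
  finally show ?thesis .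
qed

section \<open>Translation between matrices and entry functions\<close>

definition entries :: "real mat \<Rightarrow> nat \<Rightarrow> nat \<Rightarrow> real" where
  "entries X p q = X $$ (p, q)"

definition to_mat :: "nat \<Rightarrow> (nat \<Rightarrow> nat \<Rightarrow> real) \<Rightarrow> real mat" where
  "to_mat N f = mat N N (\<lambda>(p, q). f p q)"

lemma entries_to_mat: "p < N \<Longrightarrow> q < N \<Longrightarrow> entries (to_mat N f) p q = f p q"
  by (simp add: entries_def to_mat_def)

lemma to_mat_carrier [simp]: "to_mat N f \<in> carrier_mat N N"
  by (simp add: to_mat_def)

lemma to_mat_entries: "X \<in> carrier_mat N N \<Longrightarrow> to_mat N (entries X) = X"
  by (auto simp: entries_def to_mat_def)

lemma psd_iff: "psd N X \<longleftrightarrow> X \<in> carrier_mat N N \<and> psd_upto N (entries X)"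
proof (cases "X \<in> carrier_mat N N")
  case True
  have quad: "v \<bullet> (X *\<^sub>v v) = bilin N (entries X) (vec_index v) (vec_index v)" if "v \<in> carrier_vec N" for v
    using True that by (simp add: bilin_def inner_upto_def mat_vec_def entries_def scalar_prod_def lessThan_atLeast0)
  have "(X\<^sup>T = X) \<longleftrightarrow> sym_upto N (entries X)"
  proof
    assume "X\<^sup>T = X"
    then show "sym_upto N (entries X)"
      using True unfolding sym_upto_def entries_def by (metis carrier_matD index_transpose_mat(1))
  next
    assume "sym_upto N (entries X)"
    then show "X\<^sup>T = X" using True by (intro eq_matI) (auto simp: sym_upto_def entries_def)
  qed
  moreover have "(\<forall>v\<in>carrier_vec N. v \<bullet> (X *\<^sub>v v) \<ge> 0) \<longleftrightarrow> (\<forall>u. bilin N (entries X) u u \<ge> 0)"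
  proof
    assume *: "\<forall>v\<in>carrier_vec N. v \<bullet> (X *\<^sub>v v) \<ge> 0"
    show "\<forall>u. bilin N (entries X) u u \<ge> 0"
    proof
      fix u
      have "bilin N (entries X) u u = bilin N (entries X) (vec_index (vec N u)) (vec_index (vec N u))"
        by (rule bilin_cong) auto
      also have "\<dots> = vec N u \<bullet> (X *\<^sub>v vec N u)" by (rule quad[symmetric]) simp
      also have "\<dots> \<ge> 0" using * by simp
      finally show "bilin N (entries X) u u \<ge> 0" .
    qed
  qed (simp add: quad)
  ultimately show ?thesis using True by (simp add: psd_def psd_upto_def)
qed (simp add: psd_def)

lemma sdp_feasible_iff:
  assumes d: "d > 0"
  shows "sdp_feasible n d X \<longleftrightarrow> X \<in> carrier_mat (n*d) (n*d) \<and> feasible_fun n d (entries X)"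
proof -
  have "(\<forall>i<n. \<forall>a<d. \<forall>b<d. X $$ (i*d+a, i*d+b) = (if a = b then 1 else 0)) \<longleftrightarrow>
    (\<forall>p<n*d. \<forall>q<n*d. p div d = q div d \<longrightarrow> entries X p q = (if p = q then 1 else 0))" (is "?L \<longleftrightarrow> ?R")
  proof
    assume L: ?L
    show ?R
    proof (intro allI impI)
      fix p q assume pq: "p < n*d" "q < n*d" "p div d = q div d"
      have "X $$ (p div d * d + p mod d, p div d * d + q mod d) = (if p mod d = q mod d then 1 else 0)"
        using pq d by (intro L[rule_format]) (auto simp: div_less_iff_less_mult)
      moreover have "p div d * d + q mod d = q" using pq(3) by simp
      moreover have "p mod d = q mod d \<longleftrightarrow> p = q" using pq(3) by (metis div_mult_mod_eq)
      ultimately show "entries X p q = (if p = q then 1 else 0)" by (simp add: entries_def)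
    qed
  next
    assume R: ?R
    show ?L
    proof (intro allI impI)
      fix i a b assume *: "i < n" "a < d" "b < d"
      then show "X $$ (i*d+a, i*d+b) = (if a = b then 1 else 0)"
        using R[rule_format, of "i*d+a" "i*d+b"] block_less[of i n a d] block_less[of i n b d]
        by (simp add: entries_def)
    qed
  qed
  then show ?thesis by (auto simp: sdp_feasible_def feasible_fun_def psd_iff)
qed

lemma frob_eq_frob_upto: "frob N A X = frob_upto N (entries A) (entries X)"
  by (simp add: frob_def frob_upto_def entries_def)

lemma frob_upto_commute: "frob_upto N A X = frob_upto N X A"
  by (simp add: frob_upto_def mult.commute)

lemma sdp_solution_iff:
  assumes d: "d > 0"
  shows "sdp_solution n d A X \<longleftrightarrow> X \<in> carrier_mat (n*d) (n*d) \<and> optimal_fun n d (entries A) (entries X)"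
proof -
  let ?N = "n*d"
  have "(\<forall>Y. sdp_feasible n d Y \<longrightarrow> frob ?N A Y \<le> c) \<longleftrightarrow> (\<forall>f. feasible_fun n d f \<longrightarrow> frob_upto ?N (entries A) f \<le> c)" for c
  proof
    assume *: "\<forall>Y. sdp_feasible n d Y \<longrightarrow> frob ?N A Y \<le> c"
    show "\<forall>f. feasible_fun n d f \<longrightarrow> frob_upto ?N (entries A) f \<le> c"
    proof (intro allI impI)
      fix f assume "feasible_fun n d f"
      then have "sdp_feasible n d (to_mat ?N f)"
        unfolding sdp_feasible_iff[OF d] using feasible_fun_cong[of n d "entries (to_mat ?N f)" f] by (simp add: entries_to_mat)
      moreover have "frob_upto ?N (entries A) (entries (to_mat ?N f)) = frob_upto ?N (entries A) f"
        by (rule frob_upto_cong) (auto simp: entries_to_mat)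
      ultimately show "frob_upto ?N (entries A) f \<le> c" using * unfolding frob_eq_frob_upto by metis
    qed
  qed (simp add: frob_eq_frob_upto sdp_feasible_iff[OF d])
  then show ?thesis by (auto simp: sdp_solution_def optimal_fun_def sdp_feasible_iff[OF d] frob_eq_frob_upto)
qed

lemma entries_Amat:
  assumes d: "d > 0" and pq: "p < n*d" "q < n*d"
  shows "entries (Amat n d \<sigma> g) p q = data_mat d \<sigma> g p q"
proof -
  have "(Zmat n d * (Zmat n d)\<^sup>T) $$ (p, q)
      = (\<Sum>b<d. (if p mod d = b then 1 else 0) * (if q mod d = b then 1 else 0))"
    using pq by (simp add: Zmat_def scalar_prod_def lessThan_atLeast0)
  also have "\<dots> = (\<Sum>b<d. if b = p mod d then (if q mod d = p mod d then 1 else 0) else 0)"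
    by (intro sum.cong refl) auto
  also have "\<dots> = consensus d p q" using d by (auto simp: consensus_def)
  finally have "(Zmat n d * (Zmat n d)\<^sup>T) $$ (p, q) = consensus d p q" .
  moreover have "Wmat n d g $$ (p, q) = noise_mat d g p q"
    using pq by (simp add: Wmat_def noise_mat_def Let_def)
  moreover have "Wmat n d g \<in> carrier_mat (n*d) (n*d)" by (simp add: Wmat_def)
  ultimately show ?thesis using pq by (simp add: entries_def Amat_def data_mat_def)
qed

lemma sdp_solution_Amat:
  assumes d: "d > 0"
  shows "sdp_solution n d (Amat n d \<sigma> g) X \<longleftrightarrow>
    X \<in> carrier_mat (n*d) (n*d) \<and> optimal_fun n d (data_mat d \<sigma> g) (entries X)"
  unfolding sdp_solution_iff[OF d]
  using opt_cong[of n d "entries (Amat n d \<sigma> g)" "data_mat d \<sigma> g" "entries X" "entries X"] entries_Amat[OF d] by simp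

section \<open>Factorisations with orthogonal blocks\<close>

lemma mult_transpose_entry:
  "R \<in> carrier_mat N d \<Longrightarrow> p < N \<Longrightarrow> q < N \<Longrightarrow>
    (R * R\<^sup>T) $$ (p, q) = (\<Sum>b<d. R $$ (p, b) * R $$ (q, b))" for R :: "real mat"
  by (simp add: scalar_prod_def lessThan_atLeast0)

text \<open>For square R_i the conditions R_i^T R_i = I and R_i R_i^T = I are equivalent; the second
  describes a diagonal block of R R^T.\<close>

lemma block_orth_iff:
  "block_orth n d R \<longleftrightarrow> R \<in> carrier_mat (n*d) d \<and>
    (\<forall>i<n. \<forall>a<d. \<forall>b<d. (\<Sum>c<d. R $$ (i*d+a, c) * R $$ (i*d+b, c)) = (if a = b then 1 else 0))"
proof -
  have "(let Ri = mat d d (\<lambda>(a,b). R $$ (i*d+a, b)) in Ri\<^sup>T * Ri = 1\<^sub>m d) \<longleftrightarrow>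
    (\<forall>a<d. \<forall>b<d. (\<Sum>c<d. R $$ (i*d+a, c) * R $$ (i*d+b, c)) = (if a = b then 1 else 0))" for i
  proof -
    define Ri where "Ri = mat d d (\<lambda>(a,b). R $$ (i*d+a, b))"
    have Ri: "Ri \<in> carrier_mat d d" by (simp add: Ri_def)
    have "Ri\<^sup>T * Ri = 1\<^sub>m d \<longleftrightarrow> Ri * Ri\<^sup>T = 1\<^sub>m d"
      using mat_mult_left_right_inverse[of Ri d "Ri\<^sup>T"] mat_mult_left_right_inverse[of "Ri\<^sup>T" d Ri] Ri by auto
    also have "\<dots> \<longleftrightarrow> (\<forall>a<d. \<forall>b<d. (Ri * Ri\<^sup>T) $$ (a, b) = (if a = b then 1 else 0))"
    proof
      assume "\<forall>a<d. \<forall>b<d. (Ri * Ri\<^sup>T) $$ (a, b) = (if a = b then 1 else 0)"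
      then show "Ri * Ri\<^sup>T = 1\<^sub>m d" using Ri by (intro eq_matI) auto
    qed simp
    also have "\<dots> \<longleftrightarrow> (\<forall>a<d. \<forall>b<d. (\<Sum>c<d. R $$ (i*d+a, c) * R $$ (i*d+b, c)) = (if a = b then 1 else 0))"
      by (simp add: mult_transpose_entry[OF Ri] del: index_mult_mat) (simp add: Ri_def)
    finally show ?thesis by (simp add: Ri_def Let_def)
  qed
  then show ?thesis by (simp add: block_orth_def)
qed

text \<open>The semidefinite program relaxes the orthogonal problem, so an optimum of the form R R^T
  solves both.\<close>

lemma block_orth_feasible:
  assumes d: "d > 0" and R: "block_orth n d R"
  shows "sdp_feasible n d (R * R\<^sup>T)"
proof -
  let ?N = "n*d"
  have RC: "R \<in> carrier_mat ?N d" using R by (simp add: block_orth_def)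
  have ent: "entries (R * R\<^sup>T) p q = (\<Sum>b<d. R $$ (p, b) * R $$ (q, b))" if "p < ?N" "q < ?N" for p q
    unfolding entries_def using mult_transpose_entry[OF RC that] .
  have "bilin ?N (entries (R * R\<^sup>T)) u u = (\<Sum>b<d. (\<Sum>p<?N. R $$ (p, b) * u p)\<^sup>2)" for u
  proof -
    have "bilin ?N (entries (R * R\<^sup>T)) u u = (\<Sum>p<?N. \<Sum>q<?N. \<Sum>b<d. (R $$ (p, b) * u p) * (R $$ (q, b) * u q))"
      unfolding bilin_eq
      by (intro sum.cong refl) (simp add: ent sum_distrib_left sum_distrib_right algebra_simps)
    also have "\<dots> = (\<Sum>p<?N. \<Sum>b<d. \<Sum>q<?N. (R $$ (p, b) * u p) * (R $$ (q, b) * u q))"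
      by (intro sum.cong refl sum.swap)
    also have "\<dots> = (\<Sum>b<d. \<Sum>p<?N. \<Sum>q<?N. (R $$ (p, b) * u p) * (R $$ (q, b) * u q))"
      by (rule sum.swap)
    finally show ?thesis by (simp add: power2_eq_square sum_product)
  qed
  then have "psd_upto ?N (entries (R * R\<^sup>T))"
    by (auto simp: psd_upto_def sym_upto_def ent mult.commute intro: sum_nonneg)
  then have "psd ?N (R * R\<^sup>T)" using RC by (simp add: psd_iff)
  moreover have "(R * R\<^sup>T) $$ (i*d+a, i*d+b) = (if a = b then 1 else 0)" if "i < n" "a < d" "b < d" for i a b
    using R that unfolding mult_transpose_entry[OF RC block_less[OF that(1,2)] block_less[OF that(1,3)]]
    by (simp add: block_orth_iff)
  ultimately show ?thesis by (simp add: sdp_feasible_def)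
qed

text \<open>The first block column of R R^T is R R_0^T with R_0 the first block of R, and R_0^T R_0
  = I cancels in its product with its transpose.\<close>

lemma factored_block_orth:
  assumes n: "n > 0" and R: "block_orth n d R"
  shows "factored n d (entries (R * R\<^sup>T))"
  unfolding factored_def
proof (intro allI impI)
  let ?N = "n*d"
  fix p q assume p: "p < ?N" and q: "q < ?N"
  have RC: "R \<in> carrier_mat ?N d" using R by (simp add: block_orth_def)
  have le: "b < ?N" if "b < d" for b using block_less[OF n that] by simp
  have orth: "(\<Sum>b<d. R $$ (b, c) * R $$ (b, e)) = (if c = e then 1 else 0)" if "c < d" "e < d" for c e
  proof -
    define R0 where "R0 = mat d d (\<lambda>(a,b). R $$ (a, b))"
    have "R0\<^sup>T * R0 = 1\<^sub>m d" using R n by (force simp: block_orth_def R0_def Let_def)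
    moreover have "(R0\<^sup>T * R0) $$ (c, e) = (\<Sum>b<d. R $$ (b, c) * R $$ (b, e))"
      using that by (simp add: R0_def scalar_prod_def lessThan_atLeast0)
    ultimately show ?thesis using that by simp
  qed
  have "(\<Sum>b<d. entries (R * R\<^sup>T) p b * entries (R * R\<^sup>T) q b)
      = (\<Sum>b<d. \<Sum>c<d. \<Sum>e<d. R $$ (p, c) * R $$ (q, e) * (R $$ (b, c) * R $$ (b, e)))"
    using p q le by (intro sum.cong refl)
      (simp add: entries_def mult_transpose_entry[OF RC] sum_product algebra_simps del: index_mult_mat)
  also have "\<dots> = (\<Sum>c<d. \<Sum>b<d. \<Sum>e<d. R $$ (p, c) * R $$ (q, e) * (R $$ (b, c) * R $$ (b, e)))"
    by (rule sum.swap)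
  also have "\<dots> = (\<Sum>c<d. \<Sum>e<d. \<Sum>b<d. R $$ (p, c) * R $$ (q, e) * (R $$ (b, c) * R $$ (b, e)))"
    by (intro sum.cong refl sum.swap)
  also have "\<dots> = (\<Sum>c<d. \<Sum>e<d. if e = c then R $$ (p, c) * R $$ (q, c) else 0)"
    by (intro sum.cong refl) (auto simp: orth simp flip: sum_distrib_left)
  also have "\<dots> = entries (R * R\<^sup>T) p q"
    by (simp add: entries_def mult_transpose_entry[OF RC p q] del: index_mult_mat)
  finally show "entries (R * R\<^sup>T) p q = (\<Sum>b<d. entries (R * R\<^sup>T) p b * entries (R * R\<^sup>T) q b)" by simp
qed

lemma factored_trunc:
  assumes n: "n > 0" and f: "factored n d f"
  shows "factored n d (trunc (n*d) f)"
  unfolding factored_def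
proof (intro allI impI)
  fix p q assume pq: "p < n*d" "q < n*d"
  have le: "b < n*d" if "b < d" for b using block_less[OF n that] by simp
  have "trunc (n*d) f p q = f p q" using pq by (simp add: trunc_def)
  also have "\<dots> = (\<Sum>b<d. f p b * f q b)" using f pq unfolding factored_def by blast
  also have "\<dots> = (\<Sum>b<d. trunc (n*d) f p b * trunc (n*d) f q b)"
    using pq le by (intro sum.cong refl) (simp add: trunc_def)
  finally show "trunc (n*d) f p q = (\<Sum>b<d. trunc (n*d) f p b * trunc (n*d) f q b)" .
qed

lemma factored_factor:
  assumes d: "d > 0" and f: "feasible_fun n d f" and r: "factored n d f"
  defines "R \<equiv> mat (n*d) d (\<lambda>(p, b). f p b)"
  shows "block_orth n d R" and "to_mat (n*d) f = R * R\<^sup>T"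
proof -
  have RC: "R \<in> carrier_mat (n*d) d" by (simp add: R_def)
  have RR: "(\<Sum>b<d. R $$ (p, b) * R $$ (q, b)) = f p q" if "p < n*d" "q < n*d" for p q
    using r that by (simp add: R_def factored_def)
  show "block_orth n d R"
    unfolding block_orth_iff using RC f
    by (auto simp: RR block_less feasible_fun_def)
  show "to_mat (n*d) f = R * R\<^sup>T"
    using RC by (intro eq_matI) (auto simp: to_mat_def mult_transpose_entry RR simp del: index_mult_mat(1))
qed

text \<open>An equivalence is proved, not only the implication that gives tightness, because the
  event of \<open>good_event\<close> inherits its measurability from that of
  \<open>sdp_tight\<close>.\<close>

lemma good_event_iff:
  assumes n: "n > 0" and d: "d > 0"
  shows "good_event n d \<sigma> g \<longleftrightarrow> sdp_tight n d \<sigma> g"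
proof -
  let ?N = "n*d" and ?A = "Amat n d \<sigma> g"
  note sol = sdp_solution_Amat[OF d, of n \<sigma> g]
  have sol_to_mat: "sdp_solution n d ?A (to_mat ?N f) \<longleftrightarrow> optimal_fun n d (data_mat d \<sigma> g) f" for f
    unfolding sol using opt_cong[of n d "data_mat d \<sigma> g" "data_mat d \<sigma> g" "entries (to_mat ?N f)" f] by (simp add: entries_to_mat)
  have trunc_opt: "trunc ?N (entries X) \<in> feasible_fun_set n d" "optimal_fun n d (data_mat d \<sigma> g) (trunc ?N (entries X))"
    if "sdp_solution n d ?A X" for X
  proof -
    have o: "optimal_fun n d (data_mat d \<sigma> g) (entries X)" using that sol by blast
    then show "trunc ?N (entries X) \<in> feasible_fun_set n d" by (simp add: optimal_fun_def trunc_feasible_fun)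
    show "optimal_fun n d (data_mat d \<sigma> g) (trunc ?N (entries X))"
      using o opt_cong[of n d "data_mat d \<sigma> g" "data_mat d \<sigma> g" "trunc ?N (entries X)" "entries X"] by (simp add: trunc_def)
  qed
  have to_mat_inj: "f = h" if "f \<in> feasible_fun_set n d" "h \<in> feasible_fun_set n d" "to_mat ?N f = to_mat ?N h" for f h
  proof (intro ext)
    fix p q
    show "f p q = h p q"
    proof (cases "p < ?N \<and> q < ?N")
      case True
      then show ?thesis using that(3) entries_to_mat[of p ?N q f] entries_to_mat[of p ?N q h] by simp
    next
      case False
      then show ?thesis using that by (simp add: feasible_fun_set_def)
    qed
  qed
  show ?thesis
  proof
    assume good: "good_event n d \<sigma> g"
    then obtain X where X: "sdp_solution n d ?A X" by (auto simp: good_event_def)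
    then obtain R where R: "block_orth n d R" "X = R * R\<^sup>T"
      using good by (auto simp: good_event_def od_solution_def)
    have "factored n d (entries X)" unfolding R(2) by (rule factored_block_orth[OF n R(1)])
    then have "factored n d (trunc ?N (entries X))" by (rule factored_trunc[OF n])
    then have "\<exists>f\<in>feasible_fun_set n d. factored n d f \<and> optimal_fun n d (data_mat d \<sigma> g) f" using trunc_opt[OF X] by blast
    moreover have "f = h" if "f \<in> feasible_fun_set n d" "h \<in> feasible_fun_set n d" "optimal_fun n d (data_mat d \<sigma> g) f" "optimal_fun n d (data_mat d \<sigma> g) h" for f h
    proof -
      have "sdp_solution n d ?A (to_mat ?N f)" "sdp_solution n d ?A (to_mat ?N h)" using that by (simp_all add: sol_to_mat)
      then have "to_mat ?N f = to_mat ?N h" using good unfolding good_event_def by blast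
      then show ?thesis using to_mat_inj that by blast
    qed
    ultimately show "sdp_tight n d \<sigma> g" unfolding sdp_tight_def by (intro conjI ballI impI)
  next
    assume t: "sdp_tight n d \<sigma> g"
    then obtain f where f: "f \<in> feasible_fun_set n d" "factored n d f" "optimal_fun n d (data_mat d \<sigma> g) f"
      by (auto simp: sdp_tight_def)
    have unique: "X = to_mat ?N f" if X: "sdp_solution n d ?A X" for X
    proof -
      have "trunc ?N (entries X) = f" using t f trunc_opt[OF X] unfolding sdp_tight_def by blast
      then have "to_mat ?N f = to_mat ?N (entries X)" by (auto simp: to_mat_def trunc_def)
      then show ?thesis using X to_mat_entries by (simp add: sol)
    qed
    have ff: "feasible_fun n d f" using f by (simp add: feasible_fun_set_def)
    define R where "R = mat (n*d) d (\<lambda>(p, b). f p b)"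
    have R: "block_orth n d R" "to_mat ?N f = R * R\<^sup>T"
      unfolding R_def using factored_factor[OF d ff f(2)] by auto
    have od: "od_solution n d ?A R"
      unfolding od_solution_def
    proof (intro conjI R allI impI)
      fix R' assume "block_orth n d R'"
      then have "frob ?N ?A (R' * R'\<^sup>T) \<le> frob ?N ?A (R * R\<^sup>T)"
        using block_orth_feasible[OF d] f(3) sol_to_mat[of f] unfolding R(2) sdp_solution_def by blast
      then show "frob ?N (R' * R'\<^sup>T) ?A \<le> frob ?N (R * R\<^sup>T) ?A"
        by (simp add: frob_eq_frob_upto frob_upto_commute[of _ _ "entries ?A"])
    qed
    have "vec_space.rank ?N (to_mat ?N f) = d"
    proof (rule vec_space.rank_eq_leading_columns[OF to_mat_carrier])
      have le: "b < ?N" if "b < d" for b using block_less[OF n that] by simp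
      show "d \<le> ?N" using n by simp
      show "to_mat ?N f $$ (a, b) = (if a = b then 1 else 0)" if "a < d" "b < d" for a b
        using ff that le by (simp add: to_mat_def feasible_fun_def)
      have sym: "f b q = f q b" if "b < d" "q < ?N" for b q
        using ff that le by (simp add: feasible_fun_def psd_upto_def sym_upto_def)
      show "to_mat ?N f $$ (p, q) = (\<Sum>b<d. to_mat ?N f $$ (p, b) * to_mat ?N f $$ (b, q))" if "p < ?N" "q < ?N" for p q
      proof -
        have "f p q = (\<Sum>b<d. f p b * f q b)" using f(2) that by (simp add: factored_def)
        also have "\<dots> = (\<Sum>b<d. to_mat ?N f $$ (p, b) * to_mat ?N f $$ (b, q))"
        proof (rule sum.cong[OF refl])
          fix b assume "b \<in> {..<d}"
          then show "f p b * f q b = to_mat ?N f $$ (p, b) * to_mat ?N f $$ (b, q)"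
            using that le[of b] sym[of b q] by (simp add: to_mat_def)
        qed
        finally show ?thesis using that by (simp add: to_mat_def)
      qed
    qed
    then have "vec_space.rank ?N X = d \<and> (\<exists>R. od_solution n d ?A R \<and> X = R * R\<^sup>T)"
      if "sdp_solution n d ?A X" for X
      unfolding unique[OF that] using od R(2) by blast
    moreover have "sdp_solution n d ?A (to_mat ?N f)" using f(3) sol_to_mat by blast
    then have "\<exists>!X. sdp_solution n d ?A X" by (rule ex1I) (rule unique)
    ultimately show "good_event n d \<sigma> g" unfolding good_event_def by blast
  qed
qed

theorem theorem2:
  shows "\<exists>C\<^sub>0 > 0. \<exists>\<delta> :: nat \<Rightarrow> real. \<delta> \<longlonglongrightarrow> 0 \<and>
    (\<forall>n d :: nat. \<forall>\<sigma> :: real. n \<ge> 1 \<longrightarrow> d \<ge> 1 \<longrightarrow> \<sigma> > 0 \<longrightarrow>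
       \<sigma> \<le> C\<^sub>0 * real n powr (1/4) / real d powr (3/4) \<longrightarrow>
       measure (gauss_space n d) {g \<in> space (gauss_space n d). good_event n d \<sigma> g}
         \<ge> 1 - \<delta> n)"
proof (intro exI conjI allI impI)
  show "(1 / 1000 :: real) > 0" by simp
  \<comment> \<open>The failure probability of the noise event; it depends on n only, so the limit
    is uniform in d and \<sigma>.\<close>
  show "(\<lambda>n. 2 * exp (- real n) + 2 * real n * exp (- sqrt n)) \<longlonglongrightarrow> 0" by real_asymp
  fix n d :: nat and \<sigma> :: real
  assume n: "n \<ge> 1" and d: "d \<ge> 1" and \<sigma>: "\<sigma> > 0"
    and le: "\<sigma> \<le> 1 / 1000 * real n powr (1/4) / real d powr (3/4)"
  have n0: "n > 0" and d0: "d > 0" using n d by auto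
  interpret prob_space "gauss_space n d"
    unfolding gauss_space_def by (intro prob_space_PiM std_gauss.prob_space_axioms)
  obtain E where E: "E \<in> events" "prob E \<le> 2 * exp (- real n) + 2 * real n * exp (- sqrt n)"
    and noise: "\<forall>g\<in>space (gauss_space n d) - E.
      (\<forall>u v. \<bar>bilin (n*d) (noise_mat d g) u v\<bar> \<le> 40 * sqrt (real n * real d) * norm_upto (n*d) u * norm_upto (n*d) v) \<and>
      (\<forall>i<n. \<forall>x y. \<bar>bilin (n*d) (noise_mat d g) (stack d y) (block_vec d i x)\<bar>
         \<le> 40 * sqrt (real n * real d * sqrt (real n * real d)) * norm_upto d x * norm_upto d y)"
    using noise_event[OF n0 d0] by blast
  note lev = noise_level_bounds[OF n0 d0 \<sigma> le]
  have "sdp_tight n d \<sigma> g" if g: "g \<in> space (gauss_space n d) - E" for g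
  proof (rule sdp_tight_if_noise_bounded[OF n0 d0 \<sigma> _ _ _ _ lev])
    show "\<bar>bilin (n*d) (noise_mat d g) u v\<bar> \<le> 40 * sqrt (real n * real d) * norm_upto (n*d) u * norm_upto (n*d) v" for u v
      using noise g by blast
    show "\<bar>bilin (n*d) (noise_mat d g) (stack d y) (block_vec d i x)\<bar>
        \<le> 40 * sqrt (real n * real d * sqrt (real n * real d)) * norm_upto d x * norm_upto d y" if "i < n" for i x y
      using noise g that by blast
  qed auto
  then have "space (gauss_space n d) - E \<subseteq> {g \<in> space (gauss_space n d). sdp_tight n d \<sigma> g}" by blast
  then have "prob (space (gauss_space n d) - E) \<le> prob {g \<in> space (gauss_space n d). sdp_tight n d \<sigma> g}"
    by (rule finite_measure_mono) (rule sdp_tight_measurable)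
  then show "measure (gauss_space n d) {g \<in> space (gauss_space n d). good_event n d \<sigma> g}
      \<ge> 1 - (2 * exp (- real n) + 2 * real n * exp (- sqrt n))"
    using E by (simp add: prob_compl good_event_iff[OF n0 d0])
qed

end
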